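(* Let $1<q<2$. Let $V:\mathbb R^2\to\mathbb R$ be a continuous function such that there is a constant $V_0>0$ with $V_0\le V(x)$ for all $x\in\mathbb R^2$, and such that $1/V\in L^1(\mathbb R^2)$. Let $f:\mathbb R\to\mathbb R$ be an odd continuous function with $f(0)=0$ and $f(t)\ge 0$ for all $t\ge 0$, and suppose there exists $\nu>1$ such that $\lim_{t\to 0} f(t)/|t|^{\nu}=0$. Then there exists $\Lambda_1>0$ such that for each $\lambda\in(0,\Lambda_1)$ the problem $$-\Delta u+V(x)u=f(u)+\lambda|u|^{q-2}u\quad\text{in }\mathbb R^2,\qquad u\in H^1(\mathbb R^2),\quad \int_{\mathbb R^2}V(x)|u|^2\,dx<\infty,$$ has at least one positive solution with negative energy, that is, a weak solution $u>0$ with $\mathcal J(u)<0$.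
   Context: No growth restriction at infinity is imposed on $f$. A (weak) solution is a function $u\in H^1(\mathbb R^2)$ with $\int_{\mathbb R^2}V(x)|u|^2\,dx<\infty$ and $f(u)\in L^1_{\mathrm{loc}}(\mathbb R^2)$ such that $\int_{\mathbb R^2}\nabla u\cdot\nabla\eta\,dx+\int_{\mathbb R^2}V(x)u\eta\,dx=\int_{\mathbb R^2}(f(u)+\lambda|u|^{q-2}u)\eta\,dx$ for all $\eta\in C_c^\infty(\mathbb R^2)$. With $F(t)=\int_0^t f(s)\,ds$, the energy of $u$ is $$\mathcal J(u)=\frac12\int_{\mathbb R^2}|\nabla u|^2\,dx+\frac12\int_{\mathbb R^2}V(x)|u|^2\,dx-\int_{\mathbb R^2}F(u)\,dx-\frac{\lambda}{q}\int_{\mathbb R^2}|u|^q\,dx ,$$ and "negative energy" means that $F(u)\in L^1(\mathbb R^2)$ and $\mathcal J(u)<0$. *)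

theory Defs
  imports "HOL-Analysis.Analysis"
begin

(* Functions in L^2, H^1 etc. are represented by pointwise defined, Lebesgue measurable
   functions rather than by classes modulo null sets. *)

primrec Ck :: "nat \<Rightarrow> ('a::real_normed_vector \<Rightarrow> 'b::real_normed_vector) \<Rightarrow> bool" where
  "Ck 0 f \<longleftrightarrow> continuous_on UNIV f"
| "Ck (Suc k) f \<longleftrightarrow> (\<forall>x. f differentiable (at x)) \<and>
     (\<forall>v. Ck k (\<lambda>x. frechet_derivative f (at x) v))"

definition test_function :: "('a::euclidean_space \<Rightarrow> real) \<Rightarrow> bool" where
  "test_function \<phi> \<longleftrightarrow> (\<forall>k. Ck k \<phi>) \<and> compact (closure {x. \<phi> x \<noteq> 0})"

definition gradient :: "('a::euclidean_space \<Rightarrow> real) \<Rightarrow> 'a \<Rightarrow> 'a" where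
  "gradient \<phi> x = (\<Sum>b\<in>Basis. frechet_derivative \<phi> (at x) b *\<^sub>R b)"

definition locally_integrable :: "('a::euclidean_space \<Rightarrow> 'b::euclidean_space) \<Rightarrow> bool" where
  "locally_integrable f \<longleftrightarrow> (\<forall>K. compact K \<longrightarrow> f absolutely_integrable_on K)"

definition square_integrable :: "('a::euclidean_space \<Rightarrow> 'b::euclidean_space) \<Rightarrow> bool" where
  "square_integrable f \<longleftrightarrow>
     f \<in> borel_measurable lebesgue \<and> integrable lebesgue (\<lambda>x. (norm (f x))\<^sup>2)"

definition has_weak_gradient ::
    "('a::euclidean_space \<Rightarrow> real) \<Rightarrow> ('a \<Rightarrow> 'a) \<Rightarrow> bool" where
  "has_weak_gradient u g \<longleftrightarrow> locally_integrable u \<and> locally_integrable g \<and>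
     (\<forall>\<phi>. test_function \<phi> \<longrightarrow> (\<forall>b\<in>Basis.
        (LINT x|lebesgue. u x * (gradient \<phi> x \<bullet> b)) = - (LINT x|lebesgue. (g x \<bullet> b) * \<phi> x)))"

(* A weak gradient is unique almost everywhere, so the choice below is irrelevant
   under an integral. *)
definition weak_gradient :: "('a::euclidean_space \<Rightarrow> real) \<Rightarrow> 'a \<Rightarrow> 'a" where
  "weak_gradient u = (SOME g. has_weak_gradient u g)"

definition sobolev_H1 :: "('a::euclidean_space \<Rightarrow> real) set" where
  "sobolev_H1 = {u. square_integrable u \<and> (\<exists>g. has_weak_gradient u g \<and> square_integrable g)}"

(* Since 0 powr a = 0, the term |u|^(q-2) u is read as 0 where u vanishes. *)
definition weak_solution ::
    "('a::euclidean_space \<Rightarrow> real) \<Rightarrow> (real \<Rightarrow> real) \<Rightarrow> real \<Rightarrow> real \<Rightarrow> ('a \<Rightarrow> real) \<Rightarrow> bool" where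
  "weak_solution V f q lam u \<longleftrightarrow>
     u \<in> sobolev_H1 \<and>
     integrable lebesgue (\<lambda>x. V x * \<bar>u x\<bar>\<^sup>2) \<and>
     locally_integrable (\<lambda>x. f (u x)) \<and>
     (\<forall>\<eta>. test_function \<eta> \<longrightarrow>
        (LINT x|lebesgue. weak_gradient u x \<bullet> gradient \<eta> x) + (LINT x|lebesgue. V x * u x * \<eta> x)
        = (LINT x|lebesgue. (f (u x) + lam * \<bar>u x\<bar> powr (q - 2) * u x) * \<eta> x))"

(* The interval integral is oriented: for t < 0 this is minus the integral over [t, 0]. *)
definition primitive :: "(real \<Rightarrow> real) \<Rightarrow> real \<Rightarrow> real" where
  "primitive f t = (LBINT s=ereal 0..ereal t. f s)"

definition energy ::
    "('a::euclidean_space \<Rightarrow> real) \<Rightarrow> (real \<Rightarrow> real) \<Rightarrow> real \<Rightarrow> real \<Rightarrow> ('a \<Rightarrow> real) \<Rightarrow> real" where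
  "energy V f q lam u =
     1/2 * (LINT x|lebesgue. (norm (weak_gradient u x))\<^sup>2)
     + 1/2 * (LINT x|lebesgue. V x * \<bar>u x\<bar>\<^sup>2)
     - (LINT x|lebesgue. primitive f (u x))
     - lam / q * (LINT x|lebesgue. \<bar>u x\<bar> powr q)"

(* Only the integrability of F(u) has to be demanded. For a weak solution the first two
   integrals of the energy converge by definition, and the last one converges when
   1/V is integrable and 1 < q < 2, because then u lies in both L^1 and L^2. *)
definition negative_energy ::
    "('a::euclidean_space \<Rightarrow> real) \<Rightarrow> (real \<Rightarrow> real) \<Rightarrow> real \<Rightarrow> real \<Rightarrow> ('a \<Rightarrow> real) \<Rightarrow> bool" where
  "negative_energy V f q lam u \<longleftrightarrow>
     integrable lebesgue (\<lambda>x. primitive f (u x)) \<and> energy V f q lam u < 0"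

end

theory Submission
  imports Defs "HOL-Complex_Analysis.Great_Picard"
begin

text \<open>
  The theorem is proved by minimisation of a truncated energy over compactly supported functions of
  class \<open>C\<^sup>1\<close>, in any Euclidean space.

  Since \<open>f(t)\<close> is \<open>o(t)\<close> at \<open>0\<close>, there is a small \<open>M > 0\<close> with \<open>f(M) \<le> V\<^sub>0 M / 4\<close>, and if \<open>\<lambda>\<close> is small then also
  \<open>\<lambda> M\<^sup>q\<^sup>-\<^sup>1 \<le> V\<^sub>0 M / 4\<close>. So the constant \<open>M\<close> is a supersolution. Let \<open>g\<close> be the nonlinearity, kept constant
  above \<open>M\<close> and put to \<open>0\<close> below \<open>0\<close>, and \<open>G\<close> its primitive. Whatever the growth of \<open>f\<close> at infinity, \<open>g\<close> is
  bounded, and the truncated energy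
  \<open>J(u) = \<integral> |\<nabla>u|\<^sup>2 / 2 + \<integral> V u\<^sup>2 / 2 - \<integral> G(u)\<close>
  is coercive, because \<open>\<integral> |u|\<close> is at most \<open>(\<integral> 1/V)\<^sup>1\<^sup>/\<^sup>2 (\<integral> V u\<^sup>2)\<^sup>1\<^sup>/\<^sup>2\<close>.

  Existence of a minimiser (\<open>minimizing_sequence\<close>): sets that are bounded in the energy norm are precompact in
  \<open>L\<^sup>1\<close> (\<open>L1_compactness\<close>), by a Rellich--Kondrachov argument on balls and the integrability of \<open>1/V\<close> at
  infinity. Since \<open>\<integral> G(u)\<close> is Lipschitz in the \<open>L\<^sup>1\<close> norm, the parallelogram law shows that a minimising sequence
  which is Cauchy in \<open>L\<^sup>1\<close> is Cauchy in the energy norm (\<open>E_diff_le\<close>). Hence the minimiser \<open>u\<close> is a strong limit of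
  \<open>C\<^sup>1\<close> functions, its weak gradient is the limit of their gradients, and the equation \<open>-\<Delta>u + V u = g(u)\<close> follows
  by differentiating \<open>J\<close> (\<open>Euler_Lagrange\<close>).

  The minimiser takes its values in \<open>[0, M]\<close> (\<open>minimizer_bounds\<close>): a \<open>C\<^sup>1\<close> contraction towards this interval would
  otherwise lower the energy. On \<open>[0, M]\<close> nothing was truncated, so \<open>u\<close> solves the original problem and has the
  original energy. This energy is negative (\<open>inf_J_negative\<close>), since for small functions the sublinear power
  dominates the quadratic part. In particular \<open>u\<close> is not zero.

  Strict positivity (\<open>strictly_positive_or_zero\<close>): testing with \<open>\<eta>\<^sup>2/(u + \<delta>)\<close> bounds the gradient of \<open>ln (u + \<delta>)\<close>
  locally in \<open>L\<^sup>2\<close>, uniformly in \<open>\<delta>\<close>. Hence the increments \<open>ln (u(x + h) + \<delta>) - ln (u(x) + \<delta>)\<close> are bounded in \<open>L\<^sup>2\<close>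
  of balls, and letting \<open>\<delta>\<close> tend to \<open>0\<close> excludes that \<open>u(x) = 0 < u(x + h)\<close> on a set of positive measure. By Fubini's
  theorem \<open>u\<close> is then either positive almost everywhere or zero almost everywhere.

  Finally, the energy is defined with a chosen representative of the weak gradient. Weak gradients are unique
  almost everywhere (\<open>weak_gradient_unique\<close>), which needs an explicit supply of smooth bump functions.
\<close>

section \<open>Square-integrable functions\<close>

definition L2 :: "'a measure \<Rightarrow> ('a \<Rightarrow> 'b::euclidean_space) \<Rightarrow> bool" where
  "L2 M f \<longleftrightarrow> f \<in> borel_measurable M \<and> integrable M (\<lambda>x. (norm (f x))\<^sup>2)"

lemma L2_integrable: "L2 M f \<Longrightarrow> integrable M (\<lambda>x. (norm (f x))\<^sup>2)"
  by (simp add: L2_def)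

lemma L2_bound:
  fixes f :: "'a \<Rightarrow> 'b::euclidean_space" and g :: "'a \<Rightarrow> 'c::euclidean_space"
  assumes "L2 M g" and [measurable]: "f \<in> borel_measurable M"
    and "AE x in M. norm (f x) \<le> K * norm (g x)"
  shows "L2 M f"
proof -
  have "integrable M (\<lambda>x. K\<^sup>2 * (norm (g x))\<^sup>2)"
    using assms(1) by (auto simp: L2_def)
  then have "integrable M (\<lambda>x. (norm (f x))\<^sup>2)"
  proof (rule Bochner_Integration.integrable_bound)
    show "AE x in M. norm ((norm (f x))\<^sup>2) \<le> norm (K\<^sup>2 * (norm (g x))\<^sup>2)"
      using assms(3)
    proof eventually_elim
      case (elim x)
      then have "(norm (f x))\<^sup>2 \<le> (K * norm (g x))\<^sup>2" by (intro power_mono) auto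
      then show ?case by (simp add: power_mult_distrib)
    qed
  qed measurable
  then show ?thesis by (simp add: L2_def)
qed

lemma norm_add_square_le: "(norm (a + b))\<^sup>2 \<le> 2 * (norm a)\<^sup>2 + 2 * (norm b)\<^sup>2"
  for a b :: "'a::real_normed_vector"
proof -
  have "(norm (a + b))\<^sup>2 \<le> (norm a + norm b)\<^sup>2"
    by (intro power_mono norm_triangle_ineq) auto
  also have "\<dots> \<le> 2 * (norm a)\<^sup>2 + 2 * (norm b)\<^sup>2"
    using sum_squares_bound[of "norm a" "norm b"] by (simp add: power2_sum)
  finally show ?thesis .
qed

lemma L2_add:
  assumes "L2 M f" "L2 M g" shows "L2 M (\<lambda>x. f x + g x)"
proof -
  have [measurable]: "f \<in> borel_measurable M" "g \<in> borel_measurable M"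
    using assms by (auto simp: L2_def)
  have "integrable M (\<lambda>x. 2 * (norm (f x))\<^sup>2 + 2 * (norm (g x))\<^sup>2)"
    using assms by (auto simp: L2_def)
  then have "integrable M (\<lambda>x. (norm (f x + g x))\<^sup>2)"
    by (rule Bochner_Integration.integrable_bound) (auto simp: norm_add_square_le)
  then show ?thesis by (simp add: L2_def)
qed

lemma L2_scaleR: "L2 M f \<Longrightarrow> L2 M (\<lambda>x. c *\<^sub>R f x)"
  by (rule L2_bound[where K="\<bar>c\<bar>"]) (auto simp: L2_def)

lemma L2_diff:
  assumes "L2 M f" "L2 M g" shows "L2 M (\<lambda>x. f x - g x)"
  using L2_add[OF assms(1) L2_scaleR[OF assms(2), of "-1"]] by simp

lemma L2_bounded_mult:
  fixes f :: "'a \<Rightarrow> 'b::euclidean_space"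
  assumes "L2 M f" and [measurable]: "c \<in> borel_measurable M" and "AE x in M. \<bar>c x\<bar> \<le> K"
  shows "L2 M (\<lambda>x. c x *\<^sub>R f x)"
proof -
  have [measurable]: "f \<in> borel_measurable M" using assms by (auto simp: L2_def)
  show ?thesis
    by (rule L2_bound[OF assms(1), of _ K])
       (use assms(3) in \<open>auto elim!: eventually_mono simp: mult_right_mono\<close>)
qed

lemma L2_norm: "L2 M f \<Longrightarrow> L2 M (\<lambda>x. norm (f x))"
  by (auto simp: L2_def)

lemma L2_inner_integrable:
  assumes "L2 M f" "L2 M g" shows "integrable M (\<lambda>x. f x \<bullet> g x)"
proof -
  have [measurable]: "f \<in> borel_measurable M" "g \<in> borel_measurable M"
    using assms by (auto simp: L2_def)
  have "integrable M (\<lambda>x. (norm (f x))\<^sup>2 + (norm (g x))\<^sup>2)"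
    using assms by (auto simp: L2_def)
  then show ?thesis
  proof (rule Bochner_Integration.integrable_bound)
    show "AE x in M. norm (f x \<bullet> g x) \<le> norm ((norm (f x))\<^sup>2 + (norm (g x))\<^sup>2)"
    proof (intro always_eventually allI)
      fix x
      have "\<bar>f x \<bullet> g x\<bar> \<le> norm (f x) * norm (g x)" by (rule Cauchy_Schwarz_ineq2)
      also have "\<dots> \<le> (norm (f x))\<^sup>2 + (norm (g x))\<^sup>2"
        using sum_squares_bound[of "norm (f x)" "norm (g x)"]
          mult_nonneg_nonneg[OF norm_ge_zero norm_ge_zero, of "f x" "g x"] by linarith
      finally show "norm (f x \<bullet> g x) \<le> norm ((norm (f x))\<^sup>2 + (norm (g x))\<^sup>2)" by simp
    qed
  qed measurable
qed

lemma L2_mult_integrable: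
  fixes f g :: "'a \<Rightarrow> real"
  shows "L2 M f \<Longrightarrow> L2 M g \<Longrightarrow> integrable M (\<lambda>x. f x * g x)"
  using L2_inner_integrable[of M f g] by simp

text \<open>The quadratic \<open>s \<mapsto> \<integral> |s f - g|\<^sup>2\<close> is nonnegative; its discriminant gives the inequality.\<close>

lemma L2_Cauchy_Schwarz:
  assumes f: "L2 M f" and g: "L2 M g"
  shows "\<bar>LINT x|M. f x \<bullet> g x\<bar> \<le> sqrt (LINT x|M. (norm (f x))\<^sup>2) * sqrt (LINT x|M. (norm (g x))\<^sup>2)"
proof -
  define a b c where "a = (LINT x|M. (norm (f x))\<^sup>2)" and "b = (LINT x|M. f x \<bullet> g x)"
    and "c = (LINT x|M. (norm (g x))\<^sup>2)"
  note [simp] = L2_inner_integrable[OF f g] L2_integrable[OF f] L2_integrable[OF g]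
  have q: "0 \<le> s\<^sup>2 * a - 2 * s * b + c" for s
  proof -
    have "0 \<le> (LINT x|M. (norm (s *\<^sub>R f x - g x))\<^sup>2)" by simp
    also have "\<dots> = (LINT x|M. s\<^sup>2 * (norm (f x))\<^sup>2 - 2 * s * (f x \<bullet> g x) + (norm (g x))\<^sup>2)"
      by (intro Bochner_Integration.integral_cong refl)
         (simp only: power2_norm_eq_inner, simp add: inner_diff_left inner_diff_right inner_commute power2_eq_square algebra_simps)
    also have "\<dots> = s\<^sup>2 * a - 2 * s * b + c" by (simp add: a_def b_def c_def)
    finally show ?thesis .
  qed
  have a: "0 \<le> a" "0 \<le> c" by (auto simp: a_def c_def)
  have "b\<^sup>2 \<le> a * c"
  proof (cases "a = 0")
    case True
    have "b = 0"
    proof (rule ccontr)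
      assume "b \<noteq> 0"
      then have "2 * ((c + 1) / (2 * b)) * b = c + 1" by simp
      with q[of "(c + 1) / (2 * b)"] True show False by simp
    qed
    then show ?thesis using True by simp
  next
    case False
    with a have "a > 0" by simp
    have "0 \<le> (b / a)\<^sup>2 * a - 2 * (b / a) * b + c" using q[of "b / a"] by simp
    also have "\<dots> = c - b\<^sup>2 / a" using \<open>a > 0\<close> by (simp add: field_simps power2_eq_square)
    finally show ?thesis using \<open>a > 0\<close> by (simp add: field_simps)
  qed
  then have "\<bar>b\<bar> \<le> sqrt (a * c)" by (metis real_sqrt_abs real_sqrt_le_iff)
  then show ?thesis by (simp add: real_sqrt_mult a_def b_def c_def)
qed

lemma L2_Cauchy_Schwarz_norm:
  assumes f: "L2 M f" and g: "L2 M g"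
  shows "(LINT x|M. norm (f x) * norm (g x)) \<le> sqrt (LINT x|M. (norm (f x))\<^sup>2) * sqrt (LINT x|M. (norm (g x))\<^sup>2)"
  using order_trans[OF abs_ge_self L2_Cauchy_Schwarz[OF L2_norm[OF f] L2_norm[OF g]]]
  by (simp only: inner_real_def real_norm_def abs_norm_cancel)

definition L2_lim :: "'a measure \<Rightarrow> (nat \<Rightarrow> 'a \<Rightarrow> 'b::euclidean_space) \<Rightarrow> ('a \<Rightarrow> 'b) \<Rightarrow> bool" where
  "L2_lim M f h \<longleftrightarrow> (\<forall>n. L2 M (f n)) \<and> L2 M h \<and> (\<lambda>n. LINT x|M. (norm (f n x - h x))\<^sup>2) \<longlonglongrightarrow> 0"

lemma L2_limD:
  assumes "L2_lim M f h"
  shows "L2 M (f n)" "L2 M h" "(\<lambda>n. LINT x|M. (norm (f n x - h x))\<^sup>2) \<longlonglongrightarrow> 0"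
  using assms by (auto simp: L2_lim_def)

lemma L2_lim_const: "L2 M h \<Longrightarrow> L2_lim M (\<lambda>_. h) h"
  by (auto simp: L2_lim_def)

text \<open>Testing with constant sequences, this contains the passage to the limit in \<open>\<integral> f\<^sub>n \<bullet> w\<close>
  and, for \<open>w\<^sub>n = f\<^sub>n\<close>, the convergence of the norms.\<close>

lemma L2_lim_inner:
  assumes f: "L2_lim M f h" and w: "L2_lim M w v"
  shows "(\<lambda>n. LINT x|M. f n x \<bullet> w n x) \<longlonglongrightarrow> (LINT x|M. h x \<bullet> v x)"
proof -
  note fD = L2_limD[OF f] and wD = L2_limD[OF w]
  define N :: "('a \<Rightarrow> 'b) \<Rightarrow> real" where "N k = sqrt (LINT x|M. (norm (k x))\<^sup>2)" for k
  define df where "df n = N (\<lambda>x. f n x - h x)" for n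
  define dw where "dw n = N (\<lambda>x. w n x - v x)" for n
  have df: "df \<longlonglongrightarrow> 0" using tendsto_real_sqrt[OF fD(3)] by (simp add: df_def[abs_def] N_def)
  have dw: "dw \<longlonglongrightarrow> 0" using tendsto_real_sqrt[OF wD(3)] by (simp add: dw_def[abs_def] N_def)
  have bound: "\<bar>(LINT x|M. f n x \<bullet> w n x) - (LINT x|M. h x \<bullet> v x)\<bar>
      \<le> df n * dw n + df n * N v + N h * dw n" for n
  proof -
    have "(LINT x|M. f n x \<bullet> w n x) - (LINT x|M. h x \<bullet> v x) = (LINT x|M. f n x \<bullet> w n x - h x \<bullet> v x)"
      by (intro Bochner_Integration.integral_diff[symmetric] L2_inner_integrable fD wD)
    also have "\<dots> = (LINT x|M. (f n x - h x) \<bullet> (w n x - v x) + (f n x - h x) \<bullet> v x + h x \<bullet> (w n x - v x))"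
      by (intro Bochner_Integration.integral_cong refl) (simp add: inner_simps)
    also have "\<dots> = (LINT x|M. (f n x - h x) \<bullet> (w n x - v x)) + (LINT x|M. (f n x - h x) \<bullet> v x)
        + (LINT x|M. h x \<bullet> (w n x - v x))"
      by (simp only: Bochner_Integration.integral_add Bochner_Integration.integrable_add
          L2_inner_integrable L2_diff fD wD)
    finally have "(LINT x|M. f n x \<bullet> w n x) - (LINT x|M. h x \<bullet> v x) = (LINT x|M. (f n x - h x) \<bullet> (w n x - v x))
        + (LINT x|M. (f n x - h x) \<bullet> v x) + (LINT x|M. h x \<bullet> (w n x - v x))" .
    moreover have "\<bar>LINT x|M. (f n x - h x) \<bullet> (w n x - v x)\<bar> \<le> df n * dw n"
      unfolding df_def dw_def N_def by (intro L2_Cauchy_Schwarz L2_diff fD wD)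
    moreover have "\<bar>LINT x|M. (f n x - h x) \<bullet> v x\<bar> \<le> df n * N v"
      unfolding df_def dw_def N_def by (intro L2_Cauchy_Schwarz L2_diff fD wD)
    moreover have "\<bar>LINT x|M. h x \<bullet> (w n x - v x)\<bar> \<le> N h * dw n"
      unfolding df_def dw_def N_def by (intro L2_Cauchy_Schwarz L2_diff fD wD)
    ultimately show ?thesis by (simp only: abs_le_iff) linarith
  qed
  have "(\<lambda>n. df n * dw n + df n * N v + N h * dw n) \<longlonglongrightarrow> 0 * 0 + 0 * N v + N h * 0"
    by (intro tendsto_intros df dw)
  then have lim0: "(\<lambda>n. df n * dw n + df n * N v + N h * dw n) \<longlonglongrightarrow> 0" by simp
  have "(\<lambda>n. (LINT x|M. f n x \<bullet> w n x) - (LINT x|M. h x \<bullet> v x)) \<longlonglongrightarrow> 0"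
    by (rule Lim_null_comparison[OF always_eventually lim0]) (simp only: real_norm_def bound simp_thms)
  then show ?thesis by (simp add: LIM_zero_iff)
qed

lemma L2_lim_norm:
  assumes "L2_lim M f h"
  shows "(\<lambda>n. LINT x|M. (norm (f n x))\<^sup>2) \<longlonglongrightarrow> (LINT x|M. (norm (h x))\<^sup>2)"
  using L2_lim_inner[OF assms assms] by (simp add: power2_norm_eq_inner)

lemma L2_lim_subseq:
  assumes "L2_lim M f h" "strict_mono r" shows "L2_lim M (\<lambda>n. f (r n)) h"
  using LIMSEQ_subseq_LIMSEQ[OF L2_limD(3)[OF assms(1)] assms(2)] L2_limD(1,2)[OF assms(1)]
  unfolding L2_lim_def o_def by blast

text \<open>The difference splits into \<open>c\<^sub>n (f\<^sub>n - h)\<close>, which is small because the multipliers are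
  bounded, and \<open>(c\<^sub>n - d) h\<close>, which is small by dominated convergence. This is how composite functions
  and their chain-rule gradients pass to the limit in the whole development.\<close>

lemma L2_lim_mult:
  fixes f :: "nat \<Rightarrow> 'a \<Rightarrow> 'b::euclidean_space"
  assumes f: "L2_lim M f h" and [measurable]: "\<And>n. c n \<in> borel_measurable M" "d \<in> borel_measurable M"
    and bd: "\<And>n x. \<bar>c n x\<bar> \<le> K" and lim: "AE x in M. (\<lambda>n. c n x) \<longlonglongrightarrow> d x"
  shows "L2_lim M (\<lambda>n x. c n x *\<^sub>R f n x) (\<lambda>x. d x *\<^sub>R h x)"
proof -
  note fD = L2_limD[OF f]
  have [measurable]: "f n \<in> borel_measurable M" "h \<in> borel_measurable M" for n using fD(1)[of n] fD(2) by (auto simp: L2_def)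
  have bd': "AE x in M. \<bar>d x\<bar> \<le> K"
    using lim
  proof eventually_elim
    case (elim x)
    then show ?case using bd by (intro LIMSEQ_le_const2[OF tendsto_rabs[OF elim]]) auto
  qed
  have 1: "L2 M (\<lambda>x. c n x *\<^sub>R f n x)" for n
    by (rule L2_bounded_mult[OF fD(1), where K=K]) (use bd in auto)
  have 2: "L2 M (\<lambda>x. d x *\<^sub>R h x)"
    by (rule L2_bounded_mult[OF fD(2), where K=K]) (use bd' in auto)
  have dh: "L2 M (\<lambda>x. (c n x - d x) *\<^sub>R h x)" for n
    by (rule L2_bounded_mult[OF fD(2), where K="2 * K"])
       (measurable, use bd' in eventually_elim, use bd[of n] in \<open>smt (verit)\<close>)
  have lim0: "(\<lambda>n. LINT x|M. (norm ((c n x - d x) *\<^sub>R h x))\<^sup>2) \<longlonglongrightarrow> (LINT x|M. 0)"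
  proof (rule integral_dominated_convergence[where w="\<lambda>x. (2 * K)\<^sup>2 * (norm (h x))\<^sup>2"])
    show "integrable M (\<lambda>x. (2 * K)\<^sup>2 * (norm (h x))\<^sup>2)" using L2_integrable[OF fD(2)] by simp
    show "AE x in M. (\<lambda>n. (norm ((c n x - d x) *\<^sub>R h x))\<^sup>2) \<longlonglongrightarrow> 0"
      using lim
    proof eventually_elim
      case (elim x)
      have "(\<lambda>n. (norm ((c n x - d x) *\<^sub>R h x))\<^sup>2) \<longlonglongrightarrow> (norm ((d x - d x) *\<^sub>R h x))\<^sup>2"
        by (intro tendsto_intros elim)
      then show ?case by simp
    qed
    show "AE x in M. norm ((norm ((c n x - d x) *\<^sub>R h x))\<^sup>2) \<le> (2 * K)\<^sup>2 * (norm (h x))\<^sup>2" for n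
      using bd'
    proof eventually_elim
      case (elim x)
      have "\<bar>c n x - d x\<bar> \<le> 2 * K" using bd[of n x] elim by linarith
      then have "(\<bar>c n x - d x\<bar> * norm (h x))\<^sup>2 \<le> (2 * K * norm (h x))\<^sup>2"
        by (intro power_mono mult_right_mono) auto
      then show ?case by (simp add: power_mult_distrib)
    qed
  qed auto
  have "(\<lambda>n. LINT x|M. (norm (c n x *\<^sub>R f n x - d x *\<^sub>R h x))\<^sup>2) \<longlonglongrightarrow> 0"
  proof (rule tendsto_sandwich[OF _ _ tendsto_const])
    show "(\<lambda>n. 2 * (K\<^sup>2 * (LINT x|M. (norm (f n x - h x))\<^sup>2)) + 2 * (LINT x|M. (norm ((c n x - d x) *\<^sub>R h x))\<^sup>2)) \<longlonglongrightarrow> 0"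
      using tendsto_add[OF tendsto_mult_left[OF tendsto_mult_left[OF fD(3)]] tendsto_mult_left[OF lim0], of 2 "K\<^sup>2" 2] by simp
    show "\<forall>\<^sub>F n in sequentially. (LINT x|M. (norm (c n x *\<^sub>R f n x - d x *\<^sub>R h x))\<^sup>2) \<le>
        2 * (K\<^sup>2 * (LINT x|M. (norm (f n x - h x))\<^sup>2)) + 2 * (LINT x|M. (norm ((c n x - d x) *\<^sub>R h x))\<^sup>2)"
    proof (intro always_eventually allI)
      fix n
      have "(LINT x|M. (norm (c n x *\<^sub>R f n x - d x *\<^sub>R h x))\<^sup>2)
        \<le> (LINT x|M. 2 * (K\<^sup>2 * (norm (f n x - h x))\<^sup>2) + 2 * (norm ((c n x - d x) *\<^sub>R h x))\<^sup>2)"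
      proof (intro integral_mono)
        show "integrable M (\<lambda>x. (norm (c n x *\<^sub>R f n x - d x *\<^sub>R h x))\<^sup>2)"
          by (rule L2_integrable[OF L2_diff[OF 1 2]])
        show "integrable M (\<lambda>x. 2 * (K\<^sup>2 * (norm (f n x - h x))\<^sup>2) + 2 * (norm ((c n x - d x) *\<^sub>R h x))\<^sup>2)"
          using L2_integrable[OF L2_diff[OF fD(1) fD(2)], of n] L2_integrable[OF dh, of n] by simp
        fix x
        have "(norm (c n x *\<^sub>R f n x - d x *\<^sub>R h x))\<^sup>2 = (norm (c n x *\<^sub>R (f n x - h x) + (c n x - d x) *\<^sub>R h x))\<^sup>2"
          by (simp add: algebra_simps)
        also have "\<dots> \<le> 2 * (norm (c n x *\<^sub>R (f n x - h x)))\<^sup>2 + 2 * (norm ((c n x - d x) *\<^sub>R h x))\<^sup>2"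
          by (rule norm_add_square_le)
        also have "(norm (c n x *\<^sub>R (f n x - h x)))\<^sup>2 \<le> K\<^sup>2 * (norm (f n x - h x))\<^sup>2"
          using bd[of n x] by (auto simp: power_mult_distrib intro!: mult_right_mono abs_le_square_iff[THEN iffD1])
        finally show "(norm (c n x *\<^sub>R f n x - d x *\<^sub>R h x))\<^sup>2
           \<le> 2 * (K\<^sup>2 * (norm (f n x - h x))\<^sup>2) + 2 * (norm ((c n x - d x) *\<^sub>R h x))\<^sup>2" by simp
      qed
      also have "\<dots> = 2 * (K\<^sup>2 * (LINT x|M. (norm (f n x - h x))\<^sup>2)) + 2 * (LINT x|M. (norm ((c n x - d x) *\<^sub>R h x))\<^sup>2)"
        using L2_integrable[OF L2_diff[OF fD(1) fD(2)], of n] L2_integrable[OF dh, of n] by simp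
      finally show "(LINT x|M. (norm (c n x *\<^sub>R f n x - d x *\<^sub>R h x))\<^sup>2) \<le> \<dots>" .
    qed
  qed auto
  with 1 2 show ?thesis by (simp add: L2_lim_def)
qed

text \<open>Fatou's lemma in the form in which it is used: an eventual bound on the integrals passes to the
  almost everywhere limit, which is integrable.\<close>

lemma Fatou_real:
  fixes f :: "nat \<Rightarrow> 'a \<Rightarrow> real"
  assumes int: "\<And>n. integrable M (f n)" and nonneg: "\<And>n x. 0 \<le> f n x"
    and h[measurable]: "h \<in> borel_measurable M" and lim: "AE x in M. (\<lambda>n. f n x) \<longlonglongrightarrow> h x"
    and B: "\<forall>\<^sub>F n in sequentially. (LINT x|M. f n x) \<le> B"
  shows "integrable M h" "(LINT x|M. h x) \<le> B"
proof -
  have [measurable]: "f n \<in> borel_measurable M" for n using int[of n] by auto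
  have nn: "AE x in M. 0 \<le> h x"
    using lim by eventually_elim (use nonneg in \<open>auto intro!: LIMSEQ_le_const\<close>)
  obtain n0 where "(LINT x|M. f n0 x) \<le> B" using eventually_happens[OF B] by auto
  moreover have "0 \<le> (LINT x|M. f n0 x)" using nonneg by simp
  ultimately have B0: "0 \<le> B" by linarith
  have "(\<integral>\<^sup>+x. ennreal (h x) \<partial>M) = (\<integral>\<^sup>+x. liminf (\<lambda>n. ennreal (f n x)) \<partial>M)"
  proof (rule nn_integral_cong_AE)
    show "AE x in M. ennreal (h x) = liminf (\<lambda>n. ennreal (f n x))"
      using lim by eventually_elim (auto intro!: lim_imp_Liminf[symmetric] tendsto_ennrealI)
  qed
  also have "\<dots> \<le> liminf (\<lambda>n. \<integral>\<^sup>+x. ennreal (f n x) \<partial>M)"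
    by (rule nn_integral_liminf) measurable
  also have "\<dots> \<le> ennreal B"
  proof (rule Liminf_le)
    show "\<forall>\<^sub>F n in sequentially. (\<integral>\<^sup>+x. ennreal (f n x) \<partial>M) \<le> ennreal B"
      using B by eventually_elim (simp add: nn_integral_eq_integral[OF int] nonneg ennreal_leI)
  qed simp
  finally have le: "(\<integral>\<^sup>+x. ennreal (h x) \<partial>M) \<le> ennreal B" .
  show i: "integrable M h"
  proof (rule integrableI_nonneg[OF h nn])
    show "(\<integral>\<^sup>+x. ennreal (h x) \<partial>M) < \<infinity>"
      by (rule order_le_less_trans[OF le]) simp
  qed
  show "(LINT x|M. h x) \<le> B"
    using le B0 by (simp add: nn_integral_eq_integral[OF i nn])
qed

text \<open>Completeness. A strictly positive square-integrable weight \<open>w\<close> turns the Cauchy property in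
  \<open>L\<^sup>2\<close> into the Cauchy property of \<open>w f\<^sub>n\<close> in \<open>L\<^sup>1\<close>, which gives a subsequence that converges almost
  everywhere; Fatou's lemma shows that its pointwise limit is the limit in \<open>L\<^sup>2\<close>. For a confining
  potential such a weight is at hand, namely \<open>1/sqrt V\<close>.\<close>

lemma L2_complete:
  fixes f :: "nat \<Rightarrow> 'a \<Rightarrow> 'b::euclidean_space" and w :: "'a \<Rightarrow> real"
  assumes L2: "\<And>n. L2 M (f n)"
    and Cauchy: "\<And>e. e > 0 \<Longrightarrow> \<exists>N. \<forall>i\<ge>N. \<forall>j\<ge>N. (LINT x|M. (norm (f i x - f j x))\<^sup>2) < e"
    and w: "L2 M w" "\<And>x. 0 < w x"
  obtains h r where "L2_lim M f h" "strict_mono (r :: nat \<Rightarrow> nat)" "AE x in M. (\<lambda>n. f (r n) x) \<longlonglongrightarrow> h x"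
proof -
  have [measurable]: "f n \<in> borel_measurable M" for n using L2[of n] by (auto simp: L2_def)
  have [measurable]: "w \<in> borel_measurable M" using w(1) by (simp add: L2_def)
  obtain r where mono: "strict_mono (r :: nat \<Rightarrow> nat)" and AE_Cauchy: "AE x in M. Cauchy (\<lambda>n. w x *\<^sub>R f (r n) x)"
  proof (rule cauchy_L1_AE_cauchy_subseq[of M "\<lambda>n x. w x *\<^sub>R f n x"])
    show "integrable M (\<lambda>x. w x *\<^sub>R f n x)" for n
      by (rule Bochner_Integration.integrable_bound[OF L2_mult_integrable[OF w(1) L2_norm[OF L2[of n]]]]) auto
    fix e :: real assume "0 < e"
    define s where "s = sqrt (LINT x|M. (norm (w x))\<^sup>2)"
    have s: "0 \<le> s" by (simp add: s_def)
    then have "0 < (e / (s + 1))\<^sup>2" using \<open>0 < e\<close> by (simp add: add_nonneg_eq_0_iff)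
    from Cauchy[OF this] obtain N where N: "\<And>i j. i \<ge> N \<Longrightarrow> j \<ge> N \<Longrightarrow> (LINT x|M. (norm (f i x - f j x))\<^sup>2) < (e / (s + 1))\<^sup>2"
      by blast
    have "(LINT x|M. norm (w x *\<^sub>R f i x - w x *\<^sub>R f j x)) < e" if "i \<ge> N" "j \<ge> N" for i j
    proof -
      have "(LINT x|M. norm (w x *\<^sub>R f i x - w x *\<^sub>R f j x)) = (LINT x|M. norm (w x) * norm (f i x - f j x))"
        by (simp flip: scaleR_diff_right)
      also have "\<dots> \<le> s * sqrt (LINT x|M. (norm (f i x - f j x))\<^sup>2)"
        unfolding s_def by (rule L2_Cauchy_Schwarz_norm[OF w(1) L2_diff[OF L2 L2]])
      also have "\<dots> \<le> s * (e / (s + 1))"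
        using N[OF that] s \<open>0 < e\<close> by (intro mult_left_mono real_le_lsqrt) auto
      also have "\<dots> < e" using s \<open>0 < e\<close> by (simp add: field_simps)
      finally show ?thesis .
    qed
    then show "\<exists>N. \<forall>i\<ge>N. \<forall>j\<ge>N. (LINT x|M. norm (w x *\<^sub>R f i x - w x *\<^sub>R f j x)) < e" by blast
  qed blast
  define h where "h x = lim (\<lambda>n. f (r n) x)" for x
  have [measurable]: "h \<in> borel_measurable M"
    unfolding h_def[abs_def] by (intro borel_measurable_lim_metric) auto
  have lim: "AE x in M. (\<lambda>n. f (r n) x) \<longlonglongrightarrow> h x"
    using AE_Cauchy
  proof eventually_elim
    case (elim x)
    then obtain l where "(\<lambda>n. w x *\<^sub>R f (r n) x) \<longlonglongrightarrow> l" by (auto simp: Cauchy_convergent_iff convergent_def)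
    from tendsto_scaleR[OF tendsto_const this, of "1 / w x"] have "convergent (\<lambda>n. f (r n) x)"
      using w(2)[of x] by (auto simp: convergent_def)
    then show ?case by (simp add: h_def convergent_LIMSEQ_iff)
  qed
  have *: "\<exists>N. \<forall>n\<ge>N. integrable M (\<lambda>x. (norm (f n x - h x))\<^sup>2) \<and> (LINT x|M. (norm (f n x - h x))\<^sup>2) \<le> e" if e: "0 < e" for e
  proof -
    obtain N where N: "\<And>i j. i \<ge> N \<Longrightarrow> j \<ge> N \<Longrightarrow> (LINT x|M. (norm (f i x - f j x))\<^sup>2) < e"
      using Cauchy[OF e] by blast
    have "integrable M (\<lambda>x. (norm (f n x - h x))\<^sup>2) \<and> (LINT x|M. (norm (f n x - h x))\<^sup>2) \<le> e" if n: "n \<ge> N" for n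
    proof -
      have 1: "integrable M (\<lambda>x. (norm (f n x - f (r j) x))\<^sup>2)" for j
        by (rule L2_integrable[OF L2_diff[OF L2 L2]])
      have 2: "AE x in M. (\<lambda>j. (norm (f n x - f (r j) x))\<^sup>2) \<longlonglongrightarrow> (norm (f n x - h x))\<^sup>2"
        using lim by eventually_elim (intro tendsto_intros)
      have 3: "\<forall>\<^sub>F j in sequentially. (LINT x|M. (norm (f n x - f (r j) x))\<^sup>2) \<le> e"
        using eventually_ge_at_top[of N]
      proof eventually_elim
        case (elim j)
        then have "N \<le> r j" using seq_suble[OF mono, of j] by linarith
        then show ?case using N[OF n] by (simp add: less_imp_le)
      qed
      show ?thesis using Fatou_real[OF 1 _ _ 2 3] by simp
    qed
    then show ?thesis by blast
  qed
  obtain N where "L2 M (\<lambda>x. f N x - h x)" using *[of 1] by (auto simp: L2_def)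
  from L2_diff[OF L2[of N] this] have "L2 M h" by simp
  moreover have "(\<lambda>n. LINT x|M. (norm (f n x - h x))\<^sup>2) \<longlonglongrightarrow> 0"
  proof (rule LIMSEQ_I)
    fix e :: real assume "0 < e"
    then show "\<exists>no. \<forall>n\<ge>no. norm ((LINT x|M. (norm (f n x - h x))\<^sup>2) - 0) < e"
      using *[of "e / 2"] by force
  qed
  ultimately have "L2_lim M f h" using L2 by (simp add: L2_lim_def)
  then show thesis using mono lim by (rule that)
qed

section \<open>Compactly supported functions of class \<open>C\<^sup>1\<close>\<close>

text \<open>A function is carried together with its gradient, so that limits of the pair can be taken in
  \<open>L\<^sup>2\<close> without choosing representatives. One bound \<open>R\<close> serves for both supports.\<close>

definition C1c :: "('a::euclidean_space \<Rightarrow> real) \<Rightarrow> ('a \<Rightarrow> 'a) \<Rightarrow> bool" where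
  "C1c \<phi> D \<longleftrightarrow> (\<forall>x. GDERIV \<phi> x :> D x) \<and> continuous_on UNIV D \<and>
     (\<exists>R. \<forall>x. norm x > R \<longrightarrow> \<phi> x = 0 \<and> D x = 0)"

lemma C1cD:
  assumes "C1c \<phi> D"
  shows C1c_GDERIV: "GDERIV \<phi> x :> D x" and C1c_continuous: "continuous_on UNIV \<phi>"
    and C1c_continuous_gradient: "continuous_on UNIV D"
proof -
  show *: "GDERIV \<phi> x :> D x" for x using assms by (simp add: C1c_def)
  show "continuous_on UNIV \<phi>"
    using * by (intro continuous_at_imp_continuous_on) (auto simp: gderiv_def intro: has_derivative_continuous)
  show "continuous_on UNIV D" using assms by (simp add: C1c_def)
qed

lemma C1c_measurable [measurable_dest]:
  assumes "C1c \<phi> D" shows "\<phi> \<in> borel_measurable borel" "D \<in> borel_measurable borel"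
  using C1cD[OF assms] by (auto intro: borel_measurable_continuous_onI)

lemma C1c_support:
  assumes "C1c \<phi> D" obtains R where "R > 0" "\<And>x. norm x > R \<Longrightarrow> \<phi> x = 0" "\<And>x. norm x > R \<Longrightarrow> D x = 0"
proof -
  obtain R where "\<forall>x. norm x > R \<longrightarrow> \<phi> x = 0 \<and> D x = 0" using assms by (auto simp: C1c_def)
  then show thesis by (intro that[of "max R 1"]) auto
qed

lemma integrable_continuous_compact_support:
  fixes k :: "'a::euclidean_space \<Rightarrow> 'b::euclidean_space"
  assumes "continuous_on UNIV k" and supp: "\<And>x. norm x > R \<Longrightarrow> k x = 0"
  shows "integrable lborel k"
proof -
  have "integrable lborel (\<lambda>x. indicator (cball 0 R) x *\<^sub>R k x)"
    using assms by (intro borel_integrable_compact) (auto intro: continuous_on_subset)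
  also have "(\<lambda>x. indicator (cball 0 R) x *\<^sub>R k x) = k"
    using supp by (auto simp: indicator_def fun_eq_iff)
  finally show ?thesis .
qed

lemma bounded_continuous_compact_support:
  fixes k :: "'a::euclidean_space \<Rightarrow> 'b::euclidean_space"
  assumes "continuous_on UNIV k" and supp: "\<And>x. norm x > R \<Longrightarrow> k x = 0"
  obtains B where "0 < B" "\<And>x. norm (k x) \<le> B"
proof -
  have "compact (k ` cball 0 R)"
    using assms by (intro compact_continuous_image) (auto intro: continuous_on_subset)
  then obtain B where "0 < B" and B: "\<And>y. y \<in> k ` cball 0 R \<Longrightarrow> norm y \<le> B"
    using compact_imp_bounded bounded_normE by (metis (no_types, lifting) bounded_pos)
  have "norm (k x) \<le> B" for x
  proof (cases "norm x > R")
    case True then show ?thesis using supp \<open>0 < B\<close> by simp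
  next
    case False then show ?thesis by (intro B) auto
  qed
  with \<open>0 < B\<close> show thesis by (rule that)
qed

lemma C1c_integrable_weighted:
  assumes \<phi>: "C1c \<phi> D" and "continuous_on UNIV w"
  shows "integrable lborel (\<lambda>x. w x * \<phi> x)"
proof -
  obtain R where R: "\<And>x. norm x > R \<Longrightarrow> \<phi> x = 0" using C1c_support[OF \<phi>] by metis
  show ?thesis
    by (rule integrable_continuous_compact_support[where R=R])
       (use R C1cD[OF \<phi>] assms in \<open>auto intro!: continuous_intros\<close>)
qed

lemma C1c_integrable: "C1c \<phi> D \<Longrightarrow> integrable lborel \<phi>"
  using C1c_integrable_weighted[of \<phi> D "\<lambda>_. 1"] by simp

lemma C1c_L2:
  assumes \<phi>: "C1c \<phi> D" shows "L2 lborel D"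
proof -
  obtain R where R: "\<And>x. norm x > R \<Longrightarrow> D x = 0" using C1c_support[OF \<phi>] by metis
  have "integrable lborel (\<lambda>x. (norm (D x))\<^sup>2)"
    by (rule integrable_continuous_compact_support[where R=R])
       (use R C1cD[OF \<phi>] in \<open>auto intro!: continuous_intros\<close>)
  then show ?thesis using C1c_measurable[OF \<phi>] by (simp add: L2_def)
qed

lemma C1c_L2_weighted:
  assumes \<phi>: "C1c \<phi> D" and "continuous_on UNIV w" shows "L2 lborel (\<lambda>x. w x * \<phi> x)"
proof -
  obtain R where R: "\<And>x. norm x > R \<Longrightarrow> \<phi> x = 0" using C1c_support[OF \<phi>] by metis
  have c: "continuous_on UNIV (\<lambda>x. w x * \<phi> x)"
    using C1cD[OF \<phi>] assms by (auto intro!: continuous_intros)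
  have "integrable lborel (\<lambda>x. (norm (w x * \<phi> x))\<^sup>2)"
    by (rule integrable_continuous_compact_support[where R=R])
       (use R c in \<open>auto intro!: continuous_intros\<close>)
  then show ?thesis using borel_measurable_continuous_onI[OF c] by (simp add: L2_def)
qed

lemma C1c_lincomb:
  assumes \<phi>: "C1c \<phi> D" and \<psi>: "C1c \<psi> E"
  shows "C1c (\<lambda>x. a * \<phi> x + b * \<psi> x) (\<lambda>x. a *\<^sub>R D x + b *\<^sub>R E x)"
proof -
  obtain R S where R: "\<And>x. norm x > R \<Longrightarrow> \<phi> x = 0" "\<And>x. norm x > R \<Longrightarrow> D x = 0"
    and S: "\<And>x. norm x > S \<Longrightarrow> \<psi> x = 0" "\<And>x. norm x > S \<Longrightarrow> E x = 0"
    using C1c_support[OF \<phi>] C1c_support[OF \<psi>] by metis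
  have "GDERIV (\<lambda>x. a * \<phi> x + b * \<psi> x) x :> a *\<^sub>R D x + b *\<^sub>R E x" for x
    using GDERIV_add[OF GDERIV_mult[OF GDERIV_const[of a] C1c_GDERIV[OF \<phi>, of x]] GDERIV_mult[OF GDERIV_const[of b] C1c_GDERIV[OF \<psi>, of x]]]
    by simp
  moreover have "continuous_on UNIV (\<lambda>x. a *\<^sub>R D x + b *\<^sub>R E x)"
    using C1cD[OF \<phi>] C1cD[OF \<psi>] by (auto intro!: continuous_intros)
  moreover have "\<forall>x. norm x > max R S \<longrightarrow> a * \<phi> x + b * \<psi> x = 0 \<and> a *\<^sub>R D x + b *\<^sub>R E x = 0"
    using R S by simp
  ultimately show ?thesis unfolding C1c_def by blast
qed

lemma C1c_scale: "C1c \<phi> D \<Longrightarrow> C1c (\<lambda>x. a * \<phi> x) (\<lambda>x. a *\<^sub>R D x)"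
  using C1c_lincomb[of \<phi> D \<phi> D a 0] by simp

lemma C1c_add: "C1c \<phi> D \<Longrightarrow> C1c \<psi> E \<Longrightarrow> C1c (\<lambda>x. \<phi> x + \<psi> x) (\<lambda>x. D x + E x)"
  using C1c_lincomb[of \<phi> D \<psi> E 1 1] by simp

lemma C1c_diff: "C1c \<phi> D \<Longrightarrow> C1c \<psi> E \<Longrightarrow> C1c (\<lambda>x. \<phi> x - \<psi> x) (\<lambda>x. D x - E x)"
  using C1c_lincomb[of \<phi> D \<psi> E 1 "-1"] by simp

lemma C1c_times:
  assumes \<phi>: "C1c \<phi> D" and \<psi>: "\<And>x. GDERIV \<psi> x :> E x" "continuous_on UNIV E"
  shows "C1c (\<lambda>x. \<phi> x * \<psi> x) (\<lambda>x. \<phi> x *\<^sub>R E x + \<psi> x *\<^sub>R D x)"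
proof -
  obtain R where R: "\<And>x. norm x > R \<Longrightarrow> \<phi> x = 0" "\<And>x. norm x > R \<Longrightarrow> D x = 0"
    using C1c_support[OF \<phi>] by metis
  have "GDERIV (\<lambda>x. \<phi> x * \<psi> x) x :> \<phi> x *\<^sub>R E x + \<psi> x *\<^sub>R D x" for x
    by (rule GDERIV_mult[OF C1c_GDERIV[OF \<phi>] \<psi>(1)])
  moreover have "continuous_on UNIV \<psi>"
    using \<psi>(1) by (intro continuous_at_imp_continuous_on) (auto simp: gderiv_def intro: has_derivative_continuous)
  then have "continuous_on UNIV (\<lambda>x. \<phi> x *\<^sub>R E x + \<psi> x *\<^sub>R D x)"
    using C1cD[OF \<phi>] \<psi> by (auto intro!: continuous_intros)
  moreover have "\<forall>x. norm x > R \<longrightarrow> \<phi> x * \<psi> x = 0 \<and> \<phi> x *\<^sub>R E x + \<psi> x *\<^sub>R D x = 0"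
    using R by simp
  ultimately show ?thesis unfolding C1c_def by blast
qed

lemma GDERIV_compose_continuous:
  assumes \<phi>: "C1c \<phi> D" and \<theta>: "\<And>t. (\<theta> has_real_derivative \<theta>' t) (at t)" "continuous_on UNIV \<theta>'"
  shows "GDERIV (\<lambda>x. \<theta> (\<phi> x)) x :> \<theta>' (\<phi> x) *\<^sub>R D x"
    "continuous_on UNIV (\<lambda>x. \<theta>' (\<phi> x) *\<^sub>R D x)"
proof -
  show "GDERIV (\<lambda>x. \<theta> (\<phi> x)) x :> \<theta>' (\<phi> x) *\<^sub>R D x"
    by (rule GDERIV_DERIV_compose[OF C1c_GDERIV[OF \<phi>] \<theta>(1)])
  show "continuous_on UNIV (\<lambda>x. \<theta>' (\<phi> x) *\<^sub>R D x)"
    using C1cD[OF \<phi>] continuous_on_compose2[OF \<theta>(2), of UNIV \<phi>] by (auto intro!: continuous_intros)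
qed

lemma C1c_compose:
  assumes \<phi>: "C1c \<phi> D" and \<theta>: "\<And>t. (\<theta> has_real_derivative \<theta>' t) (at t)" "continuous_on UNIV \<theta>'" and "\<theta> 0 = 0"
  shows "C1c (\<lambda>x. \<theta> (\<phi> x)) (\<lambda>x. \<theta>' (\<phi> x) *\<^sub>R D x)"
proof -
  obtain R where R: "\<And>x. norm x > R \<Longrightarrow> \<phi> x = 0" "\<And>x. norm x > R \<Longrightarrow> D x = 0"
    using C1c_support[OF \<phi>] by metis
  have "\<forall>x. norm x > R \<longrightarrow> \<theta> (\<phi> x) = 0 \<and> \<theta>' (\<phi> x) *\<^sub>R D x = 0"
    using R \<open>\<theta> 0 = 0\<close> by simp
  then show ?thesis unfolding C1c_def using GDERIV_compose_continuous[OF \<phi> \<theta>] by blast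
qed

lemma pos_part_square_deriv: "((\<lambda>s. (max 0 s)\<^sup>2) has_real_derivative 2 * max 0 s) (at s)"
proof -
  define p where "p s = (max 0 s)\<^sup>2" for s :: real
  consider "s < 0" | "s = 0" | "s > 0" by linarith
  then have "(p has_real_derivative 2 * max 0 s) (at s)"
  proof cases
    case 1
    have "((\<lambda>_. 0) has_real_derivative 0) (at s)" by simp
    then have "(p has_real_derivative 0) (at s)"
      by (rule DERIV_cong_ev[THEN iffD1, rotated -1, OF _ refl _ refl])
         (use eventually_nhds_in_open[of "{..<0}" s] 1 in \<open>auto elim!: eventually_mono simp: p_def\<close>)
    then show ?thesis using 1 by simp
  next
    case 2
    have "((\<lambda>h. (p h - p 0) / (h - 0)) \<longlongrightarrow> 0) (at 0)"
    proof (rule Lim_null_comparison)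
      show "\<forall>\<^sub>F h in at 0. norm ((p h - p 0) / (h - 0)) \<le> \<bar>h\<bar>"
        by (auto simp: eventually_at_filter p_def max_def power2_eq_square)
      show "((\<lambda>h::real. \<bar>h\<bar>) \<longlongrightarrow> 0) (at 0)" by (rule tendsto_eq_intros) (auto intro!: tendsto_eq_intros)
    qed
    then show ?thesis using 2 by (simp add: has_field_derivative_iff)
  next
    case 3
    have "((\<lambda>s. s\<^sup>2) has_real_derivative 2 * s) (at s)" by (auto intro!: derivative_eq_intros)
    then have "(p has_real_derivative 2 * s) (at s)"
      by (rule DERIV_cong_ev[THEN iffD1, rotated -1, OF _ refl _ refl])
         (use eventually_nhds_in_open[of "{0<..}" s] 3 in \<open>auto elim!: eventually_mono simp: p_def\<close>)
    then show ?thesis using 3 by simp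
  qed
  then show ?thesis by (simp add: p_def[abs_def])
qed

text \<open>The cutoff is the square of the positive part of \<open>2 - |x|\<^sup>2/R\<^sup>2\<close>. It is at least \<open>1\<close> on the ball
  rather than equal to \<open>1\<close>, which is enough for localising estimates from above.\<close>

lemma C1c_cutoff:
  fixes R :: real assumes "R > 0"
  obtains \<eta> D where "C1c \<eta> (D :: 'a::euclidean_space \<Rightarrow> 'a)" "\<And>x. 0 \<le> \<eta> x" "\<And>x. norm x \<le> R \<Longrightarrow> 1 \<le> \<eta> x"
proof -
  define p where "p s = (max 0 s)\<^sup>2" for s :: real
  define k where "k x = 2 - (x \<bullet> x) / R\<^sup>2" for x :: 'a
  have p: "(p has_real_derivative 2 * max 0 s) (at s)" for s
    unfolding p_def[abs_def] by (rule pos_part_square_deriv)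
  have k: "GDERIV k x :> - (2 / R\<^sup>2) *\<^sub>R x" for x
  proof -
    have "((\<lambda>x. 2 - c * (x \<bullet> x)) has_derivative (\<lambda>h. - (c * (x \<bullet> h + h \<bullet> x)))) (at x)" for c
      by (auto intro!: derivative_eq_intros)
    from this[of "1 / R\<^sup>2"] show ?thesis by (simp add: gderiv_def k_def[abs_def] inner_commute algebra_simps)
  qed
  have "GDERIV (\<lambda>x. p (k x)) x :> (2 * max 0 (k x)) *\<^sub>R (- (2 / R\<^sup>2) *\<^sub>R x)" for x
    by (rule GDERIV_DERIV_compose[OF k p])
  moreover have "continuous_on UNIV (\<lambda>x. (2 * max 0 (k x)) *\<^sub>R (- (2 / R\<^sup>2) *\<^sub>R x))"
    unfolding k_def using \<open>R > 0\<close> by (auto intro!: continuous_intros)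
  moreover have "p (k x) = 0 \<and> (2 * max 0 (k x)) *\<^sub>R (- (2 / R\<^sup>2) *\<^sub>R x) = 0" if "norm x > 2 * R" for x
  proof -
    have "(2 * R)\<^sup>2 \<le> (norm x)\<^sup>2" using that \<open>R > 0\<close> by (intro power_mono) auto
    then have "4 * R\<^sup>2 \<le> x \<bullet> x" by (simp add: power2_norm_eq_inner)
    then have "2 * R\<^sup>2 \<le> x \<bullet> x" using zero_le_power2[of R] by linarith
    then have "k x \<le> 0" using \<open>R > 0\<close> by (simp add: k_def field_simps)
    then show ?thesis by (simp add: p_def)
  qed
  ultimately have "C1c (\<lambda>x. p (k x)) (\<lambda>x. (2 * max 0 (k x)) *\<^sub>R (- (2 / R\<^sup>2) *\<^sub>R x))"
    unfolding C1c_def by blast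
  moreover have "1 \<le> p (k x)" if "norm x \<le> R" for x
  proof -
    have "(norm x)\<^sup>2 \<le> R\<^sup>2" using that \<open>R > 0\<close> by (intro power_mono) auto
    then have "1 \<le> k x" using \<open>R > 0\<close> by (simp add: k_def field_simps power2_norm_eq_inner)
    then show ?thesis using power_mono[of 1 "k x" 2] by (simp add: p_def)
  qed
  moreover have "0 \<le> p (k x)" for x by (simp add: p_def)
  ultimately show thesis using that by blast
qed

lemma lborel_nn_integral_translate:
  fixes f :: "'a::euclidean_space \<Rightarrow> ennreal"
  assumes [measurable]: "f \<in> borel_measurable borel"
  shows "(\<integral>\<^sup>+x. f (x + c) \<partial>lborel) = (\<integral>\<^sup>+x. f x \<partial>lborel)"
  by (subst (2) lborel_distr_plus[of c, symmetric]) (simp add: nn_integral_distr add.commute)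

lemma lborel_integral_translate:
  fixes f :: "'a::euclidean_space \<Rightarrow> 'b::euclidean_space"
  assumes [measurable]: "f \<in> borel_measurable borel"
  shows "(LINT x|lborel. f (x + c)) = (LINT x|lborel. f x)"
  by (subst (2) lborel_distr_plus[of c, symmetric]) (simp add: integral_distr add.commute)

lemma lborel_integrable_translate:
  fixes f :: "'a::euclidean_space \<Rightarrow> 'b::euclidean_space"
  assumes "integrable lborel f"
  shows "integrable lborel (\<lambda>x. f (x + c))"
proof -
  have [measurable]: "f \<in> borel_measurable borel" using borel_measurable_integrable[OF assms] by simp
  have "integrable (distr lborel borel ((+) c)) f" using assms by (simp add: lborel_distr_plus)
  then show ?thesis by (subst (asm) integrable_distr_eq) (simp_all add: add.commute)
qed

text \<open>The integral of a directional derivative is the limit of integrals of difference quotients, and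
  these vanish because Lebesgue measure is invariant under translations.\<close>

lemma C1c_integral_derivative:
  assumes \<phi>: "C1c \<phi> D"
  shows "(LINT x|lborel. D x \<bullet> b) = 0"
proof -
  obtain R where R: "\<And>x. norm x > R \<Longrightarrow> \<phi> x = 0" "\<And>x. norm x > R \<Longrightarrow> D x = 0"
    using C1c_support[OF \<phi>] by metis
  obtain B where B: "0 < B" "\<And>x. norm (D x) \<le> B"
    using bounded_continuous_compact_support[OF C1c_continuous_gradient[OF \<phi>], of R] R by metis
  have [measurable]: "\<phi> \<in> borel_measurable borel" "D \<in> borel_measurable borel"
    using C1c_measurable[OF \<phi>] by auto
  have diff: "\<bar>\<phi> y - \<phi> x\<bar> \<le> B * norm (y - x)" for x y
  proof -
    have "norm (\<phi> y - \<phi> x) \<le> B * norm (y - x)"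
    proof (rule differentiable_bound[where S=UNIV and f'="\<lambda>x h. h \<bullet> D x"])
      show "(\<phi> has_derivative (\<lambda>h. h \<bullet> D z)) (at z within UNIV)" for z
        using C1c_GDERIV[OF \<phi>, of z] by (simp add: gderiv_def)
      show "onorm (\<lambda>h. h \<bullet> D z) \<le> B" for z
      proof (rule onorm_le)
        fix h
        have "\<bar>h \<bullet> D z\<bar> \<le> norm h * norm (D z)" by (rule Cauchy_Schwarz_ineq2)
        also have "\<dots> \<le> norm h * B" by (intro mult_left_mono B) auto
        finally show "norm (h \<bullet> D z) \<le> B * norm h" by (simp add: mult.commute)
      qed
    qed auto
    then show ?thesis by simp
  qed
  define q where "q n x = (\<phi> (x + (1 / real (Suc n)) *\<^sub>R b) - \<phi> x) * real (Suc n)" for n x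
  have "(\<lambda>n. LINT x|lborel. q n x) \<longlonglongrightarrow> (LINT x|lborel. D x \<bullet> b)"
  proof (rule integral_dominated_convergence[where w="\<lambda>x. indicator (cball 0 (R + norm b)) x * (B * norm b)"])
    have "emeasure lborel (cball (0::'a) (R + norm b)) < \<infinity>"
      by (rule emeasure_bounded_finite) simp
    then show "integrable lborel (\<lambda>x::'a. indicator (cball 0 (R + norm b)) x * (B * norm b))"
      by (intro integrable_mult_left) auto
    show "AE x in lborel. (\<lambda>n. q n x) \<longlonglongrightarrow> D x \<bullet> b"
    proof (intro always_eventually allI)
      fix x
      have "((\<lambda>t. x + t *\<^sub>R b) has_derivative (\<lambda>t. t *\<^sub>R b)) (at 0)"
        by (auto intro!: derivative_eq_intros)
      moreover have "(\<phi> has_derivative (\<lambda>h. h \<bullet> D x)) (at (x + 0 *\<^sub>R b))"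
        using C1c_GDERIV[OF \<phi>, of x] by (simp add: gderiv_def)
      ultimately have "((\<lambda>t. \<phi> (x + t *\<^sub>R b)) has_derivative (\<lambda>t. (t *\<^sub>R b) \<bullet> D x)) (at 0)"
        by (rule has_derivative_compose)
      then have "((\<lambda>t. \<phi> (x + t *\<^sub>R b)) has_real_derivative (D x \<bullet> b)) (at 0)"
        by (simp add: has_field_derivative_def inner_commute mult_commute_abs)
      then have "((\<lambda>h. (\<phi> (x + h *\<^sub>R b) - \<phi> x) / h) \<longlongrightarrow> D x \<bullet> b) (at 0)"
        by (simp add: has_field_derivative_iff)
      moreover have "filterlim (\<lambda>n. 1 / real (Suc n)) (at 0) sequentially"
        unfolding filterlim_at using LIMSEQ_inverse_real_of_nat by (auto simp: inverse_eq_divide)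
      ultimately have "(\<lambda>n. (\<phi> (x + (1 / real (Suc n)) *\<^sub>R b) - \<phi> x) / (1 / real (Suc n))) \<longlonglongrightarrow> D x \<bullet> b"
        by (rule filterlim_compose)
      then show "(\<lambda>n. q n x) \<longlonglongrightarrow> D x \<bullet> b" by (simp add: q_def)
    qed
    show "AE x in lborel. norm (q n x) \<le> indicator (cball 0 (R + norm b)) x * (B * norm b)" for n
    proof (intro always_eventually allI)
      fix x
      let ?y = "x + (1 / real (Suc n)) *\<^sub>R b"
      have nb: "norm ((1 / real (Suc n)) *\<^sub>R b) \<le> norm b"
        by (simp add: field_simps)
      show "norm (q n x) \<le> indicator (cball 0 (R + norm b)) x * (B * norm b)"
      proof (cases "norm x \<le> R + norm b")
        case True
        have "norm (q n x) = \<bar>\<phi> ?y - \<phi> x\<bar> * real (Suc n)" by (simp add: q_def abs_mult)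
        also have "\<dots> \<le> (B * norm (?y - x)) * real (Suc n)" by (intro mult_right_mono diff) auto
        also have "\<dots> = B * norm b" by simp
        finally show ?thesis using True by simp
      next
        case False
        have "norm ?y \<ge> norm x - norm ((1 / real (Suc n)) *\<^sub>R b)" by (rule norm_diff_ineq)
        then have "norm ?y > R" "norm x > R" using False nb norm_ge_zero[of b] by linarith+
        then show ?thesis using R False by (simp add: q_def)
      qed
    qed
  qed (auto simp: q_def[abs_def])
  moreover have "(LINT x|lborel. q n x) = 0" for n
  proof -
    have "(LINT x|lborel. q n x) = ((LINT x|lborel. \<phi> (x + (1 / real (Suc n)) *\<^sub>R b)) - (LINT x|lborel. \<phi> x)) * real (Suc n)"
      unfolding q_def using C1c_integrable[OF \<phi>] lborel_integrable_translate[OF C1c_integrable[OF \<phi>]]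
      by simp
    then show ?thesis by (simp add: lborel_integral_translate)
  qed
  ultimately show ?thesis by (simp add: LIMSEQ_const_iff)
qed

lemma C1c_integral_by_parts:
  assumes \<phi>: "C1c \<phi> D" and \<psi>: "C1c \<psi> E"
  shows "(LINT x|lborel. \<phi> x * (E x \<bullet> b)) = - (LINT x|lborel. (D x \<bullet> b) * \<psi> x)"
proof -
  have "C1c (\<lambda>x. \<phi> x * \<psi> x) (\<lambda>x. \<phi> x *\<^sub>R E x + \<psi> x *\<^sub>R D x)"
    using C1c_times[OF \<phi>] C1cD[OF \<psi>] by blast
  from C1c_integral_derivative[OF this, of b]
  have "(LINT x|lborel. \<phi> x * (E x \<bullet> b) + (D x \<bullet> b) * \<psi> x) = 0"
    by (simp add: inner_simps mult.commute)
  moreover have "continuous_on UNIV (\<lambda>x. E x \<bullet> b)" "continuous_on UNIV (\<lambda>x. D x \<bullet> b)"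
    using C1cD[OF \<phi>] C1cD[OF \<psi>] by (auto intro!: continuous_intros)
  then have "integrable lborel (\<lambda>x. (E x \<bullet> b) * \<phi> x)" "integrable lborel (\<lambda>x. (D x \<bullet> b) * \<psi> x)"
    by (auto intro: C1c_integrable_weighted[OF \<phi>] C1c_integrable_weighted[OF \<psi>])
  ultimately show ?thesis by (simp add: mult.commute[of "\<phi> _"])
qed

section \<open>Translation estimates\<close>

text \<open>The increment is the mean over \<open>s \<in> [0, 1]\<close> of \<open>D (x + s h) \<bullet> h\<close>; Jensen's inequality bounds its
  square by the mean of the squares.\<close>

lemma C1c_increment_le:
  assumes w: "C1c w D"
  shows "ennreal ((w (x + h) - w x)\<^sup>2) \<le> ennreal ((norm h)\<^sup>2) * (\<integral>\<^sup>+s. ennreal ((norm (D (x + s *\<^sub>R h)))\<^sup>2) * indicator {0..1} s \<partial>lborel)"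
proof -
  define c where "c = w (x + h) - w x"
  define k where "k s = D (x + s *\<^sub>R h) \<bullet> h" for s :: real
  have [measurable]: "D \<in> borel_measurable borel" using C1c_measurable[OF w] by auto
  have contD: "continuous_on UNIV D" by (rule C1c_continuous_gradient[OF w])
  have cD: "continuous_on {0..1} (\<lambda>s. D (x + s *\<^sub>R h))"
    by (rule continuous_on_compose2[OF contD]) (auto intro!: continuous_intros)
  have ck: "continuous_on {0..1} k" unfolding k_def by (intro continuous_intros cD)
  have der: "((\<lambda>s. w (x + s *\<^sub>R h)) has_vector_derivative k s) (at s within {0..1})" for s
  proof -
    have "((\<lambda>t. x + t *\<^sub>R h) has_derivative (\<lambda>t. t *\<^sub>R h)) (at s)"
      by (auto intro!: derivative_eq_intros)
    moreover have "(w has_derivative (\<lambda>v. v \<bullet> D (x + s *\<^sub>R h))) (at (x + s *\<^sub>R h))"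
      using C1c_GDERIV[OF w] by (simp add: gderiv_def)
    ultimately have "((\<lambda>t. w (x + t *\<^sub>R h)) has_derivative (\<lambda>t. (t *\<^sub>R h) \<bullet> D (x + s *\<^sub>R h))) (at s)"
      by (rule has_derivative_compose)
    then show ?thesis
      by (simp add: has_vector_derivative_def k_def inner_commute has_derivative_at_withinI)
  qed
  have c: "(k has_integral c) {0..1}"
    using fundamental_theorem_of_calculus[of 0 1 "\<lambda>s. w (x + s *\<^sub>R h)" k] der by (simp add: c_def)
  have i1: "(\<lambda>s. (k s)\<^sup>2) integrable_on {0..1}"
    by (intro integrable_continuous_real continuous_intros ck)
  have i2: "(\<lambda>s. (norm h)\<^sup>2 * (norm (D (x + s *\<^sub>R h)))\<^sup>2) integrable_on {0..1}"
    by (intro integrable_continuous_real continuous_intros cD)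
  \<comment> \<open>Jensen: integrate the square of \<open>k s - c\<close>, where \<open>c\<close> is the mean of \<open>k\<close>.\<close>
  have "((\<lambda>s. (k s)\<^sup>2 - 2 * c * k s + c\<^sup>2) has_integral integral {0..1} (\<lambda>s. (k s)\<^sup>2) - 2 * c * c + c\<^sup>2) {0..1}"
    using has_integral_const_real[of "c\<^sup>2" 0 1]
    by (intro has_integral_add has_integral_diff has_integral_mult_right c integrable_integral i1) auto
  then have "0 \<le> integral {0..1} (\<lambda>s. (k s)\<^sup>2) - 2 * c * c + c\<^sup>2"
  proof (rule has_integral_nonneg)
    show "0 \<le> (k s)\<^sup>2 - 2 * c * k s + c\<^sup>2" for s
      using zero_le_power2[of "k s - c"] by (simp add: power2_diff algebra_simps)
  qed
  then have "c\<^sup>2 \<le> integral {0..1} (\<lambda>s. (k s)\<^sup>2)" by (simp add: power2_eq_square)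
  also have "\<dots> \<le> integral {0..1} (\<lambda>s. (norm h)\<^sup>2 * (norm (D (x + s *\<^sub>R h)))\<^sup>2)"
  proof (rule integral_le[OF i1 i2])
    fix s
    have "(k s)\<^sup>2 = \<bar>k s\<bar>\<^sup>2" by simp
    also have "\<dots> \<le> (norm (D (x + s *\<^sub>R h)) * norm h)\<^sup>2"
      unfolding k_def by (intro power_mono Cauchy_Schwarz_ineq2) auto
    finally show "(k s)\<^sup>2 \<le> (norm h)\<^sup>2 * (norm (D (x + s *\<^sub>R h)))\<^sup>2"
      by (simp add: power_mult_distrib mult.commute)
  qed
  finally have "ennreal (c\<^sup>2) \<le> ennreal (integral {0..1} (\<lambda>s. (norm h)\<^sup>2 * (norm (D (x + s *\<^sub>R h)))\<^sup>2))"
    by (rule ennreal_leI)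
  also have "\<dots> = (\<integral>\<^sup>+s. ennreal ((norm h)\<^sup>2 * (norm (D (x + s *\<^sub>R h)))\<^sup>2) * indicator {0..1} s \<partial>lborel)"
    by (rule nn_integral_has_integral_lebesgue'[OF _ integrable_integral[OF i2], symmetric]) simp
  also have "\<dots> = (\<integral>\<^sup>+s. ennreal ((norm h)\<^sup>2) * (ennreal ((norm (D (x + s *\<^sub>R h)))\<^sup>2) * indicator {0..1} s) \<partial>lborel)"
    by (simp add: ennreal_mult mult.assoc)
  also have "\<dots> = ennreal ((norm h)\<^sup>2) * (\<integral>\<^sup>+s. ennreal ((norm (D (x + s *\<^sub>R h)))\<^sup>2) * indicator {0..1} s \<partial>lborel)"
    by (intro nn_integral_cmult) measurable
  finally show ?thesis by (simp add: c_def)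
qed

text \<open>Integrating the pointwise bound over \<open>A\<close> and exchanging the integrals, each \<open>s\<close> contributes the
  integral over the translate \<open>A + s h\<close>, which lies in \<open>A'\<close>. The version with two sets is needed for
  functions whose gradient is controlled only locally.\<close>

lemma C1c_translation_estimate:
  assumes w: "C1c w D" and [measurable]: "A \<in> sets borel" "A' \<in> sets borel"
    and sub: "\<And>x s. x \<in> A \<Longrightarrow> s \<in> {0..1} \<Longrightarrow> x + s *\<^sub>R h \<in> A'"
  shows "(\<integral>\<^sup>+x. ennreal ((w (x + h) - w x)\<^sup>2) * indicator A x \<partial>lborel)
    \<le> ennreal ((norm h)\<^sup>2) * (\<integral>\<^sup>+x. ennreal ((norm (D x))\<^sup>2) * indicator A' x \<partial>lborel)"
proof -
  have [measurable]: "w \<in> borel_measurable borel" "D \<in> borel_measurable borel"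
    using C1c_measurable[OF w] by auto
  define I where "I = (\<integral>\<^sup>+x. ennreal ((norm (D x))\<^sup>2) * indicator A' x \<partial>lborel)"
  have "(\<integral>\<^sup>+x. ennreal ((w (x + h) - w x)\<^sup>2) * indicator A x \<partial>lborel)
    \<le> (\<integral>\<^sup>+x. ennreal ((norm h)\<^sup>2) * (\<integral>\<^sup>+s. ennreal ((norm (D (x + s *\<^sub>R h)))\<^sup>2) * indicator {0..1} s * indicator A x \<partial>lborel) \<partial>lborel)"
  proof (rule nn_integral_mono)
    fix x
    have "ennreal ((w (x + h) - w x)\<^sup>2) * indicator A x \<le> (ennreal ((norm h)\<^sup>2) * (\<integral>\<^sup>+s. ennreal ((norm (D (x + s *\<^sub>R h)))\<^sup>2) * indicator {0..1} s \<partial>lborel)) * indicator A x"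
      by (intro mult_right_mono C1c_increment_le[OF w]) auto
    also have "\<dots> = ennreal ((norm h)\<^sup>2) * (\<integral>\<^sup>+s. ennreal ((norm (D (x + s *\<^sub>R h)))\<^sup>2) * indicator {0..1} s * indicator A x \<partial>lborel)"
      by (subst nn_integral_multc) (auto simp: mult.assoc)
    finally show "ennreal ((w (x + h) - w x)\<^sup>2) * indicator A x \<le> \<dots>" .
  qed
  also have "\<dots> = ennreal ((norm h)\<^sup>2) * (\<integral>\<^sup>+x. (\<integral>\<^sup>+s. ennreal ((norm (D (x + s *\<^sub>R h)))\<^sup>2) * indicator {0..1} s * indicator A x \<partial>lborel) \<partial>lborel)"
    by (rule nn_integral_cmult) measurable
  also have "(\<integral>\<^sup>+x. (\<integral>\<^sup>+s. ennreal ((norm (D (x + s *\<^sub>R h)))\<^sup>2) * indicator {0..1} s * indicator A x \<partial>lborel) \<partial>lborel)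
      = (\<integral>\<^sup>+s. (\<integral>\<^sup>+x. ennreal ((norm (D (x + s *\<^sub>R h)))\<^sup>2) * indicator {0..1} s * indicator A x \<partial>lborel) \<partial>(lborel :: real measure))"
    by (rule lborel_pair.Fubini'[symmetric]) measurable
  also have "\<dots> \<le> (\<integral>\<^sup>+s. I * indicator {0..1} s \<partial>(lborel :: real measure))"
  proof (rule nn_integral_mono)
    fix s :: real
    have "(\<integral>\<^sup>+x. ennreal ((norm (D (x + s *\<^sub>R h)))\<^sup>2) * indicator {0..1} s * indicator A x \<partial>lborel)
      \<le> (\<integral>\<^sup>+x. ennreal ((norm (D (x + s *\<^sub>R h)))\<^sup>2) * indicator A' (x + s *\<^sub>R h) * indicator {0..1} s \<partial>lborel)"
      by (intro nn_integral_mono) (use sub in \<open>auto simp: indicator_def\<close>)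
    also have "\<dots> = (\<integral>\<^sup>+x. ennreal ((norm (D (x + s *\<^sub>R h)))\<^sup>2) * indicator A' (x + s *\<^sub>R h) \<partial>lborel) * indicator {0..1} s"
      by (rule nn_integral_multc) measurable
    also have "(\<integral>\<^sup>+x. ennreal ((norm (D (x + s *\<^sub>R h)))\<^sup>2) * indicator A' (x + s *\<^sub>R h) \<partial>lborel) = I"
      unfolding I_def
      by (rule lborel_nn_integral_translate[where f="\<lambda>x. ennreal ((norm (D x))\<^sup>2) * indicator A' x"]) measurable
    finally show "(\<integral>\<^sup>+x. ennreal ((norm (D (x + s *\<^sub>R h)))\<^sup>2) * indicator {0..1} s * indicator A x \<partial>lborel) \<le> I * indicator {0..1} s" .
  qed
  also have "\<dots> = I"
    by (simp add: nn_integral_cmult_indicator)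
  finally show ?thesis by (simp add: I_def mult_left_mono)
qed

lemma C1c_translation_L2:
  assumes w: "C1c w D"
  shows "(\<integral>\<^sup>+x. ennreal ((w (x + h) - w x)\<^sup>2) \<partial>lborel) \<le> ennreal ((norm h)\<^sup>2 * (LINT x|lborel. (norm (D x))\<^sup>2))"
proof -
  have "(\<integral>\<^sup>+x. ennreal ((norm (D x))\<^sup>2) \<partial>lborel) = ennreal (LINT x|lborel. (norm (D x))\<^sup>2)"
    by (rule nn_integral_eq_integral[OF L2_integrable[OF C1c_L2[OF w]]]) auto
  then show ?thesis
    using C1c_translation_estimate[OF w, of UNIV UNIV h] by (simp add: ennreal_mult)
qed

lemma C1c_translation_L1:
  assumes w: "C1c w D" and [measurable]: "A \<in> sets borel" and "bounded A"
    and L: "(LINT x|lborel. (norm (D x))\<^sup>2) \<le> L\<^sup>2" "0 \<le> L"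
  shows "(\<integral>\<^sup>+x. ennreal \<bar>w (x + h) - w x\<bar> * indicator A x \<partial>lborel) \<le> ennreal (norm h * L * sqrt (measure lborel A))"
proof -
  have [measurable]: "w \<in> borel_measurable borel" using C1c_measurable[OF w] by auto
  have fin: "emeasure lborel A = ennreal (measure lborel A)"
    using emeasure_bounded_finite[OF \<open>bounded A\<close>] by (intro emeasure_eq_ennreal_measure) auto
  define I where "I = (\<integral>\<^sup>+x. ennreal \<bar>w (x + h) - w x\<bar> * indicator A x \<partial>lborel)"
  have "I\<^sup>2 \<le> (\<integral>\<^sup>+x. (ennreal \<bar>w (x + h) - w x\<bar>)\<^sup>2 \<partial>lborel) * (\<integral>\<^sup>+x. (indicator A x)\<^sup>2 \<partial>lborel)"
    unfolding I_def by (rule Cauchy_Schwarz_nn_integral) measurable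
  also have "(\<integral>\<^sup>+x. (indicator A x)\<^sup>2 \<partial>lborel) = (\<integral>\<^sup>+x. indicator A x \<partial>lborel)"
    by (intro nn_integral_cong) (auto simp: indicator_def)
  also have "\<dots> = ennreal (measure lborel A)" by (simp add: fin)
  also have "(\<integral>\<^sup>+x. (ennreal \<bar>w (x + h) - w x\<bar>)\<^sup>2 \<partial>lborel) = (\<integral>\<^sup>+x. ennreal ((w (x + h) - w x)\<^sup>2) \<partial>lborel)"
    by (intro nn_integral_cong) (simp add: ennreal_power)
  also have "\<dots> \<le> ennreal ((norm h)\<^sup>2 * (LINT x|lborel. (norm (D x))\<^sup>2))"
    by (rule C1c_translation_L2[OF w])
  also have "\<dots> \<le> ennreal ((norm h)\<^sup>2 * L\<^sup>2)" by (intro ennreal_leI mult_left_mono L) auto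
  finally have "I\<^sup>2 \<le> ennreal ((norm h)\<^sup>2 * L\<^sup>2) * ennreal (measure lborel A)"
    by (simp add: mult_right_mono)
  also have "\<dots> = ennreal ((norm h * L * sqrt (measure lborel A))\<^sup>2)"
    by (simp add: ennreal_mult[symmetric] power_mult_distrib)
  also have "\<dots> = (ennreal (norm h * L * sqrt (measure lborel A)))\<^sup>2"
    by (rule ennreal_power[symmetric]) (use L in auto)
  finally have "I\<^sup>2 \<le> (ennreal (norm h * L * sqrt (measure lborel A)))\<^sup>2" .
  then have "I \<le> ennreal (norm h * L * sqrt (measure lborel A))"
  proof (cases I rule: ennreal_cases)
    case (real i)
    assume "I\<^sup>2 \<le> (ennreal (norm h * L * sqrt (measure lborel A)))\<^sup>2"
    then have "i\<^sup>2 \<le> (norm h * L * sqrt (measure lborel A))\<^sup>2"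
      using real L by (simp add: ennreal_power)
    then have "i \<le> norm h * L * sqrt (measure lborel A)"
      by (rule power2_le_imp_le) (use L in auto)
    then show ?thesis using real by (simp add: ennreal_leI)
  qed (use L in \<open>auto simp: ennreal_power top_power_ennreal top_unique\<close>)
  then show ?thesis by (simp add: I_def)
qed

section \<open>Compactness in \<open>L\<^sup>1\<close>\<close>

definition ball_average :: "real \<Rightarrow> ('a::euclidean_space \<Rightarrow> real) \<Rightarrow> 'a \<Rightarrow> real" where
  "ball_average \<rho> w x = (LINT h|lborel. indicator (ball 0 \<rho>) h * w (x + h)) / measure lborel (ball (0::'a) \<rho>)"

lemma C1c_ball_integrable:
  assumes w: "C1c w D"
  shows "integrable lborel (\<lambda>h. indicator (ball 0 \<rho>) h * w (x + h))"
proof -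
  have "integrable lborel (\<lambda>h. indicator (ball 0 \<rho>) h *\<^sub>R w (h + x))"
    by (intro integrable_mult_indicator lborel_integrable_translate C1c_integrable[OF w]) auto
  then show ?thesis by (simp add: add.commute)
qed

lemma ball_average_diff:
  assumes "C1c v E" "C1c w D"
  shows "ball_average \<rho> (\<lambda>x. v x - w x) x = ball_average \<rho> v x - ball_average \<rho> w x"
  unfolding ball_average_def
  using C1c_ball_integrable[OF assms(1)] C1c_ball_integrable[OF assms(2)]
  by (simp add: right_diff_distrib diff_divide_distrib)

lemma measure_ball_pos: "0 < \<rho> \<Longrightarrow> 0 < measure lborel (ball (0::'a::euclidean_space) \<rho>)"
  by (simp add: content_ball_pos)

lemma abs_ball_average_le:
  fixes x :: "'a::euclidean_space"
  assumes w: "C1c w D" and "\<rho> > 0"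
  shows "\<bar>ball_average \<rho> w x\<bar> \<le> (LINT x|lborel. \<bar>w x\<bar>) / measure lborel (ball (0::'a) \<rho>)"
proof -
  have "\<bar>LINT h|lborel. indicator (ball 0 \<rho>) h * w (x + h)\<bar> \<le> (LINT h|lborel. \<bar>indicator (ball 0 \<rho>) h * w (x + h)\<bar>)"
    by (rule integral_abs_bound)
  also have "\<dots> \<le> (LINT h|lborel. \<bar>w (h + x)\<bar>)"
  proof (rule integral_mono)
    show "integrable lborel (\<lambda>h. \<bar>indicator (ball 0 \<rho>) h * w (x + h)\<bar>)"
      by (intro integrable_abs C1c_ball_integrable[OF w])
    show "integrable lborel (\<lambda>h. \<bar>w (h + x)\<bar>)"
      by (intro integrable_abs lborel_integrable_translate C1c_integrable[OF w])
  qed (auto simp: indicator_def add.commute)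
  also have "\<dots> = (LINT x|lborel. \<bar>w x\<bar>)"
    using C1c_measurable[OF w] by (intro lborel_integral_translate[where f="\<lambda>x. \<bar>w x\<bar>"]) measurable
  finally show ?thesis using measure_ball_pos[OF \<open>\<rho> > 0\<close>, where 'a='a]
    by (simp add: ball_average_def field_simps)
qed

text \<open>At a fixed scale \<open>\<rho>\<close> the averages are Lipschitz with a constant that depends only on the \<open>L\<^sup>2\<close>
  norm of the gradient (for fixed \<open>x\<close>): this is the equicontinuity needed for Arzela--Ascoli.\<close>

lemma ball_average_lipschitz:
  fixes x y :: "'a::euclidean_space"
  assumes w: "C1c w D" and "\<rho> > 0"
    and L: "(LINT x|lborel. (norm (D x))\<^sup>2) \<le> L\<^sup>2" "0 \<le> L"
  shows "\<bar>ball_average \<rho> w y - ball_average \<rho> w x\<bar> \<le> norm (y - x) * (L * sqrt (measure lborel (ball x \<rho>)) / measure lborel (ball (0::'a) \<rho>))"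
proof -
  let ?v = "measure lborel (ball (0::'a) \<rho>)"
  have [measurable]: "ball x \<rho> \<in> sets borel" by simp
  have [measurable]: "w \<in> borel_measurable borel" using C1c_measurable[OF w] by auto
  define k where "k h = indicator (ball 0 \<rho>) h * (w (y + h) - w (x + h))" for h
  have k: "integrable lborel k"
    unfolding k_def right_diff_distrib by (intro Bochner_Integration.integrable_diff C1c_ball_integrable[OF w])
  have eq: "ball_average \<rho> w y - ball_average \<rho> w x = (LINT h|lborel. k h) / ?v"
    unfolding ball_average_def k_def using C1c_ball_integrable[OF w]
    by (simp add: right_diff_distrib diff_divide_distrib)
  have "ennreal \<bar>LINT h|lborel. k h\<bar> \<le> ennreal (LINT h|lborel. \<bar>k h\<bar>)"
    by (intro ennreal_leI integral_abs_bound)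
  also have "\<dots> = (\<integral>\<^sup>+h. ennreal \<bar>k h\<bar> \<partial>lborel)"
    by (rule nn_integral_eq_integral[symmetric]) (use k in auto)
  also have "\<dots> = (\<integral>\<^sup>+h. ennreal \<bar>w ((h + x) + (y - x)) - w (h + x)\<bar> * indicator (ball x \<rho>) (h + x) \<partial>lborel)"
    by (intro nn_integral_cong) (auto simp: k_def indicator_def dist_norm add.commute)
  also have "\<dots> = (\<integral>\<^sup>+h. ennreal \<bar>w (h + (y - x)) - w h\<bar> * indicator (ball x \<rho>) h \<partial>lborel)"
    by (rule lborel_nn_integral_translate[where f="\<lambda>h. ennreal \<bar>w (h + (y - x)) - w h\<bar> * indicator (ball x \<rho>) h"]) measurable
  also have "\<dots> \<le> ennreal (norm (y - x) * L * sqrt (measure lborel (ball x \<rho>)))"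
    by (rule C1c_translation_L1[OF w _ _ L]) auto
  finally have "\<bar>LINT h|lborel. k h\<bar> \<le> norm (y - x) * L * sqrt (measure lborel (ball x \<rho>))"
    using L by (subst (asm) ennreal_le_iff) auto
  then show ?thesis unfolding eq using measure_ball_pos[OF \<open>\<rho> > 0\<close>, where 'a='a]
    by (simp add: field_simps)
qed

text \<open>As \<open>\<rho>\<close> tends to \<open>0\<close> the averages approximate the function in \<open>L\<^sup>1\<close> of a bounded set, uniformly
  for bounded gradients: the error is an average of translation errors over \<open>|h| < \<rho>\<close>.\<close>

lemma ball_average_approx:
  fixes w :: "'a::euclidean_space \<Rightarrow> real"
  assumes w: "C1c w D" and "\<rho> > 0" and [measurable]: "A \<in> sets borel" and "bounded A"
    and L: "(LINT x|lborel. (norm (D x))\<^sup>2) \<le> L\<^sup>2" "0 \<le> L"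
  shows "(\<integral>\<^sup>+x. ennreal \<bar>w x - ball_average \<rho> w x\<bar> * indicator A x \<partial>lborel) \<le> ennreal (\<rho> * L * sqrt (measure lborel A))"
proof -
  let ?B = "ball (0::'a) \<rho>"
  have [measurable]: "?B \<in> sets borel" by simp
  define v where "v = measure lborel ?B"
  have v: "0 < v" unfolding v_def by (rule measure_ball_pos[OF \<open>\<rho> > 0\<close>])
  have ev: "emeasure lborel ?B = ennreal v"
    unfolding v_def using emeasure_bounded_finite[of ?B] by (intro emeasure_eq_ennreal_measure) auto
  have [measurable]: "w \<in> borel_measurable borel" using C1c_measurable[OF w] by auto
  have pt: "ennreal \<bar>w x - ball_average \<rho> w x\<bar> \<le> ennreal (1 / v) * (\<integral>\<^sup>+h. ennreal \<bar>w (x + h) - w x\<bar> * indicator ?B h \<partial>lborel)" for x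
  proof -
    define k where "k h = indicator ?B h * (w (x + h) - w x)" for h
    have i: "integrable lborel (\<lambda>h. indicator ?B h * w x)"
      using emeasure_bounded_finite[of ?B] by (intro integrable_mult_left) auto
    have k: "integrable lborel k"
      unfolding k_def right_diff_distrib by (intro Bochner_Integration.integrable_diff C1c_ball_integrable[OF w] i)
    have "(LINT h|lborel. k h) = (LINT h|lborel. indicator ?B h * w (x + h)) - v * w x"
      unfolding k_def v_def right_diff_distrib using i C1c_ball_integrable[OF w] by simp
    then have "ball_average \<rho> w x = ((LINT h|lborel. k h) + v * w x) / v"
      by (simp add: ball_average_def v_def[symmetric])
    then have "w x - ball_average \<rho> w x = - (1 / v) * (LINT h|lborel. k h)"
      using v by (simp add: add_divide_distrib)
    then have "\<bar>w x - ball_average \<rho> w x\<bar> = (1 / v) * \<bar>LINT h|lborel. k h\<bar>"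
      using v by (simp add: abs_mult)
    also have "\<dots> \<le> (1 / v) * (LINT h|lborel. \<bar>k h\<bar>)"
      using v by (intro mult_left_mono integral_abs_bound) auto
    finally have "ennreal \<bar>w x - ball_average \<rho> w x\<bar> \<le> ennreal ((1 / v) * (LINT h|lborel. \<bar>k h\<bar>))"
      by (rule ennreal_leI)
    also have "\<dots> = ennreal (1 / v) * ennreal (LINT h|lborel. \<bar>k h\<bar>)"
      using v by (intro ennreal_mult) auto
    also have "ennreal (LINT h|lborel. \<bar>k h\<bar>) = (\<integral>\<^sup>+h. ennreal \<bar>k h\<bar> \<partial>lborel)"
      by (rule nn_integral_eq_integral[symmetric]) (use k in auto)
    also have "\<dots> = (\<integral>\<^sup>+h. ennreal \<bar>w (x + h) - w x\<bar> * indicator ?B h \<partial>lborel)"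
      by (intro nn_integral_cong) (auto simp: k_def indicator_def)
    finally show ?thesis .
  qed
  have "(\<integral>\<^sup>+x. ennreal \<bar>w x - ball_average \<rho> w x\<bar> * indicator A x \<partial>lborel)
    \<le> (\<integral>\<^sup>+x. ennreal (1 / v) * (\<integral>\<^sup>+h. ennreal \<bar>w (x + h) - w x\<bar> * indicator ?B h * indicator A x \<partial>lborel) \<partial>lborel)"
  proof (rule nn_integral_mono)
    fix x
    have "ennreal \<bar>w x - ball_average \<rho> w x\<bar> * indicator A x
      \<le> (ennreal (1 / v) * (\<integral>\<^sup>+h. ennreal \<bar>w (x + h) - w x\<bar> * indicator ?B h \<partial>lborel)) * indicator A x"
      by (intro mult_right_mono pt) auto
    also have "\<dots> = ennreal (1 / v) * (\<integral>\<^sup>+h. ennreal \<bar>w (x + h) - w x\<bar> * indicator ?B h * indicator A x \<partial>lborel)"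
      by (subst nn_integral_multc) (auto simp: mult.assoc)
    finally show "ennreal \<bar>w x - ball_average \<rho> w x\<bar> * indicator A x \<le> \<dots>" .
  qed
  also have "\<dots> = ennreal (1 / v) * (\<integral>\<^sup>+x. (\<integral>\<^sup>+h. ennreal \<bar>w (x + h) - w x\<bar> * indicator ?B h * indicator A x \<partial>lborel) \<partial>lborel)"
    by (rule nn_integral_cmult) measurable
  also have "(\<integral>\<^sup>+x. (\<integral>\<^sup>+h. ennreal \<bar>w (x + h) - w x\<bar> * indicator ?B h * indicator A x \<partial>lborel) \<partial>lborel)
     = (\<integral>\<^sup>+h. (\<integral>\<^sup>+x. ennreal \<bar>w (x + h) - w x\<bar> * indicator ?B h * indicator A x \<partial>lborel) \<partial>lborel)"
    by (rule lborel_pair.Fubini'[symmetric]) measurable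
  also have "\<dots> \<le> (\<integral>\<^sup>+h. ennreal (\<rho> * L * sqrt (measure lborel A)) * indicator ?B h \<partial>lborel)"
  proof (rule nn_integral_mono)
    fix h
    have "(\<integral>\<^sup>+x. ennreal \<bar>w (x + h) - w x\<bar> * indicator ?B h * indicator A x \<partial>lborel)
      = (\<integral>\<^sup>+x. ennreal \<bar>w (x + h) - w x\<bar> * indicator A x * indicator ?B h \<partial>lborel)"
      by (simp add: mult_ac)
    also have "\<dots> = (\<integral>\<^sup>+x. ennreal \<bar>w (x + h) - w x\<bar> * indicator A x \<partial>lborel) * indicator ?B h"
      by (rule nn_integral_multc) measurable
    also have "\<dots> \<le> ennreal (norm h * L * sqrt (measure lborel A)) * indicator ?B h"
      by (intro mult_right_mono C1c_translation_L1[OF w _ \<open>bounded A\<close> L]) auto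
    also have "\<dots> \<le> ennreal (\<rho> * L * sqrt (measure lborel A)) * indicator ?B h"
      using L by (auto simp: indicator_def intro!: ennreal_leI mult_right_mono)
    finally show "(\<integral>\<^sup>+x. ennreal \<bar>w (x + h) - w x\<bar> * indicator ?B h * indicator A x \<partial>lborel)
      \<le> ennreal (\<rho> * L * sqrt (measure lborel A)) * indicator ?B h" .
  qed
  also have "\<dots> = ennreal (\<rho> * L * sqrt (measure lborel A)) * ennreal v"
    by (simp add: nn_integral_cmult_indicator ev)
  finally have "(\<integral>\<^sup>+x. ennreal \<bar>w x - ball_average \<rho> w x\<bar> * indicator A x \<partial>lborel)
    \<le> ennreal (1 / v) * (ennreal (\<rho> * L * sqrt (measure lborel A)) * ennreal v)"
    by (simp add: mult_left_mono)
  also have "\<dots> = ennreal ((1 / v) * ((\<rho> * L * sqrt (measure lborel A)) * v))"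
    using v L \<open>\<rho> > 0\<close> by (simp add: ennreal_mult[symmetric])
  also have "(1 / v) * ((\<rho> * L * sqrt (measure lborel A)) * v) = \<rho> * L * sqrt (measure lborel A)"
    using v by simp
  finally show ?thesis .
qed

lemma ball_average_measurable:
  assumes w: "C1c w D"
  shows "ball_average \<rho> w \<in> borel_measurable borel"
proof -
  have [measurable]: "w \<in> borel_measurable borel" using C1c_measurable[OF w] by auto
  have [measurable]: "ball (0::'a) \<rho> \<in> sets borel" by simp
  have "(\<lambda>x. LINT h|lborel. indicator (ball 0 \<rho>) h * w (x + h)) \<in> borel_measurable lborel"
    by (rule lborel.borel_measurable_lebesgue_integral) measurable
  then show ?thesis unfolding ball_average_def[abs_def] by simp
qed

text \<open>One scale of the Rellich--Kondrachov argument. The \<open>L\<^sup>1\<close> distance is split into the tail outside a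
  ball, the error of averaging at a small radius, and the distance of the averages, which converge
  uniformly along a subsequence by Arzela--Ascoli. Each part is at most \<open>e / 3\<close>.\<close>

lemma L1_close_subsequence:
  fixes \<phi> :: "nat \<Rightarrow> 'a::euclidean_space \<Rightarrow> real"
  assumes \<phi>: "\<And>n. C1c (\<phi> n) (D n)"
    and L: "\<And>n. (LINT x|lborel. (norm (D n x))\<^sup>2) \<le> L\<^sup>2" "0 \<le> L"
    and B: "\<And>n. (LINT x|lborel. \<bar>\<phi> n x\<bar>) \<le> B"
    and tight: "\<And>e. e > 0 \<Longrightarrow> \<exists>R. \<forall>n. (\<integral>\<^sup>+x. ennreal \<bar>\<phi> n x\<bar> * indicator (- cball 0 R) x \<partial>lborel) \<le> ennreal e"
    and "e > 0"
  obtains k where "strict_mono (k :: nat \<Rightarrow> nat)"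
    "\<exists>N. \<forall>i\<ge>N. \<forall>j\<ge>N. (LINT x|lborel. \<bar>\<phi> (k i) x - \<phi> (k j) x\<bar>) \<le> e"
proof -
  obtain R where R: "\<And>n. (\<integral>\<^sup>+x. ennreal \<bar>\<phi> n x\<bar> * indicator (- cball 0 R) x \<partial>lborel) \<le> ennreal (e / 6)"
    using tight[of "e / 6"] \<open>e > 0\<close> by auto
  define A where "A = cball (0::'a) R"
  have A[measurable]: "A \<in> sets borel" "bounded A" "compact A" by (auto simp: A_def)
  define m where "m = measure lborel A"
  have m: "0 \<le> m" by (simp add: m_def)
  have em: "emeasure lborel A = ennreal m"
    unfolding m_def using emeasure_bounded_finite[OF A(2)] by (intro emeasure_eq_ennreal_measure) auto
  \<comment> \<open>Differences of members of the sequence have gradient norm at most \<open>2 * L\<close>; the summand \<open>1\<close>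
     only keeps the denominator positive.\<close>
  define p where "p = 2 * L * sqrt m + 1"
  define \<rho> where "\<rho> = e / (3 * p)"
  have pos: "0 < p" unfolding p_def using L m by (intro add_nonneg_pos mult_nonneg_nonneg) auto
  have \<rho>: "\<rho> > 0" using \<open>e > 0\<close> pos by (simp add: \<rho>_def)
  have "\<rho> * (2 * L) * sqrt m \<le> \<rho> * p" using \<rho> by (simp add: p_def algebra_simps)
  also have "\<dots> = e / 3" using pos by (simp add: \<rho>_def)
  finally have \<rho>L: "\<rho> * (2 * L) * sqrt m \<le> e / 3" .
  have [measurable]: "\<phi> n \<in> borel_measurable borel" for n using C1c_measurable[OF \<phi>[of n]] by auto
  obtain g k where k: "strict_mono (k :: nat \<Rightarrow> nat)"
    and unif: "\<And>e. 0 < e \<Longrightarrow> \<exists>N. \<forall>n x. n \<ge> N \<and> x \<in> A \<longrightarrow> norm (ball_average \<rho> (\<phi> (k n)) x - g x) < e"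
  proof (rule Arzela_Ascoli[of A "\<lambda>n. ball_average \<rho> (\<phi> n)"])
    show "norm (ball_average \<rho> (\<phi> n) x) \<le> B / measure lborel (ball (0::'a) \<rho>)" for n x
    proof -
      have "\<bar>ball_average \<rho> (\<phi> n) x\<bar> \<le> (LINT x|lborel. \<bar>\<phi> n x\<bar>) / measure lborel (ball (0::'a) \<rho>)"
        by (rule abs_ball_average_le[OF \<phi> \<rho>])
      also have "\<dots> \<le> B / measure lborel (ball (0::'a) \<rho>)"
        using B measure_ball_pos[OF \<rho>, where 'a='a] by (intro divide_right_mono) auto
      finally show ?thesis by simp
    qed
  next
    fix x :: 'a and d :: real assume "0 < d"
    define K where "K = L * sqrt (measure lborel (ball x \<rho>)) / measure lborel (ball (0::'a) \<rho>)"
    have K: "0 \<le> K" using L by (simp add: K_def)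
    show "\<exists>\<delta>>0. \<forall>n y. y \<in> A \<and> norm (x - y) < \<delta> \<longrightarrow> norm (ball_average \<rho> (\<phi> n) x - ball_average \<rho> (\<phi> n) y) < d"
    proof (intro exI[of _ "d / (K + 1)"] conjI allI impI)
      show "0 < d / (K + 1)" using \<open>0 < d\<close> K by auto
      fix n y assume y: "y \<in> A \<and> norm (x - y) < d / (K + 1)"
      have "norm (ball_average \<rho> (\<phi> n) x - ball_average \<rho> (\<phi> n) y) \<le> norm (y - x) * K"
        using ball_average_lipschitz[OF \<phi> \<rho> L, of n y x] by (simp add: K_def abs_minus_commute)
      also have "\<dots> \<le> norm (y - x) * (K + 1)" by (intro mult_left_mono) auto
      also have "\<dots> < d" using y K by (simp add: norm_minus_commute field_simps)
      finally show "norm (ball_average \<rho> (\<phi> n) x - ball_average \<rho> (\<phi> n) y) < d" .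
    qed
  qed (use A in auto)
  define c where "c = e / (3 * (m + 1))"
  have c: "0 < c" using \<open>e > 0\<close> m by (simp add: c_def)
  obtain N where N: "\<And>n x. n \<ge> N \<Longrightarrow> x \<in> A \<Longrightarrow> norm (ball_average \<rho> (\<phi> (k n)) x - g x) < c / 2"
    using unif[of "c / 2"] c by auto
  have "(LINT x|lborel. \<bar>\<phi> (k i) x - \<phi> (k j) x\<bar>) \<le> e" if ij: "i \<ge> N" "j \<ge> N" for i j
  proof -
    define w where "w x = \<phi> (k i) x - \<phi> (k j) x" for x
    define Dw where "Dw x = D (k i) x - D (k j) x" for x
    have w: "C1c w Dw" unfolding w_def[abs_def] Dw_def[abs_def] by (intro C1c_diff \<phi>)
    have [measurable]: "w \<in> borel_measurable borel" using C1c_measurable[OF w] by auto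
    have [measurable]: "ball_average \<rho> w \<in> borel_measurable borel" by (rule ball_average_measurable[OF w])
    have "(LINT x|lborel. (norm (Dw x))\<^sup>2) \<le> (LINT x|lborel. 2 * (norm (D (k i) x))\<^sup>2 + 2 * (norm (D (k j) x))\<^sup>2)"
    proof (rule integral_mono)
      show "(norm (Dw x))\<^sup>2 \<le> 2 * (norm (D (k i) x))\<^sup>2 + 2 * (norm (D (k j) x))\<^sup>2" for x
        using norm_add_square_le[of "D (k i) x" "- D (k j) x"] by (simp add: Dw_def)
    qed (use L2_integrable[OF C1c_L2[OF w]] L2_integrable[OF C1c_L2[OF \<phi>]] in auto)
    also have "\<dots> = 2 * (LINT x|lborel. (norm (D (k i) x))\<^sup>2) + 2 * (LINT x|lborel. (norm (D (k j) x))\<^sup>2)"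
      using L2_integrable[OF C1c_L2[OF \<phi>]] by simp
    also have "\<dots> \<le> 2 * L\<^sup>2 + 2 * L\<^sup>2" using L(1)[of "k i"] L(1)[of "k j"] by linarith
    finally have Lw: "(LINT x|lborel. (norm (Dw x))\<^sup>2) \<le> (2 * L)\<^sup>2" by (simp add: power_mult_distrib)
    have avg: "\<bar>ball_average \<rho> w x\<bar> \<le> c" if "x \<in> A" for x
    proof -
      have "ball_average \<rho> w x = ball_average \<rho> (\<phi> (k i)) x - ball_average \<rho> (\<phi> (k j)) x"
        unfolding w_def[abs_def] by (rule ball_average_diff[OF \<phi> \<phi>])
      then show ?thesis using N[OF ij(1) that] N[OF ij(2) that] unfolding real_norm_def by linarith
    qed
    have tail: "(\<integral>\<^sup>+x. ennreal \<bar>w x\<bar> * indicator (- A) x \<partial>lborel) \<le> ennreal (e / 3)"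
    proof -
      have "(\<integral>\<^sup>+x. ennreal \<bar>w x\<bar> * indicator (- A) x \<partial>lborel) \<le> (\<integral>\<^sup>+x. ennreal \<bar>\<phi> (k i) x\<bar> * indicator (- A) x + ennreal \<bar>\<phi> (k j) x\<bar> * indicator (- A) x \<partial>lborel)"
        by (intro nn_integral_mono)
           (auto simp: w_def indicator_def ennreal_plus[symmetric] simp del: ennreal_plus intro!: ennreal_leI)
      also have "\<dots> = (\<integral>\<^sup>+x. ennreal \<bar>\<phi> (k i) x\<bar> * indicator (- A) x \<partial>lborel) + (\<integral>\<^sup>+x. ennreal \<bar>\<phi> (k j) x\<bar> * indicator (- A) x \<partial>lborel)"
        by (rule nn_integral_add) measurable
      also have "\<dots> \<le> ennreal (e / 6) + ennreal (e / 6)"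
        unfolding A_def by (intro add_mono R)
      also have "\<dots> = ennreal (e / 3)" using \<open>e > 0\<close> by (simp add: ennreal_plus[symmetric] del: ennreal_plus)
      finally show ?thesis .
    qed
    have "(\<integral>\<^sup>+x. ennreal \<bar>w x\<bar> \<partial>lborel) \<le> (\<integral>\<^sup>+x. (ennreal \<bar>w x - ball_average \<rho> w x\<bar> * indicator A x + ennreal c * indicator A x) + ennreal \<bar>w x\<bar> * indicator (- A) x \<partial>lborel)"
    proof (rule nn_integral_mono)
      fix x
      show "ennreal \<bar>w x\<bar> \<le> (ennreal \<bar>w x - ball_average \<rho> w x\<bar> * indicator A x + ennreal c * indicator A x) + ennreal \<bar>w x\<bar> * indicator (- A) x"
      proof (cases "x \<in> A")
        case True
        have "\<bar>w x\<bar> \<le> \<bar>w x - ball_average \<rho> w x\<bar> + c" using avg[OF True] by linarith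
        then show ?thesis using True c by (simp add: ennreal_plus[symmetric] ennreal_leI del: ennreal_plus)
      qed simp
    qed
    also have "\<dots> = (\<integral>\<^sup>+x. ennreal \<bar>w x - ball_average \<rho> w x\<bar> * indicator A x + ennreal c * indicator A x \<partial>lborel) + (\<integral>\<^sup>+x. ennreal \<bar>w x\<bar> * indicator (- A) x \<partial>lborel)"
      by (rule nn_integral_add) measurable
    also have "(\<integral>\<^sup>+x. ennreal \<bar>w x - ball_average \<rho> w x\<bar> * indicator A x + ennreal c * indicator A x \<partial>lborel) =
       (\<integral>\<^sup>+x. ennreal \<bar>w x - ball_average \<rho> w x\<bar> * indicator A x \<partial>lborel) + (\<integral>\<^sup>+x. ennreal c * indicator A x \<partial>lborel)"
      by (rule nn_integral_add) measurable
    also have "(\<integral>\<^sup>+x. ennreal c * indicator A x \<partial>lborel) = ennreal (c * m)"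
      using c m by (simp add: nn_integral_cmult_indicator em ennreal_mult)
    also have "c * m \<le> e / 3"
      using \<open>e > 0\<close> m by (simp add: c_def field_simps)
    also have "(\<integral>\<^sup>+x. ennreal \<bar>w x - ball_average \<rho> w x\<bar> * indicator A x \<partial>lborel) \<le> ennreal (\<rho> * (2 * L) * sqrt m)"
      unfolding m_def by (rule ball_average_approx[OF w \<rho> A(1,2) Lw]) (use L in auto)
    also have "\<rho> * (2 * L) * sqrt m \<le> e / 3" by (rule \<rho>L)
    also note tail
    also have "ennreal (e / 3) + ennreal (e / 3) + ennreal (e / 3) = ennreal e"
      using \<open>e > 0\<close> by (simp add: ennreal_plus[symmetric] del: ennreal_plus)
    finally have "(\<integral>\<^sup>+x. ennreal \<bar>w x\<bar> \<partial>lborel) \<le> ennreal e"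
      by (simp add: ennreal_leI add_mono)
    moreover have "(\<integral>\<^sup>+x. ennreal \<bar>w x\<bar> \<partial>lborel) = ennreal (LINT x|lborel. \<bar>w x\<bar>)"
      by (rule nn_integral_eq_integral) (use C1c_integrable[OF w] in auto)
    ultimately show ?thesis using \<open>e > 0\<close> by (simp add: w_def)
  qed
  then show thesis using that[OF k] by blast
qed

text \<open>Precompactness on the whole space: the tightness hypothesis replaces a bounded domain. A diagonal
  argument over the precisions \<open>1/(k+1)\<close> combines the subsequences found at each precision.\<close>

theorem L1_compactness:
  fixes \<phi> :: "nat \<Rightarrow> 'a::euclidean_space \<Rightarrow> real"
  assumes \<phi>: "\<And>n. C1c (\<phi> n) (D n)"
    and L: "\<And>n. (LINT x|lborel. (norm (D n x))\<^sup>2) \<le> L\<^sup>2" "0 \<le> L"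
    and B: "\<And>n. (LINT x|lborel. \<bar>\<phi> n x\<bar>) \<le> B"
    and tight: "\<And>e. e > 0 \<Longrightarrow> \<exists>R. \<forall>n. (\<integral>\<^sup>+x. ennreal \<bar>\<phi> n x\<bar> * indicator (- cball 0 R) x \<partial>lborel) \<le> ennreal e"
  obtains r where "strict_mono (r :: nat \<Rightarrow> nat)"
    "\<And>e. e > 0 \<Longrightarrow> \<exists>N. \<forall>i\<ge>N. \<forall>j\<ge>N. (LINT x|lborel. \<bar>\<phi> (r i) x - \<phi> (r j) x\<bar>) < e"
proof -
  define P where "P k s \<longleftrightarrow> (\<exists>N. \<forall>i\<ge>N. \<forall>j\<ge>N. (LINT x|lborel. \<bar>\<phi> (s i) x - \<phi> (s j) x\<bar>) \<le> 1 / real (Suc k))"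
    for k :: nat and s :: "nat \<Rightarrow> nat"
  have sub: "\<exists>k. strict_mono (k :: nat \<Rightarrow> nat) \<and> P i (s \<circ> k)" for i and s :: "nat \<Rightarrow> nat"
  proof -
    have t: "\<exists>R. \<forall>n. (\<integral>\<^sup>+x. ennreal \<bar>\<phi> (s n) x\<bar> * indicator (- cball 0 R) x \<partial>lborel) \<le> ennreal e" if "e > 0" for e
      using tight[OF that] by blast
    obtain k where "strict_mono (k :: nat \<Rightarrow> nat)"
      "\<exists>N. \<forall>a\<ge>N. \<forall>b\<ge>N. (LINT x|lborel. \<bar>\<phi> (s (k a)) x - \<phi> (s (k b)) x\<bar>) \<le> 1 / real (Suc i)"
      by (rule L1_close_subsequence[of "\<lambda>n. \<phi> (s n)" "\<lambda>n. D (s n)" L B "1 / real (Suc i)"])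
         (use \<phi> L B t in auto)
    then show "\<exists>k. strict_mono (k :: nat \<Rightarrow> nat) \<and> P i (s \<circ> k)" unfolding P_def o_def by blast
  qed
  have tail: "P i (s \<circ> k2)" if P1: "P i (s \<circ> k1)" and sub: "\<And>j. N \<le> j \<Longrightarrow> \<exists>j'. j \<le> j' \<and> k2 j = k1 j'"
    for i N and s k1 k2 :: "nat \<Rightarrow> nat"
  proof -
    obtain N' where N': "\<forall>a\<ge>N'. \<forall>b\<ge>N'. (LINT x|lborel. \<bar>\<phi> (s (k1 a)) x - \<phi> (s (k1 b)) x\<bar>) \<le> 1 / real (Suc i)"
      using P1 unfolding P_def o_def by blast
    show "P i (s \<circ> k2)" unfolding P_def o_def
    proof (intro exI[of _ "max N N'"] allI impI)
      fix a b assume a: "max N N' \<le> a" and b: "max N N' \<le> b"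
      obtain a' b' where "a \<le> a'" "k2 a = k1 a'" "b \<le> b'" "k2 b = k1 b'"
        using sub[of a] sub[of b] a b by auto
      then show "(LINT x|lborel. \<bar>\<phi> (s (k2 a)) x - \<phi> (s (k2 b)) x\<bar>) \<le> 1 / real (Suc i)"
        using N' a b by auto
    qed
  qed
  have "\<exists>r. strict_mono (r :: nat \<Rightarrow> nat) \<and> (\<forall>k. P k (id \<circ> r))"
  proof (rule subsequence_diagonalization_lemma[of P id])
    show "\<exists>k. strict_mono (k :: nat \<Rightarrow> nat) \<and> P i (s \<circ> k)" for i and s :: "nat \<Rightarrow> nat" by (rule sub)
    show "P i (s \<circ> k2)" if "P i (s \<circ> k1)" "\<And>j. N \<le> j \<Longrightarrow> \<exists>j'. j \<le> j' \<and> k2 j = k1 j'" for i N and s k1 k2 :: "nat \<Rightarrow> nat"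
      by (rule tail[OF that(1)]) (rule that(2))
    show "\<exists>r. strict_mono (r :: nat \<Rightarrow> nat) \<and> (\<forall>k. P k (id \<circ> r))" if "strict_mono k" "\<And>i. P i (id \<circ> k)" for k :: "nat \<Rightarrow> nat"
      using that by blast
  qed
  then obtain r where r: "strict_mono (r :: nat \<Rightarrow> nat)" "\<And>k. P k (id \<circ> r)"
    by blast
  show thesis
  proof (rule that[OF r(1)])
    fix e :: real assume "e > 0"
    then obtain k where k: "1 / real (Suc k) < e" using nat_approx_posE by blast
    then show "\<exists>N. \<forall>i\<ge>N. \<forall>j\<ge>N. (LINT x|lborel. \<bar>\<phi> (r i) x - \<phi> (r j) x\<bar>) < e"
      using r(2)[of k] unfolding P_def id_o by (meson order_le_less_trans)
  qed
qed

section \<open>Minimisation of the truncated energy\<close>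

lemma L2_parallelogram:
  assumes f: "L2 M f" and g: "L2 M g"
  shows "(LINT x|M. (norm (f x - g x))\<^sup>2) = 2 * (LINT x|M. (norm (f x))\<^sup>2) + 2 * (LINT x|M. (norm (g x))\<^sup>2)
     - 4 * (LINT x|M. (norm ((1/2) *\<^sub>R f x + (1/2) *\<^sub>R g x))\<^sup>2)"
proof -
  have h: "L2 M (\<lambda>x. (1/2) *\<^sub>R f x + (1/2) *\<^sub>R g x)" by (intro L2_add L2_scaleR f g)
  have "(LINT x|M. (norm (f x - g x))\<^sup>2) = (LINT x|M. (2 * (norm (f x))\<^sup>2 + 2 * (norm (g x))\<^sup>2) - 4 * (norm ((1/2) *\<^sub>R f x + (1/2) *\<^sub>R g x))\<^sup>2)"
    by (intro Bochner_Integration.integral_cong refl)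
       (simp only: power2_norm_eq_inner, simp add: inner_diff_left inner_diff_right inner_add_left inner_add_right inner_commute field_simps)
  also have "\<dots> = 2 * (LINT x|M. (norm (f x))\<^sup>2) + 2 * (LINT x|M. (norm (g x))\<^sup>2)
     - 4 * (LINT x|M. (norm ((1/2) *\<^sub>R f x + (1/2) *\<^sub>R g x))\<^sup>2)"
    using L2_integrable[OF f] L2_integrable[OF g] L2_integrable[OF h] by simp
  finally show ?thesis .
qed

text \<open>The integrability of \<open>1/V\<close> is what makes the problem compact on the whole space: by
  Cauchy--Schwarz, \<open>\<integral> V u\<^sup>2\<close> controls the \<open>L\<^sup>1\<close> norm of \<open>u\<close> and its tails.\<close>

locale confining_potential =
  fixes V :: "'a::euclidean_space \<Rightarrow> real" and V0 :: real
  assumes V0_pos: "0 < V0" and V_ge: "V0 \<le> V x" and V_continuous: "continuous_on UNIV V"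
    and V_inverse_integrable: "integrable lborel (\<lambda>x. 1 / V x)"
begin

lemma V_pos [simp]: "0 < V x" and V_nonneg [simp]: "0 \<le> V x" and V_nz [simp]: "V x \<noteq> 0"
  using V0_pos V_ge[of x] by auto

abbreviation rV :: "'a \<Rightarrow> real" where "rV x \<equiv> sqrt (V x)"

lemma V_measurable [measurable]: "V \<in> borel_measurable borel"
  by (rule borel_measurable_continuous_onI[OF V_continuous])

lemma rV_continuous: "continuous_on UNIV rV"
  by (intro continuous_intros V_continuous)

lemma C1c_L2_rV: "C1c \<phi> D \<Longrightarrow> L2 lborel (\<lambda>x. rV x * \<phi> x)"
  by (rule C1c_L2_weighted[OF _ rV_continuous])

text \<open>The norm of the embedding of the space with norm \<open>(\<integral> V u\<^sup>2)\<^sup>1\<^sup>/\<^sup>2\<close> into \<open>L\<^sup>1\<close>.\<close>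

definition embedding_const :: real where "embedding_const = sqrt (LINT x|lborel. 1 / V x)"

lemma embedding_const_nonneg: "0 \<le> embedding_const"
  unfolding embedding_const_def by (intro real_sqrt_ge_zero integral_nonneg_AE) auto

lemma L2_inverse_rV: "L2 lborel (\<lambda>x. 1 / rV x)"
  using V_inverse_integrable by (simp add: L2_def power_divide)

lemma weighted_Cauchy_Schwarz:
  assumes u: "L2 lborel (\<lambda>x. rV x * u x)" and [measurable]: "c \<in> borel_measurable borel" and c: "\<And>x. \<bar>c x\<bar> \<le> 1"
  shows "integrable lborel (\<lambda>x. c x * u x)"
    and "(LINT x|lborel. \<bar>c x * u x\<bar>) \<le> sqrt (LINT x|lborel. (c x)\<^sup>2 / V x) * sqrt (LINT x|lborel. (rV x * u x)\<^sup>2)"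
proof -
  have cL: "L2 lborel (\<lambda>x. c x / rV x)"
    using L2_bounded_mult[OF L2_inverse_rV, of c 1] c by simp
  show "integrable lborel (\<lambda>x. c x * u x)"
    using L2_mult_integrable[OF cL u] by simp
  show "(LINT x|lborel. \<bar>c x * u x\<bar>) \<le> sqrt (LINT x|lborel. (c x)\<^sup>2 / V x) * sqrt (LINT x|lborel. (rV x * u x)\<^sup>2)"
    using L2_Cauchy_Schwarz_norm[OF cL u] by (simp add: abs_mult power_divide power_mult_distrib)
qed

lemma integrable_if_weighted_L2:
  assumes u: "L2 lborel (\<lambda>x. rV x * u x)"
  shows "integrable lborel u" "(LINT x|lborel. \<bar>u x\<bar>) \<le> embedding_const * sqrt (LINT x|lborel. (rV x * u x)\<^sup>2)"
  using weighted_Cauchy_Schwarz[OF u, of "\<lambda>_. 1"] by (auto simp: embedding_const_def)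

lemma tail_small:
  assumes "e > 0"
  shows "\<exists>R. (LINT x|lborel. (indicator (- cball 0 R) x)\<^sup>2 / V x) < e"
proof -
  have "(\<lambda>n. LINT x|lborel. (indicator (- cball 0 (real n)) x)\<^sup>2 / V x) \<longlonglongrightarrow> (LINT x|(lborel :: 'a measure). 0)"
  proof (rule integral_dominated_convergence[where w="\<lambda>x. 1 / V x"])
    show "AE x in lborel. (\<lambda>n. (indicator (- cball 0 (real n)) x)\<^sup>2 / V x) \<longlonglongrightarrow> 0"
    proof (intro AE_I2 tendsto_eventually)
      fix x :: 'a
      obtain n0 where "norm x \<le> real n0" using real_arch_simple by blast
      then show "\<forall>\<^sub>F n in sequentially. (indicator (- cball 0 (real n)) x)\<^sup>2 / V x = 0"
        by (intro eventually_sequentiallyI[of n0]) (auto simp: indicator_def)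
    qed
    show "AE x in lborel. norm ((indicator (- cball 0 (real n)) x)\<^sup>2 / V x) \<le> 1 / V x" for n
      by (auto simp: indicator_def)
    have [measurable]: "- cball (0::'a) (real n) \<in> sets borel" for n by simp
    show "(\<lambda>x. (indicator (- cball 0 (real n)) x)\<^sup>2 / V x) \<in> borel_measurable lborel" for n by measurable
  qed (use V_inverse_integrable in auto)
  then have "\<forall>\<^sub>F n in sequentially. (LINT x|lborel. (indicator (- cball 0 (real n)) x)\<^sup>2 / V x) < e"
    using assms by (intro order_tendstoD) auto
  then show ?thesis using eventually_happens'[OF sequentially_bot] by blast
qed

end

text \<open>The nonlinearity \<open>g\<close> is bounded, so that its primitive \<open>G\<close> is Lipschitz and \<open>\<integral> G(u)\<close> is
  controlled by the \<open>L\<^sup>1\<close> norm alone.\<close>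

locale truncated_problem = confining_potential +
  fixes g G :: "real \<Rightarrow> real" and C :: real
  assumes G_deriv: "(G has_real_derivative g t) (at t)" and g_continuous: "continuous_on UNIV g"
    and g_bounded: "\<bar>g t\<bar> \<le> C" and G_0: "G 0 = 0"
begin

lemma C_nonneg: "0 \<le> C" using g_bounded[of 0] by linarith

lemma G_lipschitz: "\<bar>G s - G t\<bar> \<le> C * \<bar>s - t\<bar>"
  using field_differentiable_bound[of UNIV G g C s t] G_deriv g_bounded by auto

lemma G_le: "\<bar>G t\<bar> \<le> C * \<bar>t\<bar>"
  using G_lipschitz[of t 0] G_0 by simp

lemma G_continuous: "continuous_on UNIV G"
  using G_deriv by (intro DERIV_continuous_on[of UNIV G g]) (auto intro: has_field_derivative_at_within)

lemma G_measurable [measurable]: "G \<in> borel_measurable borel" and g_measurable [measurable]: "g \<in> borel_measurable borel"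
  by (auto intro: borel_measurable_continuous_onI G_continuous g_continuous)

lemma G_integrable:
  assumes "integrable M u" shows "integrable M (\<lambda>x. G (u x))"
proof (rule Bochner_Integration.integrable_bound)
  have [measurable]: "u \<in> borel_measurable M" using assms by auto
  show "(\<lambda>x. G (u x)) \<in> borel_measurable M" by measurable
  show "integrable M (\<lambda>x. C * u x)" using assms by simp
  show "AE x in M. norm (G (u x)) \<le> norm (C * u x)" using G_le C_nonneg by (auto simp: abs_mult)
qed

lemma G_integral_diff:
  assumes u: "integrable M u" and v: "integrable M v"
  shows "\<bar>(LINT x|M. G (u x)) - (LINT x|M. G (v x))\<bar> \<le> C * (LINT x|M. \<bar>u x - v x\<bar>)"
proof -
  have "(LINT x|M. G (u x)) - (LINT x|M. G (v x)) = (LINT x|M. G (u x) - G (v x))"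
    using G_integrable[OF u] G_integrable[OF v] by simp
  also have "\<bar>\<dots>\<bar> \<le> (LINT x|M. \<bar>G (u x) - G (v x)\<bar>)" by (rule integral_abs_bound)
  also have "\<dots> \<le> (LINT x|M. C * \<bar>u x - v x\<bar>)"
    using G_integrable[OF u] G_integrable[OF v] u v by (intro integral_mono G_lipschitz) auto
  finally show ?thesis by simp
qed

definition E :: "('a \<Rightarrow> real) \<Rightarrow> ('a \<Rightarrow> 'a) \<Rightarrow> real" where
  "E u p = (LINT x|lborel. (norm (p x))\<^sup>2) + (LINT x|lborel. (rV x * u x)\<^sup>2)"

definition J :: "('a \<Rightarrow> real) \<Rightarrow> ('a \<Rightarrow> 'a) \<Rightarrow> real" where
  "J u p = E u p / 2 - (LINT x|lborel. G (u x))"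

lemma E_nonneg: "0 \<le> E u p" by (simp add: E_def)

lemma L1_le_E:
  assumes "C1c \<phi> D" shows "(LINT x|lborel. \<bar>\<phi> x\<bar>) \<le> embedding_const * sqrt (E \<phi> D)"
proof -
  have "(LINT x|lborel. \<bar>\<phi> x\<bar>) \<le> embedding_const * sqrt (LINT x|lborel. (rV x * \<phi> x)\<^sup>2)"
    by (rule integrable_if_weighted_L2[OF C1c_L2_rV[OF assms]])
  also have "\<dots> \<le> embedding_const * sqrt (E \<phi> D)"
    by (intro mult_left_mono real_sqrt_le_mono embedding_const_nonneg) (simp add: E_def)
  finally show ?thesis .
qed

text \<open>Coercivity: \<open>\<integral> G(\<phi>)\<close> grows at most linearly in the energy norm.\<close>

lemma E_le_J:
  assumes "C1c \<phi> D" shows "E \<phi> D \<le> 4 * J \<phi> D + 4 * (C * embedding_const)\<^sup>2"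
proof -
  have "(LINT x|lborel. G (\<phi> x)) \<le> C * (LINT x|lborel. \<bar>\<phi> x\<bar>)"
    using G_integral_diff[OF C1c_integrable[OF assms], of "\<lambda>_. 0"] by (simp add: G_0)
  also have "\<dots> \<le> C * (embedding_const * sqrt (E \<phi> D))" by (intro mult_left_mono L1_le_E[OF assms] C_nonneg)
  also have "\<dots> = (C * embedding_const) * sqrt (E \<phi> D)" by simp
  also have "\<dots> \<le> (C * embedding_const)\<^sup>2 + (sqrt (E \<phi> D))\<^sup>2 / 4"
    using zero_le_power2[of "C * embedding_const - sqrt (E \<phi> D) / 2"] by (simp add: power2_diff power_divide algebra_simps)
  also have "(sqrt (E \<phi> D))\<^sup>2 = E \<phi> D" by (simp add: E_nonneg)
  finally show ?thesis by (simp add: J_def)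
qed

definition inf_J :: real where "inf_J = Inf {J \<phi> D | \<phi> D. C1c \<phi> D}"

lemma inf_J_le: assumes "C1c \<phi> D" shows "inf_J \<le> J \<phi> D"
  unfolding inf_J_def
proof (rule cInf_lower)
  show "bdd_below {J \<phi> D | \<phi> D. C1c \<phi> D}"
  proof (rule bdd_belowI[of _ "- (C * embedding_const)\<^sup>2"])
    fix y assume "y \<in> {J \<phi> D | \<phi> D. C1c \<phi> D}"
    then obtain \<phi> D where y: "y = J \<phi> D" "C1c \<phi> D" by blast
    show "- (C * embedding_const)\<^sup>2 \<le> y" using E_le_J[OF y(2)] E_nonneg[of \<phi> D] y(1) by linarith
  qed
qed (use assms in blast)

lemma J_near_inf: assumes "e > 0" shows "\<exists>\<phi> D. C1c \<phi> D \<and> J \<phi> D < inf_J + e"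
proof -
  have "C1c (\<lambda>_::'a. 0) (\<lambda>_. 0)" by (auto simp: C1c_def GDERIV_const)
  then have "{J \<phi> D | \<phi> D. C1c \<phi> D} \<noteq> {}" by blast
  from cInf_lessD[OF this, of "inf_J + e"] assms show ?thesis unfolding inf_J_def by auto
qed

text \<open>Along \<open>t \<eta>\<close> with a fixed bump \<open>\<eta>\<close> the quadratic part is of order \<open>t\<^sup>2\<close>, but \<open>\<integral> G(t \<eta>)\<close> is at least of
  order \<open>t\<close> to the power \<open>q < 2\<close>, which wins for small \<open>t\<close>.\<close>

lemma inf_J_negative:
  assumes q: "1 < q" "q < 2" and k: "0 < k" and M: "0 < M"
    and G_ge: "\<And>t. 0 \<le> t \<Longrightarrow> t \<le> M \<Longrightarrow> k * t powr q \<le> G t"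
  shows "inf_J < 0"
proof -
  obtain \<eta> F where \<eta>: "C1c \<eta> (F :: 'a \<Rightarrow> 'a)" and \<eta>nn: "\<And>x. 0 \<le> \<eta> x" and \<eta>1: "\<And>x. norm x \<le> 1 \<Longrightarrow> 1 \<le> \<eta> x"
    using C1c_cutoff[of 1] by (metis zero_less_one)
  obtain S where S: "\<And>x. norm x > S \<Longrightarrow> \<eta> x = 0" using C1c_support[OF \<eta>] by metis
  obtain B where B: "0 < B" "\<And>x. norm (\<eta> x) \<le> B"
    using bounded_continuous_compact_support[OF C1c_continuous[OF \<eta>], of S] S by metis
  have i\<eta>: "integrable lborel (\<lambda>x. \<eta> x powr q)"
    by (rule integrable_continuous_compact_support[where R=S], rule continuous_on_powr')
       (use S q \<eta>nn C1c_continuous[OF \<eta>] in auto)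
  define a where "a = k * (LINT x|lborel. \<eta> x powr q)"
  have "0 < measure lborel (ball (0::'a) 1)" by (rule measure_ball_pos) simp
  also have "\<dots> = (LINT x|lborel. indicator (ball (0::'a) 1) x)" by simp
  also have "\<dots> \<le> (LINT x|lborel. \<eta> x powr q)"
  proof (rule integral_mono[OF _ i\<eta>])
    show "integrable lborel (indicator (ball (0::'a) 1) :: 'a \<Rightarrow> real)"
      using emeasure_bounded_finite[of "ball (0::'a) 1"] by auto
    show "indicator (ball 0 1) x \<le> \<eta> x powr q" for x
      using \<eta>1[of x] q by (auto simp: indicator_def intro: ge_one_powr_ge_zero)
  qed
  finally have a: "0 < a" using k by (simp add: a_def)
  \<comment> \<open>The amplitude \<open>t\<close> keeps \<open>t \<eta>\<close> below \<open>M\<close> and makes the quadratic part at most half of \<open>t\<close> to the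
     power \<open>q\<close> times \<open>a\<close>.\<close>
  define e where "e = a / (E \<eta> F + 1)"
  have e: "0 < e" unfolding e_def using a E_nonneg[of \<eta> F] by (intro divide_pos_pos) linarith+
  define t where "t = min (M / B) (e powr (1 / (2 - q)))"
  have "0 < e powr (1 / (2 - q))" unfolding powr_gt_zero using e by linarith
  then have t: "0 < t" using M B by (simp add: t_def)
  have tM: "t * \<eta> x \<le> M" for x
  proof -
    have "t * \<eta> x \<le> (M / B) * B" using t B(2)[of x] \<eta>nn[of x] M B(1) by (intro mult_mono) (auto simp: t_def)
    then show ?thesis using B by simp
  qed
  have "t powr (2 - q) \<le> (e powr (1 / (2 - q))) powr (2 - q)"
    using t q by (intro powr_mono2) (auto simp: t_def)
  also have "\<dots> = e" using q e by (simp add: powr_powr)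
  finally have t2: "t powr (2 - q) \<le> e" .
  have "t\<^sup>2 * E \<eta> F = t powr q * (t powr (2 - q) * E \<eta> F)"
    using t by (simp add: powr_add[symmetric] mult.assoc[symmetric])
  also have "t powr (2 - q) * E \<eta> F \<le> e * E \<eta> F"
    by (intro mult_right_mono t2 E_nonneg)
  also have "\<dots> \<le> a" unfolding e_def using a E_nonneg[of \<eta> F] by (simp add: field_simps)
  finally have tE: "t\<^sup>2 * E \<eta> F \<le> t powr q * a" using t by (simp add: mult_left_mono)
  have "t powr q * a = (LINT x|lborel. k * (t * \<eta> x) powr q)"
    using t \<eta>nn by (simp add: a_def powr_mult)
  also have "\<dots> \<le> (LINT x|lborel. G (t * \<eta> x))"
  proof (rule integral_mono)
    show "integrable lborel (\<lambda>x. k * (t * \<eta> x) powr q)" using i\<eta> t \<eta>nn by (simp add: powr_mult)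
    show "integrable lborel (\<lambda>x. G (t * \<eta> x))" by (rule G_integrable[OF C1c_integrable[OF C1c_scale[OF \<eta>]]])
    show "k * (t * \<eta> x) powr q \<le> G (t * \<eta> x)" for x
      using tM[of x] t \<eta>nn[of x] by (intro G_ge) auto
  qed
  finally have tG: "t powr q * a \<le> (LINT x|lborel. G (t * \<eta> x))" .
  have "E (\<lambda>x. t * \<eta> x) (\<lambda>x. t *\<^sub>R F x) = t\<^sup>2 * E \<eta> F"
  proof -
    have "(LINT x|lborel. (rV x * (t * \<eta> x))\<^sup>2) = (LINT x|lborel. t\<^sup>2 * (rV x * \<eta> x)\<^sup>2)"
      by (intro Bochner_Integration.integral_cong refl) (simp add: power_mult_distrib)
    then show ?thesis unfolding E_def by (simp add: power_mult_distrib distrib_left)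
  qed
  then have "J (\<lambda>x. t * \<eta> x) (\<lambda>x. t *\<^sub>R F x) = t\<^sup>2 * E \<eta> F / 2 - (LINT x|lborel. G (t * \<eta> x))"
    by (simp add: J_def)
  also have "\<dots> \<le> t powr q * a / 2 - t powr q * a" using tE tG by linarith
  also have "\<dots> < 0" using t a by simp
  finally show ?thesis using inf_J_le[OF C1c_scale[OF \<eta>, of t]] by simp
qed

text \<open>Strong convexity of the quadratic part: by the parallelogram law two almost minimisers that
  are close in \<open>L\<^sup>1\<close> are close in the energy norm, as their midpoint cannot beat the infimum.\<close>

lemma E_diff_le:
  assumes \<phi>: "C1c \<phi> D" and \<psi>: "C1c \<psi> F"
  shows "E (\<lambda>x. \<phi> x - \<psi> x) (\<lambda>x. D x - F x) \<le> 4 * (J \<phi> D - inf_J) + 4 * (J \<psi> F - inf_J) + 4 * C * (LINT x|lborel. \<bar>\<phi> x - \<psi> x\<bar>)"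
proof -
  define \<mu> H where "\<mu> x = (1/2) * \<phi> x + (1/2) * \<psi> x" and "H x = (1/2) *\<^sub>R D x + (1/2) *\<^sub>R F x" for x
  have \<mu>: "C1c \<mu> H" unfolding \<mu>_def[abs_def] H_def[abs_def] by (rule C1c_lincomb[OF \<phi> \<psi>])
  have 1: "(LINT x|lborel. (norm (D x - F x))\<^sup>2) = 2 * (LINT x|lborel. (norm (D x))\<^sup>2) + 2 * (LINT x|lborel. (norm (F x))\<^sup>2)
     - 4 * (LINT x|lborel. (norm (H x))\<^sup>2)"
    unfolding H_def by (rule L2_parallelogram[OF C1c_L2[OF \<phi>] C1c_L2[OF \<psi>]])
  have 2: "(LINT x|lborel. (rV x * (\<phi> x - \<psi> x))\<^sup>2) = 2 * (LINT x|lborel. (rV x * \<phi> x)\<^sup>2) + 2 * (LINT x|lborel. (rV x * \<psi> x)\<^sup>2)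
     - 4 * (LINT x|lborel. (rV x * \<mu> x)\<^sup>2)"
    using L2_parallelogram[OF C1c_L2_rV[OF \<phi>] C1c_L2_rV[OF \<psi>]] by (simp add: \<mu>_def algebra_simps)
  have 3: "E (\<lambda>x. \<phi> x - \<psi> x) (\<lambda>x. D x - F x) = 2 * E \<phi> D + 2 * E \<psi> F - 4 * E \<mu> H"
    unfolding E_def 1 2 by simp
  have d1: "(LINT x|lborel. G (\<phi> x)) - (LINT x|lborel. G (\<mu> x)) \<le> C * (LINT x|lborel. (1/2) * \<bar>\<phi> x - \<psi> x\<bar>)"
  proof -
    have "(LINT x|lborel. G (\<phi> x)) - (LINT x|lborel. G (\<mu> x)) \<le> C * (LINT x|lborel. \<bar>\<phi> x - \<mu> x\<bar>)"
      using G_integral_diff[OF C1c_integrable[OF \<phi>] C1c_integrable[OF \<mu>]] by linarith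
    also have "(LINT x|lborel. \<bar>\<phi> x - \<mu> x\<bar>) = (LINT x|lborel. (1/2) * \<bar>\<phi> x - \<psi> x\<bar>)"
      by (intro Bochner_Integration.integral_cong refl) (simp add: \<mu>_def abs_if field_simps)
    finally show ?thesis .
  qed
  have d2: "(LINT x|lborel. G (\<psi> x)) - (LINT x|lborel. G (\<mu> x)) \<le> C * (LINT x|lborel. (1/2) * \<bar>\<phi> x - \<psi> x\<bar>)"
  proof -
    have "(LINT x|lborel. G (\<psi> x)) - (LINT x|lborel. G (\<mu> x)) \<le> C * (LINT x|lborel. \<bar>\<psi> x - \<mu> x\<bar>)"
      using G_integral_diff[OF C1c_integrable[OF \<psi>] C1c_integrable[OF \<mu>]] by linarith
    also have "(LINT x|lborel. \<bar>\<psi> x - \<mu> x\<bar>) = (LINT x|lborel. (1/2) * \<bar>\<phi> x - \<psi> x\<bar>)"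
      by (intro Bochner_Integration.integral_cong refl) (simp add: \<mu>_def abs_if field_simps)
    finally show ?thesis .
  qed
  have "C * (LINT x|lborel. (1/2) * \<bar>\<phi> x - \<psi> x\<bar>) = C * (LINT x|lborel. \<bar>\<phi> x - \<psi> x\<bar>) / 2" by simp
  then show ?thesis using 3 d1 d2 inf_J_le[OF \<mu>] unfolding J_def by argo
qed

text \<open>Coercivity bounds a minimising sequence in the energy norm, compactness makes a subsequence
  Cauchy in \<open>L\<^sup>1\<close>, and then strong convexity makes it Cauchy in the energy norm itself. So the limit is
  reached in the energy norm.\<close>

theorem minimizing_sequence:
  obtains \<phi> D u p where
    "\<And>n. C1c (\<phi> n) (D n)" "(\<lambda>n. J (\<phi> n) (D n)) \<longlonglongrightarrow> inf_J"
    "L2_lim lborel D p" "L2_lim lborel (\<lambda>n x. rV x * \<phi> n x) (\<lambda>x. rV x * u x)"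
    "AE x in lborel. (\<lambda>n. \<phi> n x) \<longlonglongrightarrow> u x" "u \<in> borel_measurable borel"
proof -
  have "\<exists>\<phi> D. C1c \<phi> D \<and> J \<phi> D < inf_J + 1 / real (Suc n)" for n
    by (rule J_near_inf) simp
  then obtain \<phi> D where \<phi>: "\<And>n. C1c (\<phi> n) (D n)" and Jn: "\<And>n. J (\<phi> n) (D n) < inf_J + 1 / real (Suc n)"
    by metis
  have Jlim: "(\<lambda>n. J (\<phi> n) (D n)) \<longlonglongrightarrow> inf_J"
  proof (rule tendsto_sandwich[OF _ _ tendsto_const])
    show "\<forall>\<^sub>F n in sequentially. inf_J \<le> J (\<phi> n) (D n)" using inf_J_le[OF \<phi>] by simp
    show "\<forall>\<^sub>F n in sequentially. J (\<phi> n) (D n) \<le> inf_J + 1 / real (Suc n)" using Jn by (simp add: less_imp_le)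
    show "(\<lambda>n. inf_J + 1 / real (Suc n)) \<longlonglongrightarrow> inf_J"
      using tendsto_add[OF tendsto_const LIMSEQ_inverse_real_of_nat, of inf_J] by (simp add: inverse_eq_divide)
  qed
  define K where "K = 4 * (inf_J + 1) + 4 * (C * embedding_const)\<^sup>2"
  have EK: "E (\<phi> n) (D n) \<le> K" for n
  proof -
    have "1 / real (Suc n) \<le> 1" by simp
    then have "J (\<phi> n) (D n) \<le> inf_J + 1" using Jn[of n] by linarith
    then show ?thesis by (intro order_trans[OF E_le_J[OF \<phi>]]) (simp add: K_def)
  qed
  have K: "0 \<le> K" using EK[of 0] E_nonneg[of "\<phi> 0" "D 0"] by linarith
  \<comment> \<open>The sequence is bounded in the energy norm, so it satisfies the hypotheses of the compactness theorem.\<close>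
  have V2: "(LINT x|lborel. (rV x * \<phi> n x)\<^sup>2) \<le> K" for n
    using EK[of n] by (simp add: E_def) (smt (verit) integral_nonneg_AE AE_I2 zero_le_power2)
  obtain r where r: "strict_mono (r :: nat \<Rightarrow> nat)"
    and L1: "\<And>e. e > 0 \<Longrightarrow> \<exists>N. \<forall>i\<ge>N. \<forall>j\<ge>N. (LINT x|lborel. \<bar>\<phi> (r i) x - \<phi> (r j) x\<bar>) < e"
  proof (rule L1_compactness[OF \<phi>, where L="sqrt K" and B="embedding_const * sqrt K"])
    show "(LINT x|lborel. (norm (D n x))\<^sup>2) \<le> (sqrt K)\<^sup>2" for n
      using EK[of n] K by (simp add: E_def) (smt (verit) integral_nonneg_AE AE_I2 zero_le_power2)
    show "(LINT x|lborel. \<bar>\<phi> n x\<bar>) \<le> embedding_const * sqrt K" for n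
      using L1_le_E[OF \<phi>] by (rule order_trans) (intro mult_left_mono real_sqrt_le_mono EK embedding_const_nonneg)
    show "\<exists>R. \<forall>n. (\<integral>\<^sup>+x. ennreal \<bar>\<phi> n x\<bar> * indicator (- cball 0 R) x \<partial>lborel) \<le> ennreal e" if "e > 0" for e
    proof -
      have pos: "0 < sqrt K + 1" using K by (simp add: add_nonneg_pos)
      then have "0 < (e / (sqrt K + 1))\<^sup>2" using that by simp
      from tail_small[OF this]
      obtain R where R: "(LINT x|lborel. (indicator (- cball 0 R) x)\<^sup>2 / V x) < (e / (sqrt K + 1))\<^sup>2"
        by blast
      have "(\<integral>\<^sup>+x. ennreal \<bar>\<phi> n x\<bar> * indicator (- cball 0 R) x \<partial>lborel) \<le> ennreal e" for n
      proof -
        have [measurable]: "- cball (0::'a) R \<in> sets borel" by simp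
        have i: "integrable lborel (\<lambda>x. indicator (- cball 0 R) x * \<phi> n x)"
          by (rule weighted_Cauchy_Schwarz(1)[OF C1c_L2_rV[OF \<phi>]]) (measurable, auto simp: indicator_def)
        have "(LINT x|lborel. \<bar>indicator (- cball 0 R) x * \<phi> n x\<bar>)
          \<le> sqrt (LINT x|lborel. (indicator (- cball 0 R) x)\<^sup>2 / V x) * sqrt (LINT x|lborel. (rV x * \<phi> n x)\<^sup>2)"
          by (rule weighted_Cauchy_Schwarz(2)[OF C1c_L2_rV[OF \<phi>]]) (measurable, auto simp: indicator_def)
        also have "\<dots> \<le> (e / (sqrt K + 1)) * sqrt K"
        proof (intro mult_mono real_sqrt_le_mono V2)
          show "sqrt (LINT x|lborel. (indicator (- cball 0 R) x)\<^sup>2 / V x) \<le> e / (sqrt K + 1)"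
            using R that K by (intro real_le_lsqrt) auto
        qed (use that K in auto)
        also have "\<dots> \<le> e" using that pos by (simp add: field_simps)
        finally have le: "(LINT x|lborel. \<bar>indicator (- cball 0 R) x * \<phi> n x\<bar>) \<le> e" .
        have "(\<integral>\<^sup>+x. ennreal \<bar>\<phi> n x\<bar> * indicator (- cball 0 R) x \<partial>lborel) = (\<integral>\<^sup>+x. ennreal \<bar>indicator (- cball 0 R) x * \<phi> n x\<bar> \<partial>lborel)"
          by (intro nn_integral_cong) (auto simp: indicator_def)
        also have "\<dots> = ennreal (LINT x|lborel. \<bar>indicator (- cball 0 R) x * \<phi> n x\<bar>)"
          by (rule nn_integral_eq_integral) (use i in auto)
        finally show ?thesis using le by (simp add: ennreal_leI)
      qed
      then show ?thesis by blast
    qed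
  qed (use K in auto)
  have Cauchy: "\<exists>N. \<forall>i\<ge>N. \<forall>j\<ge>N. E (\<lambda>x. \<phi> (r i) x - \<phi> (r j) x) (\<lambda>x. D (r i) x - D (r j) x) < e" if "e > 0" for e
  proof -
    have "0 < e / (16 * (C + 1))" using that C_nonneg by auto
    from L1[OF this] obtain N1 where N1: "\<And>i j. i \<ge> N1 \<Longrightarrow> j \<ge> N1 \<Longrightarrow> (LINT x|lborel. \<bar>\<phi> (r i) x - \<phi> (r j) x\<bar>) < e / (16 * (C + 1))"
      by blast
    have "(\<lambda>n. J (\<phi> (r n)) (D (r n))) \<longlonglongrightarrow> inf_J"
      using LIMSEQ_subseq_LIMSEQ[OF Jlim r] by (simp add: o_def)
    then have "\<forall>\<^sub>F n in sequentially. J (\<phi> (r n)) (D (r n)) < inf_J + e / 16"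
      using that by (intro order_tendstoD) auto
    then obtain N2 where N2: "\<And>n. n \<ge> N2 \<Longrightarrow> J (\<phi> (r n)) (D (r n)) < inf_J + e / 16"
      by (auto simp: eventually_sequentially)
    have "E (\<lambda>x. \<phi> (r i) x - \<phi> (r j) x) (\<lambda>x. D (r i) x - D (r j) x) < e" if ij: "i \<ge> max N1 N2" "j \<ge> max N1 N2" for i j
    proof -
      have "4 * C * (LINT x|lborel. \<bar>\<phi> (r i) x - \<phi> (r j) x\<bar>) \<le> 4 * C * (e / (16 * (C + 1)))"
        using N1[of i j] ij C_nonneg by (intro mult_left_mono) auto
      also have "\<dots> \<le> e / 4" using \<open>e > 0\<close> C_nonneg by (simp add: field_simps)
      finally have "4 * C * (LINT x|lborel. \<bar>\<phi> (r i) x - \<phi> (r j) x\<bar>) \<le> e / 4" .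
      then show ?thesis using E_diff_le[OF \<phi> \<phi>, of "r i" "r j"] N2[of i] N2[of j] ij \<open>e > 0\<close> by auto
    qed
    then show ?thesis by blast
  qed
  obtain p r' where p: "L2_lim lborel (\<lambda>n. D (r n)) p" and "strict_mono (r' :: nat \<Rightarrow> nat)"
  proof (rule L2_complete[where M=lborel and f="\<lambda>n. D (r n)" and w="\<lambda>x. 1 / rV x"])
    fix e :: real assume "e > 0"
    then obtain N where N: "\<forall>i\<ge>N. \<forall>j\<ge>N. E (\<lambda>x. \<phi> (r i) x - \<phi> (r j) x) (\<lambda>x. D (r i) x - D (r j) x) < e"
      using Cauchy by blast
    have "(LINT x|lborel. (norm (D (r i) x - D (r j) x))\<^sup>2) \<le> E (\<lambda>x. \<phi> (r i) x - \<phi> (r j) x) (\<lambda>x. D (r i) x - D (r j) x)" for i j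
      by (simp add: E_def)
    then show "\<exists>N. \<forall>i\<ge>N. \<forall>j\<ge>N. (LINT x|lborel. (norm (D (r i) x - D (r j) x))\<^sup>2) < e"
      using N by (meson order_le_less_trans)
  qed (use C1c_L2[OF \<phi>] L2_inverse_rV in \<open>auto intro!: divide_pos_pos\<close>)
  obtain h s where h: "L2_lim lborel (\<lambda>n x. rV x * \<phi> (r n) x) h" and s: "strict_mono (s :: nat \<Rightarrow> nat)"
    and AE: "AE x in lborel. (\<lambda>n. rV x * \<phi> (r (s n)) x) \<longlonglongrightarrow> h x"
  proof (rule L2_complete[where M=lborel and f="\<lambda>n x. rV x * \<phi> (r n) x" and w="\<lambda>x. 1 / rV x"])
    fix e :: real assume "e > 0"
    then obtain N where N: "\<forall>i\<ge>N. \<forall>j\<ge>N. E (\<lambda>x. \<phi> (r i) x - \<phi> (r j) x) (\<lambda>x. D (r i) x - D (r j) x) < e"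
      using Cauchy by blast
    have "(LINT x|lborel. (norm (rV x * \<phi> (r i) x - rV x * \<phi> (r j) x))\<^sup>2) \<le> E (\<lambda>x. \<phi> (r i) x - \<phi> (r j) x) (\<lambda>x. D (r i) x - D (r j) x)" for i j
      by (simp add: E_def right_diff_distrib)
    then show "\<exists>N. \<forall>i\<ge>N. \<forall>j\<ge>N. (LINT x|lborel. (norm (rV x * \<phi> (r i) x - rV x * \<phi> (r j) x))\<^sup>2) < e"
      using N by (meson order_le_less_trans)
  qed (use C1c_L2_rV[OF \<phi>] L2_inverse_rV in auto)
  define u where "u x = h x / rV x" for x
  have hm[measurable]: "h \<in> borel_measurable borel" using L2_limD(2)[OF h] by (simp add: L2_def)
  show thesis
  proof (rule that[of "\<lambda>n. \<phi> (r (s n))" "\<lambda>n. D (r (s n))" p u])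
    show "C1c (\<phi> (r (s n))) (D (r (s n)))" for n by (rule \<phi>)
    show "(\<lambda>n. J (\<phi> (r (s n))) (D (r (s n)))) \<longlonglongrightarrow> inf_J"
      using LIMSEQ_subseq_LIMSEQ[OF Jlim strict_mono_o[OF r s]] by (simp add: o_def)
    show "L2_lim lborel (\<lambda>n. D (r (s n))) p" by (rule L2_lim_subseq[OF p s])
    show "L2_lim lborel (\<lambda>n x. rV x * \<phi> (r (s n)) x) (\<lambda>x. rV x * u x)"
      using L2_lim_subseq[OF h s] by (simp add: u_def)
    show "AE x in lborel. (\<lambda>n. \<phi> (r (s n)) x) \<longlonglongrightarrow> u x"
      using AE
    proof eventually_elim
      case (elim x)
      from tendsto_divide[OF this tendsto_const, of "rV x"] show ?case by (simp add: u_def)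
    qed
    show "u \<in> borel_measurable borel" unfolding u_def[abs_def] by measurable
  qed
qed

end

section \<open>The Euler--Lagrange equation\<close>

lemma L2_lim_add_const:
  assumes "L2_lim M f h" "L2 M k" shows "L2_lim M (\<lambda>n x. f n x + k x) (\<lambda>x. h x + k x)"
  using assms L2_add[of M _ k] by (auto simp: L2_lim_def)

text \<open>The minimiser \<open>u\<close> and its gradient \<open>p\<close> are kept together with the \<open>C\<^sup>1\<close> functions that
  approximate them. Every nonlinear test function below is first built from \<open>\<phi>\<^sub>n\<close>, where the classical
  chain rule applies, and then passed to the limit.\<close>

locale minimizer = truncated_problem +
  fixes \<phi> :: "nat \<Rightarrow> 'a \<Rightarrow> real" and D :: "nat \<Rightarrow> 'a \<Rightarrow> 'a" and u :: "'a \<Rightarrow> real" and p :: "'a \<Rightarrow> 'a"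
  assumes \<phi>: "C1c (\<phi> n) (D n)" and J_lim: "(\<lambda>n. J (\<phi> n) (D n)) \<longlonglongrightarrow> inf_J"
    and D_lim: "L2_lim lborel D p" and \<phi>_lim: "L2_lim lborel (\<lambda>n x. rV x * \<phi> n x) (\<lambda>x. rV x * u x)"
    and AE_lim: "AE x in lborel. (\<lambda>n. \<phi> n x) \<longlonglongrightarrow> u x" and u_measurable [measurable]: "u \<in> borel_measurable borel"
begin

lemma \<phi>_measurable [measurable]: "\<phi> n \<in> borel_measurable borel" "D n \<in> borel_measurable borel"
  using C1c_measurable[OF \<phi>] by auto

lemma p_L2: "L2 lborel p" and u_L2: "L2 lborel (\<lambda>x. rV x * u x)"
  using L2_limD[OF D_lim] L2_limD[OF \<phi>_lim] by auto

lemma p_measurable [measurable]: "p \<in> borel_measurable borel"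
  using p_L2 by (simp add: L2_def)

lemma u_integrable: "integrable lborel u"
  by (rule integrable_if_weighted_L2[OF u_L2])

lemma \<phi>_L1_lim: "(\<lambda>n. LINT x|lborel. \<bar>\<phi> n x - u x\<bar>) \<longlonglongrightarrow> 0"
proof (rule tendsto_sandwich[OF _ _ tendsto_const])
  have "L2 lborel (\<lambda>x. rV x * (\<phi> n x - u x))" for n
    using L2_diff[OF C1c_L2_rV[OF \<phi>] u_L2] by (simp add: right_diff_distrib)
  from integrable_if_weighted_L2(2)[OF this]
  show "\<forall>\<^sub>F n in sequentially. (LINT x|lborel. \<bar>\<phi> n x - u x\<bar>) \<le> embedding_const * sqrt (LINT x|lborel. (rV x * (\<phi> n x - u x))\<^sup>2)" by simp
  have "(\<lambda>n. LINT x|lborel. (rV x * (\<phi> n x - u x))\<^sup>2) \<longlonglongrightarrow> 0"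
    using L2_limD(3)[OF \<phi>_lim] by (simp add: right_diff_distrib)
  from tendsto_mult_left[OF tendsto_real_sqrt[OF this], of embedding_const]
  show "(\<lambda>n. embedding_const * sqrt (LINT x|lborel. (rV x * (\<phi> n x - u x))\<^sup>2)) \<longlonglongrightarrow> 0" by simp
qed auto

text \<open>Integration by parts passes to the limit, so \<open>p\<close> is a weak gradient of \<open>u\<close>.\<close>

lemma weak_gradient_limit:
  assumes \<psi>: "C1c \<psi> F"
  shows "(LINT x|lborel. u x * (F x \<bullet> b)) = - (LINT x|lborel. (p x \<bullet> b) * \<psi> x)"
proof -
  obtain R where R: "\<And>x. norm x > R \<Longrightarrow> F x = 0" using C1c_support[OF \<psi>] by metis
  have c: "continuous_on UNIV (\<lambda>x. (F x \<bullet> b) / rV x)"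
    by (intro continuous_on_divide continuous_on_inner continuous_on_const rV_continuous C1c_continuous_gradient[OF \<psi>]) auto
  have "integrable lborel (\<lambda>x. (norm ((F x \<bullet> b) / rV x))\<^sup>2)"
    by (rule integrable_continuous_compact_support[where R=R], intro continuous_on_power continuous_on_norm c) (use R in auto)
  then have F: "L2 lborel (\<lambda>x. (F x \<bullet> b) / rV x)"
    using borel_measurable_continuous_onI[OF c] by (simp add: L2_def)
  have "L2 lborel (\<lambda>x. 1 * \<psi> x)" by (rule C1c_L2_weighted[OF \<psi>]) simp
  then have "L2 lborel \<psi>" by simp
  then have b: "L2 lborel (\<lambda>x. \<psi> x *\<^sub>R b)"
    by (rule L2_bound[where K="norm b"]) (use C1c_measurable[OF \<psi>] in auto)
  have "(\<lambda>n. LINT x|lborel. (rV x * \<phi> n x) \<bullet> ((F x \<bullet> b) / rV x)) \<longlonglongrightarrow> (LINT x|lborel. (rV x * u x) \<bullet> ((F x \<bullet> b) / rV x))"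
    by (rule L2_lim_inner[OF \<phi>_lim L2_lim_const[OF F]])
  then have 1: "(\<lambda>n. LINT x|lborel. \<phi> n x * (F x \<bullet> b)) \<longlonglongrightarrow> (LINT x|lborel. u x * (F x \<bullet> b))" by simp
  have "(\<lambda>n. LINT x|lborel. D n x \<bullet> (\<psi> x *\<^sub>R b)) \<longlonglongrightarrow> (LINT x|lborel. p x \<bullet> (\<psi> x *\<^sub>R b))"
    by (rule L2_lim_inner[OF D_lim L2_lim_const[OF b]])
  then have "(\<lambda>n. - (LINT x|lborel. (D n x \<bullet> b) * \<psi> x)) \<longlonglongrightarrow> - (LINT x|lborel. (p x \<bullet> b) * \<psi> x)"
    by (intro tendsto_minus) (simp add: mult.commute)
  with 1 show ?thesis
    unfolding C1c_integral_by_parts[OF \<phi> \<psi>] by (rule LIMSEQ_unique)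
qed

lemma J_limit:
  assumes \<eta>: "C1c \<eta> F"
  shows "(\<lambda>n. J (\<lambda>x. \<phi> n x + \<eta> x) (\<lambda>x. D n x + F x)) \<longlonglongrightarrow> J (\<lambda>x. u x + \<eta> x) (\<lambda>x. p x + F x)"
proof -
  have 1: "(\<lambda>n. LINT x|lborel. (norm (D n x + F x))\<^sup>2) \<longlonglongrightarrow> (LINT x|lborel. (norm (p x + F x))\<^sup>2)"
    by (rule L2_lim_norm[OF L2_lim_add_const[OF D_lim C1c_L2[OF \<eta>]]])
  have "(\<lambda>n. LINT x|lborel. (norm (rV x * \<phi> n x + rV x * \<eta> x))\<^sup>2) \<longlonglongrightarrow> (LINT x|lborel. (norm (rV x * u x + rV x * \<eta> x))\<^sup>2)"
    by (rule L2_lim_norm[OF L2_lim_add_const[OF \<phi>_lim C1c_L2_rV[OF \<eta>]]])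
  then have 2: "(\<lambda>n. LINT x|lborel. (rV x * (\<phi> n x + \<eta> x))\<^sup>2) \<longlonglongrightarrow> (LINT x|lborel. (rV x * (u x + \<eta> x))\<^sup>2)"
    by (simp add: distrib_left)
  have 3: "(\<lambda>n. LINT x|lborel. G (\<phi> n x + \<eta> x)) \<longlonglongrightarrow> (LINT x|lborel. G (u x + \<eta> x))"
  proof (rule LIM_zero_cancel, rule Lim_null_comparison[OF always_eventually])
    show "\<forall>n. norm ((LINT x|lborel. G (\<phi> n x + \<eta> x)) - (LINT x|lborel. G (u x + \<eta> x))) \<le> C * (LINT x|lborel. \<bar>\<phi> n x - u x\<bar>)"
    proof
      fix n
      have "integrable lborel (\<lambda>x. \<phi> n x + \<eta> x)" "integrable lborel (\<lambda>x. u x + \<eta> x)"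
        using C1c_integrable[OF \<phi>] C1c_integrable[OF \<eta>] u_integrable by auto
      from G_integral_diff[OF this]
      show "norm ((LINT x|lborel. G (\<phi> n x + \<eta> x)) - (LINT x|lborel. G (u x + \<eta> x))) \<le> C * (LINT x|lborel. \<bar>\<phi> n x - u x\<bar>)"
        by simp
    qed
    show "(\<lambda>n. C * (LINT x|lborel. \<bar>\<phi> n x - u x\<bar>)) \<longlonglongrightarrow> 0"
      using tendsto_mult_left[OF \<phi>_L1_lim, of C] by simp
  qed
  show ?thesis unfolding J_def E_def by (intro tendsto_intros 1 2 3) simp
qed

lemma J_u: "J u p = inf_J"
proof -
  have "C1c (\<lambda>_::'a. 0) (\<lambda>_. 0)" by (auto simp: C1c_def GDERIV_const)
  from J_limit[OF this] show ?thesis using J_lim by (auto intro: LIMSEQ_unique)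
qed

text \<open>The limit pair itself need not be of class \<open>C\<^sup>1\<close>, but its perturbations by such functions are
  limits of admissible ones.\<close>

lemma inf_J_le_perturbed:
  assumes \<eta>: "C1c \<eta> F" shows "inf_J \<le> J (\<lambda>x. u x + \<eta> x) (\<lambda>x. p x + F x)"
  by (rule LIMSEQ_le_const[OF J_limit[OF \<eta>]]) (use inf_J_le[OF C1c_add[OF \<phi> \<eta>]] in auto)

text \<open>Minimality along \<open>u + t \<eta>\<close> for \<open>t > 0\<close> gives one inequality; the other one follows by replacing
  \<open>\<eta>\<close> by \<open>- \<eta>\<close>.\<close>

lemma Euler_Lagrange_le:
  assumes \<eta>: "C1c \<eta> F"
  shows "(LINT x|lborel. g (u x) * \<eta> x) \<le> (LINT x|lborel. p x \<bullet> F x) + (LINT x|lborel. V x * u x * \<eta> x)"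
proof -
  define L where "L = (LINT x|lborel. p x \<bullet> F x) + (LINT x|lborel. V x * u x * \<eta> x)"
  have F: "L2 lborel F" and \<eta>2: "L2 lborel (\<lambda>x. rV x * \<eta> x)" using C1c_L2[OF \<eta>] C1c_L2_rV[OF \<eta>] by auto
  have [measurable]: "\<eta> \<in> borel_measurable borel" using C1c_measurable[OF \<eta>] by auto
  have expand: "E (\<lambda>x. u x + t * \<eta> x) (\<lambda>x. p x + t *\<^sub>R F x) = E u p + 2 * t * L + t\<^sup>2 * E \<eta> F" for t
  proof -
    have "(LINT x|lborel. (norm (p x + t *\<^sub>R F x))\<^sup>2) = (LINT x|lborel. (norm (p x))\<^sup>2 + 2 * t * (p x \<bullet> F x) + t\<^sup>2 * (norm (F x))\<^sup>2)"
      by (intro Bochner_Integration.integral_cong refl)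
         (simp only: power2_norm_eq_inner, simp add: inner_add_left inner_add_right inner_commute power2_eq_square algebra_simps)
    also have "\<dots> = (LINT x|lborel. (norm (p x))\<^sup>2) + 2 * t * (LINT x|lborel. p x \<bullet> F x) + t\<^sup>2 * (LINT x|lborel. (norm (F x))\<^sup>2)"
      using L2_integrable[OF p_L2] L2_integrable[OF F] L2_inner_integrable[OF p_L2 F] by simp
    finally have 1: "(LINT x|lborel. (norm (p x + t *\<^sub>R F x))\<^sup>2) = \<dots>" .
    have "(LINT x|lborel. (rV x * (u x + t * \<eta> x))\<^sup>2) = (LINT x|lborel. (rV x * u x)\<^sup>2 + 2 * t * ((rV x * u x) * (rV x * \<eta> x)) + t\<^sup>2 * (rV x * \<eta> x)\<^sup>2)"
      by (intro Bochner_Integration.integral_cong refl) (simp add: power2_eq_square algebra_simps)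
    also have "\<dots> = (LINT x|lborel. (rV x * u x)\<^sup>2) + 2 * t * (LINT x|lborel. (rV x * u x) * (rV x * \<eta> x)) + t\<^sup>2 * (LINT x|lborel. (rV x * \<eta> x)\<^sup>2)"
      using L2_integrable[OF u_L2] L2_integrable[OF \<eta>2] L2_mult_integrable[OF u_L2 \<eta>2] by simp
    also have "(LINT x|lborel. (rV x * u x) * (rV x * \<eta> x)) = (LINT x|lborel. V x * u x * \<eta> x)"
    proof (intro Bochner_Integration.integral_cong refl)
      fix x
      have "(rV x * u x) * (rV x * \<eta> x) = (rV x * rV x) * (u x * \<eta> x)" by (simp only: mult_ac)
      then show "(rV x * u x) * (rV x * \<eta> x) = V x * u x * \<eta> x" by (simp add: mult.assoc)
    qed
    finally show ?thesis unfolding E_def 1 L_def by (simp add: algebra_simps)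
  qed
  \<comment> \<open>Divide the minimality inequality by \<open>h n\<close> and let \<open>n\<close> tend to infinity.\<close>
  define h where "h n = 1 / real (Suc n)" for n
  have h: "h n > 0" for n by (simp add: h_def)
  have hlim: "h \<longlonglongrightarrow> 0" unfolding h_def using LIMSEQ_inverse_real_of_nat by (simp add: inverse_eq_divide)
  have ineq: "(LINT x|lborel. (G (u x + h n * \<eta> x) - G (u x)) / h n) \<le> L + h n / 2 * E \<eta> F" for n
  proof -
    have i: "integrable lborel (\<lambda>x. G (u x + h n * \<eta> x))" "integrable lborel (\<lambda>x. G (u x))"
      using u_integrable C1c_integrable[OF \<eta>] by (auto intro!: G_integrable)
    have "J u p \<le> J (\<lambda>x. u x + h n * \<eta> x) (\<lambda>x. p x + h n *\<^sub>R F x)"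
      unfolding J_u by (rule inf_J_le_perturbed[OF C1c_scale[OF \<eta>]])
    then have "(LINT x|lborel. G (u x + h n * \<eta> x)) - (LINT x|lborel. G (u x)) \<le> h n * L + (h n)\<^sup>2 / 2 * E \<eta> F"
      unfolding J_def expand by argo
    also have "\<dots> = h n * (L + h n / 2 * E \<eta> F)" by (simp add: power2_eq_square algebra_simps)
    finally have "((LINT x|lborel. G (u x + h n * \<eta> x)) - (LINT x|lborel. G (u x))) / h n \<le> L + h n / 2 * E \<eta> F"
      using h[of n] by (simp add: pos_divide_le_eq mult.commute)
    then show ?thesis using i by simp
  qed
  have "(\<lambda>n. LINT x|lborel. (G (u x + h n * \<eta> x) - G (u x)) / h n) \<longlonglongrightarrow> (LINT x|lborel. g (u x) * \<eta> x)"
  proof (rule integral_dominated_convergence[where w="\<lambda>x. C * \<bar>\<eta> x\<bar>"])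
    show "integrable lborel (\<lambda>x. C * \<bar>\<eta> x\<bar>)" using C1c_integrable[OF \<eta>] by simp
    show "AE x in lborel. (\<lambda>n. (G (u x + h n * \<eta> x) - G (u x)) / h n) \<longlonglongrightarrow> g (u x) * \<eta> x"
    proof (intro AE_I2)
      fix x
      have "((\<lambda>t. u x + t * \<eta> x) has_real_derivative \<eta> x) (at 0)"
        by (auto intro!: derivative_eq_intros)
      moreover have "(G has_real_derivative g (u x)) (at (u x + 0 * \<eta> x))" using G_deriv by simp
      ultimately have "((\<lambda>t. G (u x + t * \<eta> x)) has_real_derivative g (u x) * \<eta> x) (at 0)"
        using DERIV_chain2[of G "g (u x)" "\<lambda>t. u x + t * \<eta> x" 0 "\<eta> x" UNIV] by simp
      then have "((\<lambda>t. (G (u x + t * \<eta> x) - G (u x)) / t) \<longlongrightarrow> g (u x) * \<eta> x) (at 0)"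
        by (simp add: has_field_derivative_iff)
      moreover have "filterlim h (at 0) sequentially"
        unfolding filterlim_at using hlim h by (auto simp: less_imp_neq[symmetric])
      ultimately show "(\<lambda>n. (G (u x + h n * \<eta> x) - G (u x)) / h n) \<longlonglongrightarrow> g (u x) * \<eta> x"
        by (rule filterlim_compose)
    qed
    show "AE x in lborel. norm ((G (u x + h n * \<eta> x) - G (u x)) / h n) \<le> C * \<bar>\<eta> x\<bar>" for n
    proof (intro AE_I2)
      fix x
      have "\<bar>G (u x + h n * \<eta> x) - G (u x)\<bar> \<le> C * \<bar>h n * \<eta> x\<bar>"
        using G_lipschitz[of "u x + h n * \<eta> x" "u x"] by simp
      then show "norm ((G (u x + h n * \<eta> x) - G (u x)) / h n) \<le> C * \<bar>\<eta> x\<bar>"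
        using h[of n] by (simp add: abs_mult pos_divide_le_eq mult_ac)
    qed
  qed auto
  moreover have "(\<lambda>n. L + h n / 2 * E \<eta> F) \<longlonglongrightarrow> L + 0 / 2 * E \<eta> F"
    by (intro tendsto_intros hlim) auto
  ultimately have "(LINT x|lborel. g (u x) * \<eta> x) \<le> L + 0 / 2 * E \<eta> F"
    by (rule LIMSEQ_le) (use ineq in auto)
  then show ?thesis by (simp add: L_def)
qed

theorem Euler_Lagrange:
  assumes \<eta>: "C1c \<eta> F"
  shows "(LINT x|lborel. p x \<bullet> F x) + (LINT x|lborel. V x * u x * \<eta> x) = (LINT x|lborel. g (u x) * \<eta> x)"
  using Euler_Lagrange_le[OF \<eta>] Euler_Lagrange_le[OF C1c_scale[OF \<eta>, of "-1"]] by simp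

end

section \<open>Bounds on the minimiser\<close>

text \<open>A regularisation of class \<open>C\<^sup>1\<close> of the positive part, with derivative in \<open>[0, 1]\<close>, that vanishes
  exactly on the nonpositive half-line.\<close>

definition smooth_pos :: "real \<Rightarrow> real \<Rightarrow> real" where
  "smooth_pos c s = sqrt (c\<^sup>2 + (max 0 s)\<^sup>2) - c"

definition smooth_pos' :: "real \<Rightarrow> real \<Rightarrow> real" where
  "smooth_pos' c s = max 0 s / sqrt (c\<^sup>2 + (max 0 s)\<^sup>2)"

lemma smooth_pos_deriv:
  assumes "c > 0" shows "(smooth_pos c has_real_derivative smooth_pos' c s) (at s)"
proof -
  have pos: "0 < c\<^sup>2 + (max 0 s)\<^sup>2" using assms by (intro add_pos_nonneg) auto
  have "((\<lambda>s. c\<^sup>2 + (max 0 s)\<^sup>2) has_real_derivative 2 * max 0 s) (at s)"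
    using DERIV_add[OF DERIV_const pos_part_square_deriv] by simp
  from DERIV_chain2[OF DERIV_real_sqrt[OF pos] this]
  have "((\<lambda>s. sqrt (c\<^sup>2 + (max 0 s)\<^sup>2)) has_real_derivative inverse (sqrt (c\<^sup>2 + (max 0 s)\<^sup>2)) / 2 * (2 * max 0 s)) (at s)" .
  then have "((\<lambda>s. sqrt (c\<^sup>2 + (max 0 s)\<^sup>2) - c) has_real_derivative inverse (sqrt (c\<^sup>2 + (max 0 s)\<^sup>2)) / 2 * (2 * max 0 s) - 0) (at s)"
    by (rule DERIV_diff[OF _ DERIV_const])
  moreover have "inverse X / 2 * (2 * m) - 0 = m / X" for X m :: real by (cases "X = 0") (simp_all add: field_simps)
  ultimately show ?thesis unfolding smooth_pos_def[abs_def] smooth_pos'_def by (simp only:)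
qed

lemma smooth_pos'_continuous: assumes "c > 0" shows "continuous_on UNIV (smooth_pos' c)"
proof -
  have "sqrt (c\<^sup>2 + (max 0 s)\<^sup>2) \<noteq> 0" for s
  proof -
    have "0 < c\<^sup>2 + (max 0 s)\<^sup>2" using assms by (intro add_pos_nonneg) auto
    then have "0 < sqrt (c\<^sup>2 + (max 0 s)\<^sup>2)" by (rule real_sqrt_gt_zero)
    then show ?thesis by linarith
  qed
  then show ?thesis unfolding smooth_pos'_def[abs_def]
    by (intro continuous_on_divide continuous_on_real_sqrt continuous_on_add continuous_on_power
        continuous_on_max continuous_on_const continuous_on_id ballI)
qed

lemma smooth_pos_le:
  assumes "c > 0" shows "0 \<le> smooth_pos c s" "smooth_pos c s \<le> max 0 s"
    "s \<le> 0 \<Longrightarrow> smooth_pos c s = 0" "0 < s \<Longrightarrow> 0 < smooth_pos c s" "s - c \<le> smooth_pos c s"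
proof -
  have "sqrt (c\<^sup>2) \<le> sqrt (c\<^sup>2 + (max 0 s)\<^sup>2)" by (intro real_sqrt_le_mono) simp
  then show "0 \<le> smooth_pos c s" using assms by (simp add: smooth_pos_def)
  have "sqrt (c\<^sup>2 + (max 0 s)\<^sup>2) \<le> sqrt (c\<^sup>2) + sqrt ((max 0 s)\<^sup>2)" by (rule sqrt_add_le_add_sqrt) auto
  then show "smooth_pos c s \<le> max 0 s" using assms by (simp add: smooth_pos_def)
  show "s \<le> 0 \<Longrightarrow> smooth_pos c s = 0" using assms by (simp add: smooth_pos_def max_def)
  show "0 < smooth_pos c s" if "0 < s"
  proof -
    have "sqrt (c\<^sup>2) < sqrt (c\<^sup>2 + (max 0 s)\<^sup>2)" using that by (intro real_sqrt_less_mono) simp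
    then show ?thesis using assms by (simp add: smooth_pos_def)
  qed
  have "sqrt ((max 0 s)\<^sup>2) \<le> sqrt (c\<^sup>2 + (max 0 s)\<^sup>2)" by (intro real_sqrt_le_mono) simp
  then have "max 0 s \<le> sqrt (c\<^sup>2 + (max 0 s)\<^sup>2)" by simp
  then show "s - c \<le> smooth_pos c s" unfolding smooth_pos_def by linarith
qed

lemma smooth_pos'_bounds:
  assumes "c > 0" shows "0 \<le> smooth_pos' c s" "smooth_pos' c s \<le> 1" "s \<le> 0 \<Longrightarrow> smooth_pos' c s = 0"
proof -
  have pos: "0 < sqrt (c\<^sup>2 + (max 0 s)\<^sup>2)" using assms by (intro real_sqrt_gt_zero add_pos_nonneg) auto
  then show "0 \<le> smooth_pos' c s" by (simp add: smooth_pos'_def)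
  have "sqrt ((max 0 s)\<^sup>2) \<le> sqrt (c\<^sup>2 + (max 0 s)\<^sup>2)" by (intro real_sqrt_le_mono) simp
  then show "smooth_pos' c s \<le> 1" using pos by (simp add: smooth_pos'_def)
  show "s \<le> 0 \<Longrightarrow> smooth_pos' c s = 0" by (simp add: smooth_pos'_def max_def)
qed

text \<open>A \<open>C\<^sup>1\<close> contraction that fixes exactly the points of \<open>[0, M]\<close> and moves all other points towards
  this interval. The sharp clamp would leave the class of \<open>C\<^sup>1\<close> functions.\<close>

definition soft_clamp :: "real \<Rightarrow> real \<Rightarrow> real" where
  "soft_clamp M t = t - smooth_pos 1 (t - M) + smooth_pos 1 (- t)"

definition soft_clamp' :: "real \<Rightarrow> real \<Rightarrow> real" where
  "soft_clamp' M t = 1 - smooth_pos' 1 (t - M) - smooth_pos' 1 (- t)"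

lemma soft_clamp_deriv: "(soft_clamp M has_real_derivative soft_clamp' M t) (at t)"
proof -
  have a: "((\<lambda>t. smooth_pos 1 (t - M)) has_real_derivative smooth_pos' 1 (t - M) * 1) (at t)"
    by (rule DERIV_chain2[OF smooth_pos_deriv]) (auto intro!: derivative_eq_intros)
  have b: "((\<lambda>t. smooth_pos 1 (- t)) has_real_derivative smooth_pos' 1 (- t) * (- 1)) (at t)"
    by (rule DERIV_chain2[OF smooth_pos_deriv]) (auto intro!: derivative_eq_intros)
  show ?thesis using DERIV_add[OF DERIV_diff[OF DERIV_ident a] b]
    by (simp add: soft_clamp_def[abs_def] soft_clamp'_def)
qed

lemma soft_clamp'_continuous: "continuous_on UNIV (soft_clamp' M)"
proof -
  have "continuous_on UNIV (\<lambda>t. smooth_pos' 1 (t - M))"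
    by (rule continuous_on_compose2[OF smooth_pos'_continuous, of 1 UNIV]) (auto intro!: continuous_intros)
  moreover have "continuous_on UNIV (\<lambda>t. smooth_pos' 1 (- t))"
    by (rule continuous_on_compose2[OF smooth_pos'_continuous, of 1 UNIV]) (auto intro!: continuous_intros)
  ultimately show ?thesis unfolding soft_clamp'_def[abs_def]
    by (intro continuous_on_diff continuous_on_const)
qed

lemma soft_clamp'_bound: assumes "0 < M" shows "\<bar>soft_clamp' M t\<bar> \<le> 1"
proof (cases "t \<le> 0")
  case True
  then have "smooth_pos' 1 (t - M) = 0" using assms by (intro smooth_pos'_bounds) auto
  then show ?thesis using smooth_pos'_bounds(1,2)[of 1 "- t"] by (simp add: soft_clamp'_def)
next
  case False
  then have "smooth_pos' 1 (- t) = 0" by (intro smooth_pos'_bounds) auto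
  then show ?thesis using smooth_pos'_bounds(1,2)[of 1 "t - M"] by (simp add: soft_clamp'_def)
qed

lemma soft_clamp_0: "0 < M \<Longrightarrow> soft_clamp M 0 = 0"
  by (simp add: soft_clamp_def smooth_pos_le(3))

lemma soft_clamp_negative: assumes "0 < M" "t < 0" shows "t < soft_clamp M t" "soft_clamp M t \<le> 0"
proof -
  have "smooth_pos 1 (t - M) = 0" using assms by (intro smooth_pos_le) auto
  moreover have "0 < smooth_pos 1 (- t)" "smooth_pos 1 (- t) \<le> - t"
    using assms smooth_pos_le(4)[of 1 "- t"] smooth_pos_le(2)[of 1 "- t"] by auto
  ultimately show "t < soft_clamp M t" "soft_clamp M t \<le> 0" by (simp_all add: soft_clamp_def)
qed

lemma soft_clamp_large: assumes "0 < M" "M < t" shows "M \<le> soft_clamp M t" "soft_clamp M t < t"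
proof -
  have "smooth_pos 1 (- t) = 0" using assms by (intro smooth_pos_le) auto
  moreover have "0 < smooth_pos 1 (t - M)" "smooth_pos 1 (t - M) \<le> t - M"
    using assms smooth_pos_le(4)[of 1 "t - M"] smooth_pos_le(2)[of 1 "t - M"] by auto
  ultimately show "M \<le> soft_clamp M t" "soft_clamp M t < t" by (simp_all add: soft_clamp_def)
qed

lemma soft_clamp_middle: "0 \<le> t \<Longrightarrow> t \<le> M \<Longrightarrow> soft_clamp M t = t"
  by (simp add: soft_clamp_def smooth_pos_le(3))

context minimizer
begin

text \<open>Beyond \<open>M\<close> the potential beats the nonlinearity, and below \<open>0\<close> the nonlinearity vanishes, so
  pulling a value softly back towards \<open>[0, M]\<close> lowers the energy density by a definite amount.\<close>

lemma soft_clamp_gain: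
  assumes M: "0 < M" and G_neg: "\<And>t. t \<le> 0 \<Longrightarrow> G t = 0" and g_large: "\<And>t. M \<le> t \<Longrightarrow> g t \<le> V0 * M / 2"
  shows "V0 / 2 * (t - soft_clamp M t)\<^sup>2 \<le> V x / 2 * (t\<^sup>2 - (soft_clamp M t)\<^sup>2) - (G t - G (soft_clamp M t))"
proof -
  define s where "s = soft_clamp M t"
  consider "t < 0" | "0 \<le> t" "t \<le> M" | "M < t" by linarith
  then show ?thesis unfolding s_def[symmetric]
  proof cases
    case 1
    then have s: "t < s" "s \<le> 0" using soft_clamp_negative[OF M] by (auto simp: s_def)
    have "(t - s)\<^sup>2 \<le> t\<^sup>2 - s\<^sup>2"
    proof -
      have "t\<^sup>2 - s\<^sup>2 - (t - s)\<^sup>2 = 2 * (- s) * (s - t)" by (simp add: power2_eq_square algebra_simps)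
      moreover have "0 \<le> 2 * (- s) * (s - t)" using s by (intro mult_nonneg_nonneg) auto
      ultimately show ?thesis by linarith
    qed
    then have "V0 / 2 * (t - s)\<^sup>2 \<le> V x / 2 * (t\<^sup>2 - s\<^sup>2)"
      using V_ge[of x] V0_pos by (intro mult_mono) auto
    then show "V0 / 2 * (t - s)\<^sup>2 \<le> V x / 2 * (t\<^sup>2 - s\<^sup>2) - (G t - G s)"
      using G_neg[of t] G_neg[of s] 1 s by simp
  next
    case 2
    then show "V0 / 2 * (t - s)\<^sup>2 \<le> V x / 2 * (t\<^sup>2 - s\<^sup>2) - (G t - G s)"
      using soft_clamp_middle[of t M] by (simp add: s_def)
  next
    case 3
    then have s: "M \<le> s" "s < t" using soft_clamp_large[OF M] by (auto simp: s_def)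
    obtain z where z: "s < z" "z < t" "G t - G s = (t - s) * g z"
      using MVT2[of s t G g] G_deriv s(2) by blast
    have "(t - s) * g z \<le> (t - s) * (V0 * M / 2)"
      using z s g_large[of z] by (intro mult_left_mono) auto
    also have "\<dots> = V0 / 2 * ((t - s) * M)" by simp
    also have "\<dots> \<le> V0 / 2 * ((t - s) * (2 * s))"
      using s M V0_pos by (intro mult_left_mono) auto
    finally have "G t - G s \<le> V0 / 2 * ((t - s) * (2 * s))" using z by simp
    moreover have "V0 / 2 * (t\<^sup>2 - s\<^sup>2) \<le> V x / 2 * (t\<^sup>2 - s\<^sup>2)"
      using V_ge[of x] s M by (intro mult_right_mono) (auto intro!: power_mono)
    moreover have "V0 / 2 * (t\<^sup>2 - s\<^sup>2) - V0 / 2 * ((t - s) * (2 * s)) = V0 / 2 * (t - s)\<^sup>2"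
      by (simp add: power2_eq_square algebra_simps)
    ultimately show "V0 / 2 * (t - s)\<^sup>2 \<le> V x / 2 * (t\<^sup>2 - s\<^sup>2) - (G t - G s)" by linarith
  qed
qed

text \<open>Applying the contraction to \<open>\<phi>\<^sub>n\<close> cannot push the energy below the infimum, so the gain tends to
  \<open>0\<close>. By Fatou's lemma \<open>u\<close> is a fixed point of the contraction almost everywhere.\<close>

theorem minimizer_bounds:
  assumes M: "0 < M" and G_neg: "\<And>t. t \<le> 0 \<Longrightarrow> G t = 0" and g_large: "\<And>t. M \<le> t \<Longrightarrow> g t \<le> V0 * M / 2"
  shows "AE x in lborel. 0 \<le> u x \<and> u x \<le> M"
proof -
  define \<theta> where "\<theta> = soft_clamp M"
  define \<theta>' where "\<theta>' = soft_clamp' M"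
  have \<theta>cont: "continuous_on UNIV \<theta>"
    unfolding \<theta>_def by (rule DERIV_continuous_on[OF has_field_derivative_at_within[OF soft_clamp_deriv]])
  have \<theta>m[measurable]: "\<theta> \<in> borel_measurable borel" by (rule borel_measurable_continuous_onI[OF \<theta>cont])
  have \<theta>\<phi>: "C1c (\<lambda>x. \<theta> (\<phi> n x)) (\<lambda>x. \<theta>' (\<phi> n x) *\<^sub>R D n x)" for n
    unfolding \<theta>_def \<theta>'_def by (rule C1c_compose[OF \<phi> soft_clamp_deriv soft_clamp'_continuous soft_clamp_0[OF M]])
  have diff: "C1c (\<lambda>x. \<phi> n x - \<theta> (\<phi> n x)) (\<lambda>x. D n x - \<theta>' (\<phi> n x) *\<^sub>R D n x)" for n
    by (rule C1c_diff[OF \<phi> \<theta>\<phi>])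
  have int: "integrable lborel (\<lambda>x. (\<phi> n x - \<theta> (\<phi> n x))\<^sup>2)" for n
    using L2_integrable[OF C1c_L2_weighted[OF diff[of n] continuous_on_const, of 1]] by simp
  have gain: "V0 / 2 * (LINT x|lborel. (\<phi> n x - \<theta> (\<phi> n x))\<^sup>2) \<le> J (\<phi> n) (D n) - inf_J" for n
  proof -
    have i1: "integrable lborel (\<lambda>x. (rV x * \<phi> n x)\<^sup>2)" "integrable lborel (\<lambda>x. (rV x * \<theta> (\<phi> n x))\<^sup>2)"
      using L2_integrable[OF C1c_L2_rV[OF \<phi>]] L2_integrable[OF C1c_L2_rV[OF \<theta>\<phi>]] by auto
    have i2: "integrable lborel (\<lambda>x. G (\<phi> n x))" "integrable lborel (\<lambda>x. G (\<theta> (\<phi> n x)))"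
      by (auto intro!: G_integrable C1c_integrable[OF \<phi>] C1c_integrable[OF \<theta>\<phi>])
    have "V0 / 2 * (LINT x|lborel. (\<phi> n x - \<theta> (\<phi> n x))\<^sup>2) = (LINT x|lborel. V0 / 2 * (\<phi> n x - \<theta> (\<phi> n x))\<^sup>2)"
      by simp
    also have "\<dots> \<le> (LINT x|lborel. ((rV x * \<phi> n x)\<^sup>2 / 2 - (rV x * \<theta> (\<phi> n x))\<^sup>2 / 2) - (G (\<phi> n x) - G (\<theta> (\<phi> n x))))"
    proof (rule integral_mono)
      show "V0 / 2 * (\<phi> n x - \<theta> (\<phi> n x))\<^sup>2 \<le> ((rV x * \<phi> n x)\<^sup>2 / 2 - (rV x * \<theta> (\<phi> n x))\<^sup>2 / 2) - (G (\<phi> n x) - G (\<theta> (\<phi> n x)))" for x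
        using soft_clamp_gain[OF assms, of "\<phi> n x" x]
        by (simp add: \<theta>_def power_mult_distrib right_diff_distrib)
    qed (use int i1 i2 in auto)
    also have "\<dots> = ((LINT x|lborel. (rV x * \<phi> n x)\<^sup>2) / 2 - (LINT x|lborel. (rV x * \<theta> (\<phi> n x))\<^sup>2) / 2)
        - ((LINT x|lborel. G (\<phi> n x)) - (LINT x|lborel. G (\<theta> (\<phi> n x))))"
      using i1 i2 by simp
    also have "\<dots> \<le> J (\<phi> n) (D n) - J (\<lambda>x. \<theta> (\<phi> n x)) (\<lambda>x. \<theta>' (\<phi> n x) *\<^sub>R D n x)"
    proof -
      have "(LINT x|lborel. (norm (\<theta>' (\<phi> n x) *\<^sub>R D n x))\<^sup>2) \<le> (LINT x|lborel. (norm (D n x))\<^sup>2)"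
      proof (rule integral_mono)
        show "(norm (\<theta>' (\<phi> n x) *\<^sub>R D n x))\<^sup>2 \<le> (norm (D n x))\<^sup>2" for x
          using soft_clamp'_bound[OF M, of "\<phi> n x"]
          by (intro power_mono) (auto simp: \<theta>'_def mult_left_le_one_le)
      qed (use L2_integrable[OF C1c_L2[OF \<phi>]] L2_integrable[OF C1c_L2[OF \<theta>\<phi>]] in auto)
      then show ?thesis unfolding J_def E_def by argo
    qed
    also have "\<dots> \<le> J (\<phi> n) (D n) - inf_J" using inf_J_le[OF \<theta>\<phi>, of n] by simp
    finally show ?thesis .
  qed
  have lim0: "(\<lambda>n. LINT x|lborel. (\<phi> n x - \<theta> (\<phi> n x))\<^sup>2) \<longlonglongrightarrow> 0"
  proof (rule tendsto_sandwich[OF _ _ tendsto_const])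
    have "(\<lambda>n. 2 / V0 * (J (\<phi> n) (D n) - inf_J)) \<longlonglongrightarrow> 2 / V0 * (inf_J - inf_J)"
      by (intro tendsto_intros J_lim)
    then show "(\<lambda>n. 2 / V0 * (J (\<phi> n) (D n) - inf_J)) \<longlonglongrightarrow> 0" by simp
    show "\<forall>\<^sub>F n in sequentially. (LINT x|lborel. (\<phi> n x - \<theta> (\<phi> n x))\<^sup>2) \<le> 2 / V0 * (J (\<phi> n) (D n) - inf_J)"
      using gain V0_pos by (intro always_eventually allI) (simp add: field_simps)
  qed auto
  have AEl: "AE x in lborel. (\<lambda>n. (\<phi> n x - \<theta> (\<phi> n x))\<^sup>2) \<longlonglongrightarrow> (u x - \<theta> (u x))\<^sup>2"
    using AE_lim
  proof eventually_elim
    case (elim x)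
    have "(\<lambda>n. \<theta> (\<phi> n x)) \<longlonglongrightarrow> \<theta> (u x)"
      by (rule continuous_on_tendsto_compose[OF \<theta>cont elim]) auto
    then show ?case by (intro tendsto_intros elim)
  qed
  have F: "integrable lborel (\<lambda>x. (u x - \<theta> (u x))\<^sup>2) \<and> (LINT x|lborel. (u x - \<theta> (u x))\<^sup>2) \<le> e" if "e > 0" for e
  proof -
    have ev: "\<forall>\<^sub>F n in sequentially. (LINT x|lborel. (\<phi> n x - \<theta> (\<phi> n x))\<^sup>2) \<le> e"
      using order_tendstoD(2)[OF lim0 that] by eventually_elim simp
    show ?thesis using Fatou_real[OF int _ _ AEl ev] by simp
  qed
  have "(LINT x|lborel. (u x - \<theta> (u x))\<^sup>2) \<le> 0"
    by (rule field_le_epsilon) (simp add: F)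
  then have "(LINT x|lborel. (u x - \<theta> (u x))\<^sup>2) = 0" by (intro antisym) auto
  then have "AE x in lborel. (u x - \<theta> (u x))\<^sup>2 = 0"
    using F[of 1] by (subst (asm) integral_nonneg_eq_0_iff_AE) auto
  then show ?thesis
  proof eventually_elim
    case (elim x)
    then have eq: "soft_clamp M (u x) = u x" by (simp add: \<theta>_def)
    show ?case using soft_clamp_negative[OF M, of "u x"] soft_clamp_large[OF M, of "u x"] eq
      by linarith
  qed
qed

end

section \<open>Positivity of the minimiser\<close>

text \<open>The identity on the positive half-line, bent so that it never goes below \<open>- \<delta>/2\<close>; then \<open>soft_relu \<delta> t + \<delta>\<close>
  can be inverted and its logarithm can be taken.\<close>

definition soft_relu :: "real \<Rightarrow> real \<Rightarrow> real" where
  "soft_relu \<delta> t = t + smooth_pos (\<delta> / 2) (- t)"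

definition soft_relu' :: "real \<Rightarrow> real \<Rightarrow> real" where
  "soft_relu' \<delta> t = 1 - smooth_pos' (\<delta> / 2) (- t)"

lemma soft_relu:
  assumes "\<delta> > 0"
  shows "(soft_relu \<delta> has_real_derivative soft_relu' \<delta> t) (at t)"
    and "continuous_on UNIV (soft_relu' \<delta>)"
    and "\<delta> / 2 \<le> soft_relu \<delta> t + \<delta>"
    and "0 \<le> t \<Longrightarrow> soft_relu \<delta> t = t"
    and "0 \<le> t \<Longrightarrow> soft_relu' \<delta> t = 1"
    and "0 \<le> soft_relu' \<delta> t" "soft_relu' \<delta> t \<le> 1"
proof -
  have d: "\<delta> / 2 > 0" using assms by simp
  have b: "((\<lambda>t. smooth_pos (\<delta> / 2) (- t)) has_real_derivative smooth_pos' (\<delta> / 2) (- t) * (- 1)) (at t)"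
    by (rule DERIV_chain2[OF smooth_pos_deriv[OF d]]) (auto intro!: derivative_eq_intros)
  show "(soft_relu \<delta> has_real_derivative soft_relu' \<delta> t) (at t)"
    using DERIV_add[OF DERIV_ident b] by (simp add: soft_relu_def[abs_def] soft_relu'_def)
  have "continuous_on UNIV (\<lambda>t. smooth_pos' (\<delta> / 2) (- t))"
    by (rule continuous_on_compose2[OF smooth_pos'_continuous[OF d], of UNIV]) (auto intro!: continuous_intros)
  then show "continuous_on UNIV (soft_relu' \<delta>)"
    unfolding soft_relu'_def[abs_def] by (intro continuous_on_diff continuous_on_const)
  show "\<delta> / 2 \<le> soft_relu \<delta> t + \<delta>"
    using smooth_pos_le(5)[OF d, of "- t"] unfolding soft_relu_def by (simp add: field_simps)
  show "0 \<le> t \<Longrightarrow> soft_relu \<delta> t = t" "0 \<le> t \<Longrightarrow> soft_relu' \<delta> t = 1"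
    using smooth_pos_le(3)[OF d, of "- t"] smooth_pos'_bounds(3)[OF d, of "- t"]
    by (simp_all add: soft_relu_def soft_relu'_def)
  show "0 \<le> soft_relu' \<delta> t" "soft_relu' \<delta> t \<le> 1"
    using smooth_pos'_bounds(1,2)[OF d, of "- t"] by (simp_all add: soft_relu'_def)
qed

context minimizer
begin

text \<open>Once \<open>u\<close> is known to be nonnegative, the approximations can be bent upwards without changing
  the limit or its gradient.\<close>

lemma nonnegative_approximation:
  assumes u_nn: "AE x in lborel. 0 \<le> u x" and \<delta>: "0 < \<delta>"
  obtains v Dv where "\<And>n. C1c (v n) (Dv n)" "\<And>n x. \<delta> / 2 \<le> v n x + \<delta>" "L2_lim lborel Dv p"
    "AE x in lborel. (\<lambda>n. v n x) \<longlonglongrightarrow> u x"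
proof -
  define v where "v n x = soft_relu \<delta> (\<phi> n x)" for n x
  define Dv where "Dv n x = soft_relu' \<delta> (\<phi> n x) *\<^sub>R D n x" for n x
  have cont: "continuous_on UNIV (soft_relu \<delta>)"
    by (rule DERIV_continuous_on[OF has_field_derivative_at_within[OF soft_relu(1)[OF \<delta>]]])
  have [measurable]: "soft_relu' \<delta> \<in> borel_measurable borel"
    by (rule borel_measurable_continuous_onI[OF soft_relu(2)[OF \<delta>]])
  have "C1c (v n) (Dv n)" for n
    unfolding v_def[abs_def] Dv_def[abs_def]
    by (rule C1c_compose[OF \<phi> soft_relu(1,2)[OF \<delta>]]) (simp add: soft_relu(4)[OF \<delta>])
  moreover have "\<delta> / 2 \<le> v n x + \<delta>" for n x unfolding v_def by (rule soft_relu(3)[OF \<delta>])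
  moreover have lim: "L2_lim lborel Dv (\<lambda>x. 1 *\<^sub>R p x)"
    unfolding Dv_def[abs_def]
  proof (rule L2_lim_mult[OF D_lim, where K=1])
    show "AE x in lborel. (\<lambda>n. soft_relu' \<delta> (\<phi> n x)) \<longlonglongrightarrow> 1"
      using AE_lim u_nn
    proof eventually_elim
      case (elim x)
      have "(\<lambda>n. soft_relu' \<delta> (\<phi> n x)) \<longlonglongrightarrow> soft_relu' \<delta> (u x)"
        by (rule continuous_on_tendsto_compose[OF soft_relu(2)[OF \<delta>] elim(1)]) auto
      then show ?case using soft_relu(5)[OF \<delta> elim(2)] by simp
    qed
  qed (use soft_relu(6,7)[OF \<delta>] in auto)
  moreover have "AE x in lborel. (\<lambda>n. v n x) \<longlonglongrightarrow> u x"
    using AE_lim u_nn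
  proof eventually_elim
    case (elim x)
    have "(\<lambda>n. v n x) \<longlonglongrightarrow> soft_relu \<delta> (u x)"
      unfolding v_def by (rule continuous_on_tendsto_compose[OF cont elim(1)]) auto
    then show ?case using soft_relu(4)[OF \<delta> elim(2)] by simp
  qed
  ultimately show thesis using that by (simp only: scaleR_one) blast
qed

text \<open>The equation is tested with \<open>\<eta>\<^sup>2/(u + \<delta>)\<close>, as in the logarithmic estimate of Moser's proof of the
  Harnack inequality. As \<open>g(u)\<close> is nonnegative, the gradient of \<open>ln (u + \<delta>)\<close> is bounded in \<open>L\<^sup>2\<close> of a ball
  by a constant that does not depend on \<open>\<delta>\<close>.\<close>

lemma log_gradient_bound:
  assumes u_nn: "AE x in lborel. 0 \<le> u x" and gu_nn: "AE x in lborel. 0 \<le> g (u x)" and "R > 0"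
  shows "\<exists>K. \<forall>\<delta>>0. (LINT x|lborel. (norm ((indicator (cball 0 R) x * inverse (u x + \<delta>)) *\<^sub>R p x))\<^sup>2) \<le> K"
proof -
  obtain \<eta> F where \<eta>: "C1c \<eta> (F :: 'a \<Rightarrow> 'a)" and \<eta>nn: "\<And>x. 0 \<le> \<eta> x" and \<eta>1: "\<And>x. norm x \<le> R \<Longrightarrow> 1 \<le> \<eta> x"
    using C1c_cutoff[OF \<open>R > 0\<close>] by metis
  have [measurable]: "\<eta> \<in> borel_measurable borel" "F \<in> borel_measurable borel" using C1c_measurable[OF \<eta>] by auto
  obtain S where S: "\<And>x. norm x > S \<Longrightarrow> \<eta> x = 0" using C1c_support[OF \<eta>] by metis
  obtain B where B: "0 < B" "\<And>x. norm (\<eta> x) \<le> B"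
    using bounded_continuous_compact_support[OF C1c_continuous[OF \<eta>], of S] S by metis
  define F2 where "F2 x = \<eta> x *\<^sub>R F x + \<eta> x *\<^sub>R F x" for x
  have \<eta>2: "C1c (\<lambda>x. \<eta> x * \<eta> x) F2"
    unfolding F2_def[abs_def] using C1c_times[OF \<eta>] C1cD[OF \<eta>] by blast
  define K where "K = 4 * (LINT x|lborel. (norm (F x))\<^sup>2) + 2 * (LINT x|lborel. V x * (\<eta> x)\<^sup>2)"
  have int_F: "integrable lborel (\<lambda>x. (norm (F x))\<^sup>2)" by (rule L2_integrable[OF C1c_L2[OF \<eta>]])
  have int_V: "integrable lborel (\<lambda>x. V x * (\<eta> x)\<^sup>2)"
    using L2_integrable[OF C1c_L2_rV[OF \<eta>]] by (simp add: power_mult_distrib)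
  have "(LINT x|lborel. (norm ((indicator (cball 0 R) x * inverse (u x + \<delta>)) *\<^sub>R p x))\<^sup>2) \<le> K" if \<delta>: "\<delta> > 0" for \<delta>
  proof -
    obtain v Dv where v: "\<And>n. C1c (v n) (Dv n)" and v_ge: "\<And>n x. \<delta> / 2 \<le> v n x + \<delta>"
      and Dv_lim: "L2_lim lborel Dv p" and v_lim: "AE x in lborel. (\<lambda>n. v n x) \<longlonglongrightarrow> u x"
      by (rule nonnegative_approximation[OF u_nn \<delta>]) blast
    have [measurable]: "v n \<in> borel_measurable borel" for n using C1c_measurable[OF v[of n]] by auto
    define c where "c n x = inverse (v n x + \<delta>)" for n x
    define r where "r x = inverse (u x + \<delta>)" for x
    have [measurable]: "c n \<in> borel_measurable borel" "r \<in> borel_measurable borel" for n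
      by (simp_all add: c_def[abs_def] r_def[abs_def])
    have v_pos: "0 < v n x + \<delta>" for n x using v_ge[of n x] \<delta> by linarith
    have c: "0 \<le> c n x" "\<bar>c n x\<bar> \<le> 2 / \<delta>" for n x
      using v_pos[of n x] le_imp_inverse_le[OF v_ge[of n x]] \<delta> by (simp_all add: c_def)
    have c_lim: "AE x in lborel. (\<lambda>n. c n x) \<longlonglongrightarrow> r x"
      using v_lim u_nn by eventually_elim (use \<delta> in \<open>auto simp: c_def r_def intro!: tendsto_intros\<close>)
    \<comment> \<open>The test function \<open>\<eta>\<^sup>2 / (v\<^sub>n + \<delta>)\<close> and its gradient.\<close>
    define \<psi> where "\<psi> n x = (\<eta> x * \<eta> x) * c n x" for n x
    define W where "W n x = (\<eta> x * \<eta> x) *\<^sub>R (- (c n x)\<^sup>2 *\<^sub>R Dv n x) + c n x *\<^sub>R F2 x" for n x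
    have \<psi>: "C1c (\<psi> n) (W n)" for n
      unfolding \<psi>_def[abs_def] W_def[abs_def]
    proof (rule C1c_times[OF \<eta>2])
      have nz: "v n x + \<delta> \<noteq> 0" for x using v_pos[of n x] by simp
      show "GDERIV (c n) x :> - (c n x)\<^sup>2 *\<^sub>R Dv n x" for x
        unfolding c_def[abs_def] using GDERIV_inverse[OF GDERIV_add[OF C1c_GDERIV[OF v[of n]] GDERIV_const] nz] by simp
      show "continuous_on UNIV (\<lambda>x. - (c n x)\<^sup>2 *\<^sub>R Dv n x)"
        unfolding c_def using C1cD[OF v[of n]] nz by (auto intro!: continuous_intros)
    qed
    have bd': "\<bar>(\<eta> x * \<eta> x) * - (c n x)\<^sup>2\<bar> \<le> B * B * (2 / \<delta>)\<^sup>2" for n x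
    proof -
      have "(c n x)\<^sup>2 \<le> (2 / \<delta>)\<^sup>2" using c(2)[of n x] by (metis abs_ge_zero power2_abs power_mono)
      then have "\<bar>\<eta> x * \<eta> x\<bar> * \<bar>- (c n x)\<^sup>2\<bar> \<le> B * B * (2 / \<delta>)\<^sup>2"
        unfolding abs_mult using B by (intro mult_mono) auto
      then show ?thesis by (simp only: abs_mult)
    qed
    have l1: "L2_lim lborel (\<lambda>n x. ((\<eta> x * \<eta> x) * - (c n x)\<^sup>2) *\<^sub>R Dv n x) (\<lambda>x. ((\<eta> x * \<eta> x) * - (r x)\<^sup>2) *\<^sub>R p x)"
    proof (rule L2_lim_mult[OF Dv_lim _ _ bd'])
      show "AE x in lborel. (\<lambda>n. (\<eta> x * \<eta> x) * - (c n x)\<^sup>2) \<longlonglongrightarrow> (\<eta> x * \<eta> x) * - (r x)\<^sup>2"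
        using c_lim by eventually_elim (intro tendsto_intros)
    qed measurable
    have l2: "L2_lim lborel (\<lambda>n x. c n x *\<^sub>R F2 x) (\<lambda>x. r x *\<^sub>R F2 x)"
      by (rule L2_lim_mult[OF L2_lim_const[OF C1c_L2[OF \<eta>2]] _ _ c(2) c_lim]) measurable
    have l3: "L2_lim lborel (\<lambda>n x. c n x *\<^sub>R (rV x * (\<eta> x * \<eta> x))) (\<lambda>x. r x *\<^sub>R (rV x * (\<eta> x * \<eta> x)))"
      by (rule L2_lim_mult[OF L2_lim_const[OF C1c_L2_rV[OF \<eta>2]] _ _ c(2) c_lim]) measurable
    have eq: "(LINT x|lborel. p x \<bullet> W n x) + (LINT x|lborel. V x * u x * \<psi> n x)
      = (LINT x|lborel. p x \<bullet> (((\<eta> x * \<eta> x) * - (c n x)\<^sup>2) *\<^sub>R Dv n x)) + (LINT x|lborel. p x \<bullet> (c n x *\<^sub>R F2 x))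
        + (LINT x|lborel. (rV x * u x) \<bullet> (c n x *\<^sub>R (rV x * (\<eta> x * \<eta> x))))" for n
    proof -
      have "(LINT x|lborel. p x \<bullet> W n x) = (LINT x|lborel. p x \<bullet> (((\<eta> x * \<eta> x) * - (c n x)\<^sup>2) *\<^sub>R Dv n x) + p x \<bullet> (c n x *\<^sub>R F2 x))"
        by (simp only: W_def inner_add_right scaleR_scaleR)
      also have "\<dots> = (LINT x|lborel. p x \<bullet> (((\<eta> x * \<eta> x) * - (c n x)\<^sup>2) *\<^sub>R Dv n x)) + (LINT x|lborel. p x \<bullet> (c n x *\<^sub>R F2 x))"
        by (intro Bochner_Integration.integral_add L2_inner_integrable p_L2 L2_limD(1)[OF l1] L2_limD(1)[OF l2])
      finally have 1: "(LINT x|lborel. p x \<bullet> W n x) = \<dots>" .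
      have "(rV x * u x) * (c n x * (rV x * (\<eta> x * \<eta> x))) = (rV x * rV x) * (u x * ((\<eta> x * \<eta> x) * c n x))" for x
        by (simp only: mult_ac)
      then have "(LINT x|lborel. V x * u x * \<psi> n x) = (LINT x|lborel. (rV x * u x) \<bullet> (c n x *\<^sub>R (rV x * (\<eta> x * \<eta> x))))"
        by (intro Bochner_Integration.integral_cong refl) (simp add: \<psi>_def mult.assoc)
      with 1 show ?thesis by simp
    qed
    have nn: "0 \<le> (LINT x|lborel. p x \<bullet> W n x) + (LINT x|lborel. V x * u x * \<psi> n x)" for n
      unfolding Euler_Lagrange[OF \<psi>]
    proof (rule integral_nonneg_AE)
      show "AE x in lborel. 0 \<le> g (u x) * \<psi> n x"
        using gu_nn by eventually_elim (auto simp: \<psi>_def intro!: mult_nonneg_nonneg c(1) \<eta>nn)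
    qed
    have "(\<lambda>n. (LINT x|lborel. p x \<bullet> W n x) + (LINT x|lborel. V x * u x * \<psi> n x)) \<longlonglongrightarrow>
        (LINT x|lborel. p x \<bullet> (((\<eta> x * \<eta> x) * - (r x)\<^sup>2) *\<^sub>R p x)) + (LINT x|lborel. p x \<bullet> (r x *\<^sub>R F2 x))
        + (LINT x|lborel. (rV x * u x) \<bullet> (r x *\<^sub>R (rV x * (\<eta> x * \<eta> x))))" (is "_ \<longlonglongrightarrow> ?lim")
      unfolding eq
      by (intro tendsto_add L2_lim_inner[OF L2_lim_const[OF p_L2]] L2_lim_inner[OF L2_lim_const[OF u_L2]] l1 l2 l3)
    then have lim_nn: "0 \<le> ?lim"
      by (rule LIMSEQ_le_const) (use nn in auto)
    \<comment> \<open>The localised gradient of \<open>ln (u + \<delta>)\<close>.\<close>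
    define q where "q x = (\<eta> x * r x) *\<^sub>R p x" for x
    have r_bd: "AE x in lborel. \<bar>r x\<bar> \<le> 1 / \<delta>"
      using u_nn by eventually_elim (use \<delta> in \<open>auto simp: r_def inverse_eq_divide field_simps\<close>)
    have q: "L2 lborel q"
      unfolding q_def[abs_def]
    proof (rule L2_bounded_mult[OF p_L2, where K="B * (1 / \<delta>)"])
      show "AE x in lborel. \<bar>\<eta> x * r x\<bar> \<le> B * (1 / \<delta>)"
        using r_bd
      proof eventually_elim
        case (elim x)
        then show ?case unfolding abs_mult using B by (intro mult_mono) auto
      qed
    qed measurable
    have ind: "L2 lborel (\<lambda>x. (indicator (cball 0 R) x * r x) *\<^sub>R p x)"
    proof (rule L2_bounded_mult[OF p_L2, where K="1 / \<delta>"])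
      show "AE x in lborel. \<bar>indicator (cball 0 R) x * r x\<bar> \<le> 1 / \<delta>"
        using r_bd by eventually_elim (use \<delta> in \<open>auto simp: indicator_def\<close>)
    qed (auto intro!: borel_measurable_times borel_measurable_indicator)
    have i1: "integrable lborel (\<lambda>x. p x \<bullet> (((\<eta> x * \<eta> x) * - (r x)\<^sup>2) *\<^sub>R p x))"
      "integrable lborel (\<lambda>x. p x \<bullet> (r x *\<^sub>R F2 x))"
      "integrable lborel (\<lambda>x. (rV x * u x) \<bullet> (r x *\<^sub>R (rV x * (\<eta> x * \<eta> x))))"
      by (intro L2_inner_integrable p_L2 u_L2 L2_limD(2)[OF l1] L2_limD(2)[OF l2] L2_limD(2)[OF l3])+
    have "?lim = (LINT x|lborel. p x \<bullet> (((\<eta> x * \<eta> x) * - (r x)\<^sup>2) *\<^sub>R p x) + p x \<bullet> (r x *\<^sub>R F2 x)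
        + (rV x * u x) \<bullet> (r x *\<^sub>R (rV x * (\<eta> x * \<eta> x))))"
      using i1 by simp
    also have "\<dots> \<le> (LINT x|lborel. - (1/2) * (norm (q x))\<^sup>2 + 2 * (norm (F x))\<^sup>2 + V x * (\<eta> x)\<^sup>2)"
    proof (rule integral_mono_AE)
      show "AE x in lborel. p x \<bullet> (((\<eta> x * \<eta> x) * - (r x)\<^sup>2) *\<^sub>R p x) + p x \<bullet> (r x *\<^sub>R F2 x)
        + (rV x * u x) \<bullet> (r x *\<^sub>R (rV x * (\<eta> x * \<eta> x))) \<le> - (1/2) * (norm (q x))\<^sup>2 + 2 * (norm (F x))\<^sup>2 + V x * (\<eta> x)\<^sup>2"
        using u_nn
      proof eventually_elim
        case (elim x)
        have t1: "p x \<bullet> (((\<eta> x * \<eta> x) * - (r x)\<^sup>2) *\<^sub>R p x) = - (norm (q x))\<^sup>2"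
          by (simp add: q_def power2_norm_eq_inner[symmetric] power_mult_distrib power2_eq_square)
        have t2: "p x \<bullet> (r x *\<^sub>R F2 x) = 2 * (q x \<bullet> F x)"
          by (simp add: q_def F2_def inner_add_right)
        \<comment> \<open>Young's inequality absorbs the mixed term.\<close>
        have "2 * (q x \<bullet> F x) \<le> 2 * (norm (q x) * norm (F x))"
          using Cauchy_Schwarz_ineq2[of "q x" "F x"] by linarith
        also have "\<dots> \<le> (norm (q x))\<^sup>2 / 2 + 2 * (norm (F x))\<^sup>2"
          using zero_le_power2[of "norm (q x) - 2 * norm (F x)"] by (simp add: power2_diff field_simps)
        finally have t2': "2 * (q x \<bullet> F x) \<le> (norm (q x))\<^sup>2 / 2 + 2 * (norm (F x))\<^sup>2" .
        have "(rV x * u x) \<bullet> (r x *\<^sub>R (rV x * (\<eta> x * \<eta> x))) = (rV x * rV x) * (\<eta> x)\<^sup>2 * (u x * r x)"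
          by (simp only: inner_real_def real_scaleR_def power2_eq_square mult_ac)
        also have "\<dots> = V x * (\<eta> x)\<^sup>2 * (u x * r x)" by simp
        also have "\<dots> \<le> V x * (\<eta> x)\<^sup>2 * 1"
          using elim \<delta> by (intro mult_left_mono) (auto simp: r_def inverse_eq_divide)
        finally show ?case using t1 t2 t2' by simp
      qed
    qed (use i1 L2_integrable[OF q] int_F int_V in auto)
    also have "\<dots> = - (1/2) * (LINT x|lborel. (norm (q x))\<^sup>2) + K / 2"
      using L2_integrable[OF q] int_F int_V by (simp add: K_def)
    finally have qK: "(LINT x|lborel. (norm (q x))\<^sup>2) \<le> K" using lim_nn by linarith
    have "(LINT x|lborel. (norm ((indicator (cball 0 R) x * r x) *\<^sub>R p x))\<^sup>2) \<le> (LINT x|lborel. (norm (q x))\<^sup>2)"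
    proof (rule integral_mono[OF L2_integrable[OF ind] L2_integrable[OF q]])
      fix x
      have "\<bar>indicator (cball 0 R) x * r x\<bar> \<le> \<bar>\<eta> x * r x\<bar>"
        unfolding abs_mult using \<eta>1[of x] \<eta>nn[of x] by (intro mult_right_mono) (auto simp: indicator_def)
      then show "(norm ((indicator (cball 0 R) x * r x) *\<^sub>R p x))\<^sup>2 \<le> (norm (q x))\<^sup>2"
        unfolding q_def norm_scaleR by (intro power_mono mult_right_mono) auto
    qed
    then show ?thesis using qK by (simp add: r_def)
  qed
  then show ?thesis by blast
qed

end

lemma AE_lborel_translate:
  assumes "AE x in lborel. P x" shows "AE x in lborel. P (x + h :: 'a::euclidean_space)"
proof -
  have "AE x in distr lborel borel ((+) h). P x" using assms by (subst lborel_distr_plus)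
  then have "AE x in lborel. P (h + x)" by (rule AE_distrD[rotated]) simp
  then show ?thesis by (simp add: add.commute)
qed

context minimizer
begin

text \<open>The translation estimate applied to \<open>ln (v\<^sub>n + \<delta>) - ln \<delta>\<close>, which has compact support, in the limit.\<close>

lemma log_increment_bound:
  assumes u_nn: "AE x in lborel. 0 \<le> u x" and gu_nn: "AE x in lborel. 0 \<le> g (u x)" and "R > 0"
  shows "\<exists>K. \<forall>\<delta>>0. (\<integral>\<^sup>+x. ennreal ((ln (u (x + h) + \<delta>) - ln (u x + \<delta>))\<^sup>2) * indicator (cball 0 R) x \<partial>lborel) \<le> ennreal K"
proof -
  have "R + norm h > 0" using \<open>R > 0\<close> by (simp add: add_pos_nonneg)
  from log_gradient_bound[OF u_nn gu_nn this] obtain K where K: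
    "\<And>\<delta>. \<delta> > 0 \<Longrightarrow> (LINT x|lborel. (norm ((indicator (cball 0 (R + norm h)) x * inverse (u x + \<delta>)) *\<^sub>R p x))\<^sup>2) \<le> K"
    by blast
  have "(\<integral>\<^sup>+x. ennreal ((ln (u (x + h) + \<delta>) - ln (u x + \<delta>))\<^sup>2) * indicator (cball 0 R) x \<partial>lborel) \<le> ennreal ((norm h)\<^sup>2 * (K + 1))"
    if \<delta>: "\<delta> > 0" for \<delta>
  proof -
    obtain v Dv where v: "\<And>n. C1c (v n) (Dv n)" and v_ge: "\<And>n x. \<delta> / 2 \<le> v n x + \<delta>"
      and Dv_lim: "L2_lim lborel Dv p" and v_lim: "AE x in lborel. (\<lambda>n. v n x) \<longlonglongrightarrow> u x"
      by (rule nonnegative_approximation[OF u_nn \<delta>]) blast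
    have v_pos: "0 < v n x + \<delta>" for n x using v_ge[of n x] \<delta> by linarith
    define w where "w n x = ln (v n x + \<delta>) - ln \<delta>" for n x
    define A where "A = cball (0::'a) R"
    define A' where "A' = cball (0::'a) (R + norm h)"
    have [measurable]: "A \<in> sets borel" "A' \<in> sets borel" by (auto simp: A_def A'_def)
    have [measurable]: "v n \<in> borel_measurable borel" for n using C1c_measurable[OF v[of n]] by auto
    have w: "C1c (w n) (\<lambda>x. inverse (v n x + \<delta>) *\<^sub>R Dv n x)" for n
      unfolding C1c_def
    proof (intro conjI allI)
      have nz: "v n x + \<delta> \<noteq> 0" for x using v_pos[of n x] by simp
      show "GDERIV (w n) x :> inverse (v n x + \<delta>) *\<^sub>R Dv n x" for x
        unfolding w_def[abs_def]
        using GDERIV_diff[OF GDERIV_DERIV_compose[OF GDERIV_add[OF C1c_GDERIV[OF v[of n]] GDERIV_const] DERIV_ln[OF v_pos]] GDERIV_const] by simp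
      show "continuous_on UNIV (\<lambda>x. inverse (v n x + \<delta>) *\<^sub>R Dv n x)"
        using C1cD[OF v[of n]] nz by (auto intro!: continuous_intros)
      obtain S where "\<And>x. norm x > S \<Longrightarrow> v n x = 0" "\<And>x. norm x > S \<Longrightarrow> Dv n x = 0" using C1c_support[OF v] by metis
      then show "\<exists>R. \<forall>x. R < norm x \<longrightarrow> w n x = 0 \<and> inverse (v n x + \<delta>) *\<^sub>R Dv n x = 0"
        by (intro exI[of _ S]) (auto simp: w_def)
    qed
    have [measurable]: "w n \<in> borel_measurable borel" for n using C1c_measurable[OF w[of n]] by auto
    have wlim: "AE x in lborel. (\<lambda>n. w n x) \<longlonglongrightarrow> ln (u x + \<delta>) - ln \<delta>"
      using v_lim u_nn by eventually_elim (use \<delta> in \<open>auto simp: w_def intro!: tendsto_intros\<close>)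
    have lim_grad: "L2_lim lborel (\<lambda>n x. (indicator A' x * inverse (v n x + \<delta>)) *\<^sub>R Dv n x) (\<lambda>x. (indicator A' x * inverse (u x + \<delta>)) *\<^sub>R p x)"
    proof (rule L2_lim_mult[OF Dv_lim, where K="2 / \<delta>"])
      show "\<bar>indicator A' x * inverse (v n x + \<delta>)\<bar> \<le> 2 / \<delta>" for n x
        using le_imp_inverse_le[OF v_ge[of n x]] v_pos[of n x] \<delta> by (auto simp: indicator_def)
      show "AE x in lborel. (\<lambda>n. indicator A' x * inverse (v n x + \<delta>)) \<longlonglongrightarrow> indicator A' x * inverse (u x + \<delta>)"
        using v_lim u_nn by eventually_elim (use \<delta> in \<open>auto intro!: tendsto_intros\<close>)
    qed measurable
    have "K < K + 1" by simp
    then have ev: "\<forall>\<^sub>F n in sequentially. (LINT x|lborel. (norm ((indicator A' x * inverse (v n x + \<delta>)) *\<^sub>R Dv n x))\<^sup>2) < K + 1"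
      by (intro order_tendstoD(2)[OF L2_lim_norm[OF lim_grad]] order_le_less_trans[OF K[OF \<delta>, folded A'_def]])
    have step: "\<forall>\<^sub>F n in sequentially. (\<integral>\<^sup>+x. ennreal ((w n (x + h) - w n x)\<^sup>2) * indicator A x \<partial>lborel) \<le> ennreal ((norm h)\<^sup>2 * (K + 1))"
      using ev
    proof eventually_elim
      case (elim n)
      have "(\<integral>\<^sup>+x. ennreal ((w n (x + h) - w n x)\<^sup>2) * indicator A x \<partial>lborel)
        \<le> ennreal ((norm h)\<^sup>2) * (\<integral>\<^sup>+x. ennreal ((norm (inverse (v n x + \<delta>) *\<^sub>R Dv n x))\<^sup>2) * indicator A' x \<partial>lborel)"
      proof (rule C1c_translation_estimate[OF w])
        fix x s assume x: "x \<in> A" and s: "s \<in> {0..1::real}"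
        have "norm (x + s *\<^sub>R h) \<le> norm x + norm (s *\<^sub>R h)" by (rule norm_triangle_ineq)
        also have "norm (s *\<^sub>R h) \<le> norm h" using s by (simp add: mult_left_le_one_le)
        finally show "x + s *\<^sub>R h \<in> A'" using x by (simp add: A_def A'_def)
      qed auto
      also have "(\<integral>\<^sup>+x. ennreal ((norm (inverse (v n x + \<delta>) *\<^sub>R Dv n x))\<^sup>2) * indicator A' x \<partial>lborel)
        = (\<integral>\<^sup>+x. ennreal ((norm ((indicator A' x * inverse (v n x + \<delta>)) *\<^sub>R Dv n x))\<^sup>2) \<partial>lborel)"
        by (intro nn_integral_cong) (auto simp: indicator_def)
      also have "\<dots> = ennreal (LINT x|lborel. (norm ((indicator A' x * inverse (v n x + \<delta>)) *\<^sub>R Dv n x))\<^sup>2)"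
        by (rule nn_integral_eq_integral[OF L2_integrable[OF L2_limD(1)[OF lim_grad]]]) auto
      also have "ennreal ((norm h)\<^sup>2) * \<dots> = ennreal ((norm h)\<^sup>2 * (LINT x|lborel. (norm ((indicator A' x * inverse (v n x + \<delta>)) *\<^sub>R Dv n x))\<^sup>2))"
        by (rule ennreal_mult[symmetric]) auto
      also have "\<dots> \<le> ennreal ((norm h)\<^sup>2 * (K + 1))"
        using elim by (intro ennreal_leI mult_left_mono) auto
      finally show ?case .
    qed
    have "(\<integral>\<^sup>+x. ennreal ((ln (u (x + h) + \<delta>) - ln (u x + \<delta>))\<^sup>2) * indicator A x \<partial>lborel)
      = (\<integral>\<^sup>+x. liminf (\<lambda>n. ennreal ((w n (x + h) - w n x)\<^sup>2) * indicator A x) \<partial>lborel)"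
    proof (rule nn_integral_cong_AE)
      show "AE x in lborel. ennreal ((ln (u (x + h) + \<delta>) - ln (u x + \<delta>))\<^sup>2) * indicator A x
          = liminf (\<lambda>n. ennreal ((w n (x + h) - w n x)\<^sup>2) * indicator A x)"
        using wlim AE_lborel_translate[OF wlim, of h]
      proof eventually_elim
        case (elim x)
        have "(\<lambda>n. ennreal ((w n (x + h) - w n x)\<^sup>2)) \<longlonglongrightarrow> ennreal ((ln (u (x + h) + \<delta>) - ln (u x + \<delta>))\<^sup>2)"
          using tendsto_ennrealI[OF tendsto_power[OF tendsto_diff[OF elim(2) elim(1)], of 2]] by simp
        then have "(\<lambda>n. ennreal ((w n (x + h) - w n x)\<^sup>2) * indicator A x) \<longlonglongrightarrow> ennreal ((ln (u (x + h) + \<delta>) - ln (u x + \<delta>))\<^sup>2) * indicator A x"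
          by (cases "x \<in> A") auto
        then show ?case by (intro lim_imp_Liminf[symmetric]) auto
      qed
    qed
    also have "\<dots> \<le> liminf (\<lambda>n. \<integral>\<^sup>+x. ennreal ((w n (x + h) - w n x)\<^sup>2) * indicator A x \<partial>lborel)"
      by (rule nn_integral_liminf) measurable
    also have "\<dots> \<le> ennreal ((norm h)\<^sup>2 * (K + 1))"
      by (rule Liminf_le[OF sequentially_bot step])
    finally show ?thesis unfolding A_def .
  qed
  then show ?thesis by blast
qed

text \<open>If \<open>u\<close> vanished at \<open>x\<close> but not at \<open>x + h\<close> for \<open>x\<close> in a set of positive measure, the increments
  \<open>ln (u(x + h) + \<delta>) - ln \<delta>\<close> would blow up there as \<open>\<delta>\<close> tends to \<open>0\<close>.\<close>

lemma no_jump_from_zero: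
  assumes u_nn: "AE x in lborel. 0 \<le> u x" and gu_nn: "AE x in lborel. 0 \<le> g (u x)"
  shows "AE x in lborel. \<not> (u x \<le> 0 \<and> 0 < u (x + h))"
proof -
  have local: "AE x in lborel. x \<in> cball 0 R \<longrightarrow> \<not> (u x \<le> 0 \<and> 0 < u (x + h))" if R: "R > 0" for R
  proof -
    define A where "A = cball (0::'a) R"
    have [measurable]: "A \<in> sets borel" by (simp add: A_def)
    define k where "k n x = ennreal ((ln (u (x + h) + 1 / real (Suc n)) - ln (u x + 1 / real (Suc n)))\<^sup>2) * indicator A x" for n x
    have [measurable]: "k n \<in> borel_measurable borel" for n unfolding k_def[abs_def] by measurable
    obtain K where K: "\<And>\<delta>. \<delta> > 0 \<Longrightarrow> (\<integral>\<^sup>+x. ennreal ((ln (u (x + h) + \<delta>) - ln (u x + \<delta>))\<^sup>2) * indicator A x \<partial>lborel) \<le> ennreal K"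
      using log_increment_bound[OF u_nn gu_nn R, of h] unfolding A_def by blast
    have "(\<integral>\<^sup>+x. liminf (\<lambda>n. k n x) \<partial>lborel) \<le> liminf (\<lambda>n. \<integral>\<^sup>+x. k n x \<partial>lborel)"
      by (rule nn_integral_liminf) measurable
    also have "\<dots> \<le> ennreal K"
    proof (rule Liminf_le[OF sequentially_bot always_eventually], rule allI)
      show "(\<integral>\<^sup>+x. k n x \<partial>lborel) \<le> ennreal K" for n
        unfolding k_def by (rule K) simp
    qed
    also have "\<dots> < \<infinity>" by simp
    finally have "AE x in lborel. liminf (\<lambda>n. k n x) \<noteq> \<infinity>"
      by (intro nn_integral_noteq_infinite) auto
    with u_nn show ?thesis
    proof eventually_elim
      case (elim x)
      show ?case
      proof (intro impI notI)
        assume x: "x \<in> cball 0 R" and j: "u x \<le> 0 \<and> 0 < u (x + h)"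
        then have u0: "u x = 0" using elim by simp
        have "filterlim (\<lambda>n. u (x + h) * real (Suc n)) at_top sequentially"
          using j by (intro filterlim_tendsto_pos_mult_at_top[OF tendsto_const]
              filterlim_compose[OF filterlim_real_sequentially filterlim_Suc]) auto
        then have "filterlim (\<lambda>n. 1 + u (x + h) * real (Suc n)) at_top sequentially"
          by (intro filterlim_tendsto_add_at_top[OF tendsto_const])
        from filterlim_compose[OF ln_at_top this]
        have l: "filterlim (\<lambda>n. ln (1 + u (x + h) * real (Suc n))) at_top sequentially" .
        have "filterlim (\<lambda>n. (ln (1 + u (x + h) * real (Suc n)))\<^sup>2) at_top sequentially"
          by (rule filterlim_pow_at_top[OF _ l]) simp
        then have "(\<lambda>n. ennreal ((ln (1 + u (x + h) * real (Suc n)))\<^sup>2)) \<longlonglongrightarrow> \<infinity>"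
          by (simp add: ennreal_tendsto_top_eq_at_top)
        moreover have "k n x = ennreal ((ln (1 + u (x + h) * real (Suc n)))\<^sup>2)" for n
        proof -
          have eq: "1 + u (x + h) * real (Suc n) = (u (x + h) + 1 / real (Suc n)) / (1 / real (Suc n))"
            by (simp add: field_simps)
          have "0 < u (x + h) + 1 / real (Suc n)" using j by (simp add: add_pos_pos)
          then have "ln (1 + u (x + h) * real (Suc n)) = ln (u (x + h) + 1 / real (Suc n)) - ln (1 / real (Suc n))"
            unfolding eq by (rule ln_divide_pos) simp
          then show ?thesis using x by (simp add: k_def u0 A_def)
        qed
        ultimately have "(\<lambda>n. k n x) \<longlonglongrightarrow> \<infinity>" by simp
        then have "liminf (\<lambda>n. k n x) = \<infinity>" by (rule lim_imp_Liminf[rotated]) simp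
        with elim show False by simp
      qed
    qed
  qed
  have "AE x in lborel. \<forall>n. x \<in> cball 0 (real (Suc n)) \<longrightarrow> \<not> (u x \<le> 0 \<and> 0 < u (x + h))"
    unfolding AE_all_countable using local by simp
  then show ?thesis
  proof eventually_elim
    case (elim x)
    obtain n where "norm x \<le> real n" using real_arch_simple by blast
    then have "x \<in> cball 0 (real (Suc n))" by simp
    with elim show ?case by blast
  qed
qed

text \<open>A strong maximum principle. For every \<open>h\<close> the set of \<open>x\<close> with \<open>u(x) = 0 < u(x + h)\<close> is null;
  integrating over \<open>h\<close>, the product of the measures of the zero set and of the positivity set is \<open>0\<close>.\<close>

theorem strictly_positive_or_zero:
  assumes u_nn: "AE x in lborel. 0 \<le> u x" and gu_nn: "AE x in lborel. 0 \<le> g (u x)"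
  shows "(AE x in lborel. 0 < u x) \<or> (AE x in lborel. u x = 0)"
proof -
  define Z P where "Z = {x. u x \<le> 0}" and "P = {x. 0 < u x}"
  have [measurable]: "Z \<in> sets borel" "P \<in> sets borel" by (auto simp: Z_def P_def)
  have "(\<integral>\<^sup>+h. (\<integral>\<^sup>+x. indicator Z x * indicator P (x + h) \<partial>lborel) \<partial>lborel) = (\<integral>\<^sup>+(h::'a). 0 \<partial>lborel)"
  proof (rule nn_integral_cong)
    fix h :: 'a
    show "(\<integral>\<^sup>+x. indicator Z x * indicator P (x + h) \<partial>lborel) = 0"
    proof (subst nn_integral_0_iff_AE)
      show "AE x in lborel. indicator Z x * indicator P (x + h) = (0 :: ennreal)"
        using no_jump_from_zero[OF assms, of h] by eventually_elim (auto simp: Z_def P_def indicator_def)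
    qed measurable
  qed
  also have "\<dots> = 0" by simp
  also have "(\<integral>\<^sup>+h. (\<integral>\<^sup>+x. indicator Z x * indicator P (x + h) \<partial>lborel) \<partial>lborel)
    = (\<integral>\<^sup>+x. (\<integral>\<^sup>+h. indicator Z x * indicator P (x + h) \<partial>lborel) \<partial>(lborel :: 'a measure))"
    by (rule lborel_pair.Fubini') measurable
  also have "\<dots> = (\<integral>\<^sup>+x. emeasure lborel P * indicator Z x \<partial>lborel)"
  proof (rule nn_integral_cong)
    fix x :: 'a
    have "(\<integral>\<^sup>+h. indicator Z x * indicator P (x + h) \<partial>lborel) = indicator Z x * (\<integral>\<^sup>+h. indicator P (h + x) \<partial>lborel)"
      by (subst nn_integral_cmult) (auto simp: add.commute)
    also have "(\<integral>\<^sup>+h. indicator P (h + x) \<partial>lborel) = (\<integral>\<^sup>+h. indicator P h \<partial>lborel)"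
      by (rule lborel_nn_integral_translate) measurable
    finally show "(\<integral>\<^sup>+h. indicator Z x * indicator P (x + h) \<partial>lborel) = emeasure lborel P * indicator Z x"
      by (simp add: mult.commute)
  qed
  also have "\<dots> = emeasure lborel P * emeasure lborel Z"
    by (simp add: nn_integral_cmult_indicator)
  finally have "emeasure lborel P = 0 \<or> emeasure lborel Z = 0" by simp
  then show ?thesis
  proof
    assume "emeasure lborel P = 0"
    then have "P \<in> null_sets lborel" by (simp add: null_sets_def)
    then have "AE x in lborel. x \<notin> P" by (rule AE_not_in)
    with u_nn have "AE x in lborel. u x = 0" by eventually_elim (auto simp: P_def)
    then show ?thesis ..
  next
    assume "emeasure lborel Z = 0"
    then have "Z \<in> null_sets lborel" by (simp add: null_sets_def)
    then have "AE x in lborel. x \<notin> Z" by (rule AE_not_in)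
    then have "AE x in lborel. 0 < u x" by eventually_elim (auto simp: Z_def)
    then show ?thesis ..
  qed
qed

end

section \<open>Test functions and uniqueness of weak gradients\<close>

lemma Ck_SucI:
  assumes "\<And>x. (f has_derivative f' x) (at x)" "\<And>v. Ck k (\<lambda>x. f' x v)"
  shows "Ck (Suc k) f"
proof -
  have "frechet_derivative f (at x) = f' x" for x
    using frechet_derivative_at[OF assms(1)] by simp
  then show ?thesis using assms by (auto simp: differentiable_def)
qed

lemma Ck_Suc_has_derivative:
  "Ck (Suc k) f \<Longrightarrow> (f has_derivative frechet_derivative f (at x)) (at x)"
  by (simp add: frechet_derivative_works)

lemma Ck_SucD: "Ck (Suc k) f \<Longrightarrow> Ck k f"
proof (induction k arbitrary: f)
  case 0
  then show ?case
    by (auto intro!: continuous_at_imp_continuous_on differentiable_imp_continuous_within)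
next
  case (Suc k)
  then show ?case by (metis Ck.simps(2))
qed

lemma Ck_const: "Ck k (\<lambda>_. c)"
proof (induction k arbitrary: c)
  case (Suc k)
  show ?case by (rule Ck_SucI[where f'="\<lambda>_ _. 0"]) (auto intro: Suc)
qed simp

lemma Ck_add:
  "Ck k f \<Longrightarrow> Ck k g \<Longrightarrow> Ck k (\<lambda>x. f x + g x)"
proof (induction k arbitrary: f g)
  case (Suc k)
  show ?case
    by (rule Ck_SucI[OF has_derivative_add[OF Ck_Suc_has_derivative Ck_Suc_has_derivative]])
       (use Suc in auto)
qed (auto intro: continuous_intros)

lemma Ck_mult:
  fixes f g :: "'a::real_normed_vector \<Rightarrow> real"
  shows "Ck k f \<Longrightarrow> Ck k g \<Longrightarrow> Ck k (\<lambda>x. f x * g x)"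
proof (induction k arbitrary: f g)
  case (Suc k)
  show ?case
  proof (rule Ck_SucI[OF has_derivative_mult[OF Ck_Suc_has_derivative[OF Suc.prems(1)] Ck_Suc_has_derivative[OF Suc.prems(2)]]])
    show "Ck k (\<lambda>x. f x * frechet_derivative g (at x) v + frechet_derivative f (at x) v * g x)" for v
      using Suc Ck_SucD[OF Suc.prems(1)] Ck_SucD[OF Suc.prems(2)] by (intro Ck_add Suc.IH) auto
  qed
qed (auto intro: continuous_intros)

lemma Ck_prod:
  fixes f :: "'i \<Rightarrow> 'a::real_normed_vector \<Rightarrow> real"
  shows "finite I \<Longrightarrow> (\<And>i. i \<in> I \<Longrightarrow> Ck k (f i)) \<Longrightarrow> Ck k (\<lambda>x. \<Prod>i\<in>I. f i x)"
  by (induction I rule: finite_induct) (auto intro: Ck_const Ck_mult)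

text \<open>The functions \<open>t\<^sup>-\<^sup>m exp (-1/t)\<close>, extended by \<open>0\<close>. The span of the whole family is closed under
  differentiation, so smoothness follows by induction without computing higher derivatives.\<close>

definition flat_exp :: "nat \<Rightarrow> real \<Rightarrow> real" where
  "flat_exp m t = (if t > 0 then (1 / t) ^ m * exp (- (1 / t)) else 0)"

lemma flat_exp_tendsto_0: "(flat_exp m \<longlongrightarrow> 0) (at 0)"
proof (rule filterlim_split_at)
  have "((\<lambda>t. 0) \<longlongrightarrow> 0) (at_left (0::real))" by simp
  then show "(flat_exp m \<longlongrightarrow> 0) (at_left 0)"
    by (rule Lim_transform_eventually) (auto simp: eventually_at_left_field flat_exp_def intro!: exI[of _ "-1"])
  have "((\<lambda>t. inverse t ^ m / exp (inverse t)) \<longlongrightarrow> 0) (at_right (0::real))"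
    by (rule filterlim_compose[OF tendsto_power_div_exp_0 filterlim_inverse_at_top_right])
  then show "(flat_exp m \<longlongrightarrow> 0) (at_right 0)"
    by (rule Lim_transform_eventually)
       (auto simp: eventually_at_right_field flat_exp_def exp_minus inverse_eq_divide intro!: exI[of _ 1])
qed

lemma flat_exp_deriv:
  "(flat_exp m has_real_derivative - real m * flat_exp (m + 1) t + flat_exp (m + 2) t) (at t)"
proof -
  consider "t < 0" | "t = 0" | "t > 0" by linarith
  then show ?thesis
  proof cases
    case 1
    have "((\<lambda>_. 0) has_real_derivative 0) (at t)" by simp
    then have "(flat_exp m has_real_derivative 0) (at t)"
      by (rule DERIV_cong_ev[THEN iffD1, rotated -1, OF _ refl _ refl])
         (use eventually_nhds_in_open[of "{..<0}" t] 1 in \<open>auto elim!: eventually_mono simp: flat_exp_def\<close>)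
    then show ?thesis using 1 by (simp add: flat_exp_def)
  next
    case 2
    have "flat_exp m h / h = flat_exp (m + 1) h" for h
      by (simp add: flat_exp_def field_simps)
    then have "((\<lambda>h. (flat_exp m h - flat_exp m 0) / (h - 0)) \<longlongrightarrow> 0) (at 0)"
      using flat_exp_tendsto_0[of "m + 1"] by (simp add: flat_exp_def[of _ 0])
    then show ?thesis using 2 by (simp add: has_field_derivative_iff flat_exp_def[of _ 0])
  next
    case 3
    define s where "s = 1 / t"
    have "((\<lambda>t. 1 / t) has_real_derivative - s\<^sup>2) (at t)"
      using 3 by (auto intro!: derivative_eq_intros simp: s_def power2_eq_square)
    from DERIV_mult[OF DERIV_power[OF this, of m] DERIV_chain2[OF DERIV_exp DERIV_minus[OF this]]]
    have "((\<lambda>t. (1 / t) ^ m * exp (- (1 / t))) has_real_derivative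
        (real m * ((- s\<^sup>2) * s ^ (m - Suc 0))) * exp (- s) + (exp (- s) * (- (- s\<^sup>2))) * s ^ m) (at t)"
      by (simp add: s_def)
    moreover have "(real m * ((- s\<^sup>2) * s ^ (m - Suc 0))) * exp (- s) + (exp (- s) * (- (- s\<^sup>2))) * s ^ m
        = - real m * flat_exp (m + 1) t + flat_exp (m + 2) t"
      using 3 by (cases m) (simp_all add: flat_exp_def s_def[symmetric] power2_eq_square algebra_simps)
    ultimately have "((\<lambda>t. (1 / t) ^ m * exp (- (1 / t))) has_real_derivative - real m * flat_exp (m + 1) t + flat_exp (m + 2) t) (at t)"
      by simp
    then show ?thesis
      by (rule DERIV_cong_ev[THEN iffD1, rotated -1, OF _ refl _ refl])
         (use eventually_nhds_in_open[of "{0<..}" t] 3 in \<open>auto elim!: eventually_mono simp: flat_exp_def\<close>)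
  qed
qed

lemma Ck_flat_exp_affine:
  fixes b :: "'a::real_inner"
  shows "Ck k (\<lambda>x. flat_exp m (c * (x \<bullet> b) + d))"
proof (induction k arbitrary: m)
  case 0
  have "continuous_on UNIV (flat_exp m)"
    by (rule DERIV_continuous_on[OF has_field_derivative_at_within[OF flat_exp_deriv]])
  then have "continuous_on UNIV (\<lambda>x. flat_exp m (c * (x \<bullet> b) + d))"
    by (rule continuous_on_compose2[of UNIV _ UNIV]) (auto intro!: continuous_intros)
  then show ?case by simp
next
  case (Suc k)
  show ?case
  proof (rule Ck_SucI)
    fix x
    have "((\<lambda>x. c * (x \<bullet> b) + d) has_derivative (\<lambda>v. c * (v \<bullet> b))) (at x)"
      by (auto intro!: derivative_eq_intros)
    from has_derivative_compose[OF this flat_exp_deriv[unfolded has_field_derivative_def]]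
    show "((\<lambda>x. flat_exp m (c * (x \<bullet> b) + d)) has_derivative
      (\<lambda>v. (- real m * flat_exp (m + 1) (c * (x \<bullet> b) + d) + flat_exp (m + 2) (c * (x \<bullet> b) + d)) * (c * (v \<bullet> b)))) (at x)" .
  next
    show "Ck k (\<lambda>x. (- real m * flat_exp (m + 1) (c * (x \<bullet> b) + d) + flat_exp (m + 2) (c * (x \<bullet> b) + d)) * (c * (v \<bullet> b)))" for v
      by (intro Ck_mult Ck_add Ck_const Suc.IH)
  qed
qed

text \<open>As \<open>n\<close> grows, these smooth functions increase to the indicator of the box from \<open>a\<close> to \<open>c\<close>. The
  arguments are written as affine functions of \<open>x \<bullet> b\<close> to fit the smoothness lemma.\<close>

definition box_bump :: "real \<Rightarrow> 'a::euclidean_space \<Rightarrow> 'a \<Rightarrow> 'a \<Rightarrow> real" where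
  "box_bump n a c x = (\<Prod>b\<in>Basis. flat_exp 0 (n * (x \<bullet> b) + - n * (a \<bullet> b)) * flat_exp 0 (- n * (x \<bullet> b) + n * (c \<bullet> b)))"

lemma flat_exp_0: "flat_exp 0 t = (if t > 0 then exp (- (1 / t)) else 0)"
  by (simp add: flat_exp_def)

lemma box_bump_outside:
  assumes "n > 0" "x \<notin> box a c" shows "box_bump n a c x = 0"
proof -
  obtain b where b: "b \<in> Basis" "\<not> (a \<bullet> b < x \<bullet> b \<and> x \<bullet> b < c \<bullet> b)" using assms(2) by (auto simp: mem_box)
  have "n * (x \<bullet> b) + - n * (a \<bullet> b) = n * (x \<bullet> b - a \<bullet> b)" "- n * (x \<bullet> b) + n * (c \<bullet> b) = n * (c \<bullet> b - x \<bullet> b)"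
    by (simp_all add: algebra_simps)
  then have "flat_exp 0 (n * (x \<bullet> b) + - n * (a \<bullet> b)) * flat_exp 0 (- n * (x \<bullet> b) + n * (c \<bullet> b)) = 0"
    using b(2) \<open>n > 0\<close> by (auto simp: flat_exp_0 zero_less_mult_iff)
  then show ?thesis unfolding box_bump_def using b(1) by (intro prod_zero) auto
qed

lemma box_bump_test_function:
  assumes "n > 0" shows "test_function (box_bump n a c)"
proof -
  have "Ck k (box_bump n a c)" for k
    unfolding box_bump_def[abs_def] by (intro Ck_prod Ck_mult Ck_flat_exp_affine) auto
  moreover have "{x. box_bump n a c x \<noteq> 0} \<subseteq> box a c" using box_bump_outside[OF assms] by blast
  then have "bounded {x. box_bump n a c x \<noteq> 0}" by (rule bounded_subset[OF bounded_box])
  ultimately show ?thesis by (simp add: test_function_def compact_closure)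
qed

lemma box_bump_bounds: "0 \<le> box_bump n a c x" "box_bump n a c x \<le> 1"
proof -
  have f: "0 \<le> flat_exp 0 t" "flat_exp 0 t \<le> 1" for t by (auto simp: flat_exp_0)
  show "0 \<le> box_bump n a c x" unfolding box_bump_def by (intro prod_nonneg mult_nonneg_nonneg f)
  show "box_bump n a c x \<le> 1" unfolding box_bump_def
    by (intro prod_le_1 conjI mult_nonneg_nonneg mult_le_one f)
qed

lemma box_bump_tendsto: "(\<lambda>n. box_bump (real (Suc n)) a c x) \<longlonglongrightarrow> indicator (box a c) x"
proof (cases "x \<in> box a c")
  case False
  then show ?thesis using box_bump_outside[of _ x a c] by simp
next
  case True
  have l: "(\<lambda>n. flat_exp 0 (real (Suc n) * s)) \<longlonglongrightarrow> 1" if "s > 0" for s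
  proof -
    have "(\<lambda>n. exp (- (inverse (real (Suc n)) * (1 / s)))) \<longlonglongrightarrow> exp (- (0 * (1 / s)))"
      by (intro tendsto_intros LIMSEQ_inverse_real_of_nat)
    then show ?thesis using that by (simp add: flat_exp_0 inverse_eq_divide)
  qed
  have "(\<lambda>n. box_bump (real (Suc n)) a c x) \<longlonglongrightarrow> (\<Prod>b\<in>(Basis :: 'a set). 1 * 1)"
    unfolding box_bump_def
  proof (rule Limits.tendsto_prod, rule tendsto_mult)
    fix b :: 'a assume b: "b \<in> Basis"
    have eq: "n * (x \<bullet> b) + - n * (a \<bullet> b) = n * (x \<bullet> b - a \<bullet> b)" "- n * (x \<bullet> b) + n * (c \<bullet> b) = n * (c \<bullet> b - x \<bullet> b)" for n
      by (simp_all add: algebra_simps)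
    show "(\<lambda>n. flat_exp 0 (real (Suc n) * (x \<bullet> b) + - real (Suc n) * (a \<bullet> b))) \<longlonglongrightarrow> 1"
      unfolding eq using True b by (intro l) (auto simp: mem_box)
    show "(\<lambda>n. flat_exp 0 (- real (Suc n) * (x \<bullet> b) + real (Suc n) * (c \<bullet> b))) \<longlonglongrightarrow> 1"
      unfolding eq using True b by (intro l) (auto simp: mem_box)
  qed
  then show ?thesis using True by simp
qed

lemma test_function_C1c:
  fixes \<phi> :: "'a::euclidean_space \<Rightarrow> real"
  assumes "test_function \<phi>" shows "C1c \<phi> (gradient \<phi>)"
proof -
  have C1: "Ck (Suc 0) \<phi>" using assms by (simp add: test_function_def)
  have d: "(\<phi> has_derivative frechet_derivative \<phi> (at x)) (at x)" for x by (rule Ck_Suc_has_derivative[OF C1])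
  have "GDERIV \<phi> x :> gradient \<phi> x" for x
  proof -
    have "linear (frechet_derivative \<phi> (at x))" using d has_derivative_linear by blast
    then have "frechet_derivative \<phi> (at x) h = h \<bullet> gradient \<phi> x" for h
      by (subst euclidean_representation[of h, symmetric])
         (simp add: gradient_def linear_sum linear_cmul inner_sum_right inner_sum_left mult.commute)
    then have "frechet_derivative \<phi> (at x) = (\<lambda>h. h \<bullet> gradient \<phi> x)" by (rule ext)
    then show ?thesis using d[of x] by (simp add: gderiv_def)
  qed
  moreover have "continuous_on UNIV (gradient \<phi>)"
    unfolding gradient_def[abs_def] using C1 by (intro continuous_intros) auto
  moreover have "\<exists>R. \<forall>x. norm x > R \<longrightarrow> \<phi> x = 0 \<and> gradient \<phi> x = 0"
  proof -
    have "bounded {x. \<phi> x \<noteq> 0}" using assms by (simp add: test_function_def compact_closure)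
    then obtain R where R: "\<And>x. \<phi> x \<noteq> 0 \<Longrightarrow> norm x \<le> R" unfolding bounded_iff by auto
    have z: "\<phi> x = 0" if "norm x > R" for x using R[of x] that by force
    have "gradient \<phi> x = 0" if x: "norm x > R" for x
    proof -
      have "open {x :: 'a. R < norm x}" by (intro open_Collect_less continuous_intros)
      then have "(\<phi> has_derivative (\<lambda>_. 0)) (at x)"
        by (rule has_derivative_transform_within_open[OF has_derivative_const[of 0]]) (use x z in auto)
      then have "frechet_derivative \<phi> (at x) = (\<lambda>_. 0)" using frechet_derivative_at by metis
      then show ?thesis by (simp add: gradient_def)
    qed
    with z show ?thesis by blast
  qed
  ultimately show ?thesis unfolding C1c_def by blast
qed

lemma locally_integrable_times_C1c:
  assumes h: "locally_integrable h" and \<phi>: "C1c \<phi> F"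
  shows "integrable lebesgue (\<lambda>x. \<phi> x *\<^sub>R h x)"
proof -
  obtain R where R: "\<And>x. norm x > R \<Longrightarrow> \<phi> x = 0" using C1c_support[OF \<phi>] by metis
  obtain B where B: "0 < B" "\<And>x. norm (\<phi> x) \<le> B"
    using bounded_continuous_compact_support[OF C1c_continuous[OF \<phi>], of R] R by metis
  have i: "integrable lebesgue (\<lambda>x. indicator (cball 0 R) x *\<^sub>R h x)"
    using h compact_cball by (auto simp: locally_integrable_def set_integrable_def)
  have [measurable]: "\<phi> \<in> borel_measurable lebesgue"
    using C1c_measurable[OF \<phi>] by (intro measurable_completion) simp
  have "integrable lebesgue (\<lambda>x. \<phi> x *\<^sub>R (indicator (cball 0 R) x *\<^sub>R h x))"
  proof (rule Bochner_Integration.integrable_bound)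
    show "integrable lebesgue (\<lambda>x. B *\<^sub>R (indicator (cball 0 R) x *\<^sub>R h x))"
      by (rule integrable_scaleR_right) (rule i)
    show "(\<lambda>x. \<phi> x *\<^sub>R (indicator (cball 0 R) x *\<^sub>R h x)) \<in> borel_measurable lebesgue"
      by (rule borel_measurable_scaleR[OF _ borel_measurable_integrable[OF i]]) measurable
    show "AE x in lebesgue. norm (\<phi> x *\<^sub>R (indicator (cball 0 R) x *\<^sub>R h x)) \<le> norm (B *\<^sub>R (indicator (cball 0 R) x *\<^sub>R h x))"
      using B by (intro AE_I2) (auto simp: indicator_def intro!: mult_right_mono)
  qed
  also have "(\<lambda>x. \<phi> x *\<^sub>R (indicator (cball 0 R) x *\<^sub>R h x)) = (\<lambda>x. \<phi> x *\<^sub>R h x)"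
    using R by (fastforce simp: indicator_def fun_eq_iff not_le[symmetric])
  finally show ?thesis .
qed

text \<open>The fundamental lemma of the calculus of variations. Testing with bumps that converge to the
  indicator of a box shows that all integrals over boxes vanish. Boxes are stable under intersection and
  generate the Borel sets, so by Dynkin's argument all integrals over Borel sets in a large box vanish.\<close>

theorem locally_integrable_zero_if_test_zero:
  fixes h :: "'a::euclidean_space \<Rightarrow> real"
  assumes h: "locally_integrable h"
    and zero: "\<And>\<phi>. test_function \<phi> \<Longrightarrow> (LINT x|lebesgue. h x * \<phi> x) = 0"
  shows "AE x in lebesgue. h x = 0"
proof -
  have ibox: "integrable lebesgue (\<lambda>x. indicator (cbox a c) x * h x)" for a c
    using h compact_cbox by (auto simp: locally_integrable_def set_integrable_def)
  have hm[measurable]: "(\<lambda>x. indicator (box a c) x * h x) \<in> borel_measurable lebesgue" for a c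
  proof -
    have "(\<lambda>x. indicator (box a c) x * (indicator (cbox a c) x * h x)) \<in> borel_measurable lebesgue"
      by (rule borel_measurable_times[OF borel_measurable_indicator borel_measurable_integrable[OF ibox]]) simp
    also have "(\<lambda>x. indicator (box a c) x * (indicator (cbox a c) x * h x)) = (\<lambda>x. indicator (box a c) x * h x)"
      using box_subset_cbox[of a c] by (auto simp: indicator_def fun_eq_iff)
    finally show ?thesis .
  qed
  have box_zero: "(LINT x|lebesgue. indicator (box a c) x * h x) = 0" for a c
  proof -
    have "(\<lambda>n. LINT x|lebesgue. h x * box_bump (real (Suc n)) a c x) \<longlonglongrightarrow> (LINT x|lebesgue. indicator (box a c) x * h x)"
    proof (rule integral_dominated_convergence[where w="\<lambda>x. \<bar>indicator (cbox a c) x * h x\<bar>"])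
      show "integrable lebesgue (\<lambda>x. \<bar>indicator (cbox a c) x * h x\<bar>)" using ibox by simp
      show "(\<lambda>x. h x * box_bump (real (Suc n)) a c x) \<in> borel_measurable lebesgue" for n
        using locally_integrable_times_C1c[OF h test_function_C1c[OF box_bump_test_function[of "real (Suc n)" a c]]]
        by (auto simp: mult.commute)
      show "AE x in lebesgue. (\<lambda>n. h x * box_bump (real (Suc n)) a c x) \<longlonglongrightarrow> indicator (box a c) x * h x"
        using tendsto_mult_left[OF box_bump_tendsto] by (intro AE_I2) (simp add: mult.commute)
      show "AE x in lebesgue. norm (h x * box_bump (real (Suc n)) a c x) \<le> \<bar>indicator (cbox a c) x * h x\<bar>" for n
      proof (intro AE_I2)
        fix x
        show "norm (h x * box_bump (real (Suc n)) a c x) \<le> \<bar>indicator (cbox a c) x * h x\<bar>"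
        proof (cases "x \<in> box a c")
          case True
          then have "x \<in> cbox a c" using box_subset_cbox by blast
          then show ?thesis using box_bump_bounds[of "real (Suc n)" a c x] by (simp add: abs_mult mult_left_le)
        next
          case False
          then show ?thesis using box_bump_outside[of "real (Suc n)" x a c] by simp
        qed
      qed
    qed (rule hm)
    then show ?thesis
      using zero[OF box_bump_test_function] by (simp add: LIMSEQ_const_iff)
  qed
  \<comment> \<open>Integrability holds only locally, so the space is exhausted by boxes.\<close>
  define K where "K n = box (- (real n *\<^sub>R One)) (real n *\<^sub>R One :: 'a)" for n :: nat
  have "AE x in lebesgue. indicator (K n) x * h x = 0" for n
  proof -
    have iK: "integrable lebesgue (\<lambda>x. indicator (K n) x * h x)"
    proof (rule Bochner_Integration.integrable_bound[OF ibox[of "- (real n *\<^sub>R One)" "real n *\<^sub>R One"]])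
      show "AE x in lebesgue. norm (indicator (K n) x * h x) \<le> norm (indicator (cbox (- (real n *\<^sub>R One)) (real n *\<^sub>R One)) x * h x)"
        using box_subset_cbox[of "- (real n *\<^sub>R One)" "real n *\<^sub>R One :: 'a"] by (intro AE_I2) (auto simp: K_def indicator_def)
    qed (simp add: K_def hm)
    \<comment> \<open>A Borel representative, because the induction below runs over Borel sets.\<close>
    obtain k where k: "k \<in> borel_measurable lborel" and eq: "AE x in lborel. indicator (K n) x * h x = k x"
      using completion_ex_borel_measurable_real[of "\<lambda>x. indicator (K n) x * h x" lborel] iK by auto
    have eq': "AE x in lebesgue. indicator (K n) x * h x = k x" by (rule AE_completion[OF eq])
    have ik: "integrable lborel k"
      using iK k integrable_cong_AE[of "\<lambda>x. indicator (K n) x * h x" lebesgue k] eq'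
        measurable_completion[OF k] integrable_completion[OF k] by auto
    have int_eq: "(LINT x:A|lborel. k x) = (LINT x|lebesgue. indicator (A \<inter> K n) x * h x)" if A[measurable]: "A \<in> sets borel" for A
    proof -
      have "(LINT x:A|lborel. k x) = (LINT x|lebesgue. indicator A x *\<^sub>R k x)"
        unfolding set_lebesgue_integral_def using k A by (intro integral_completion[symmetric]) auto
      also have "\<dots> = (LINT x|lebesgue. indicator (A \<inter> K n) x * h x)"
      proof (rule integral_cong_AE)
        show "(\<lambda>x. indicator A x *\<^sub>R k x) \<in> borel_measurable lebesgue"
          using k A by (intro measurable_completion) auto
        have "(\<lambda>x. indicator A x * (indicator (K n) x * h x)) \<in> borel_measurable lebesgue"
          by (rule borel_measurable_times[OF borel_measurable_indicator borel_measurable_integrable[OF iK]]) (use A in simp)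
        then show "(\<lambda>x. indicator (A \<inter> K n) x * h x) \<in> borel_measurable lebesgue"
          by (simp add: indicator_inter_arith mult.assoc)
        show "AE x in lebesgue. indicator A x *\<^sub>R k x = indicator (A \<inter> K n) x * h x"
          using eq' by eventually_elim (simp add: indicator_inter_arith mult.assoc)
      qed
      finally show ?thesis .
    qed
    have "(LINT x:A|lborel. k x) = 0" if "A \<in> sets lborel" for A
    proof -
      define G where "G = range (\<lambda>(a, b). box a b :: 'a set)"
      have "Int_stable G" by (auto simp: Int_stable_def box_Int_box G_def)
      moreover have "G \<subseteq> Pow UNIV" by simp
      moreover have sG: "sigma_sets UNIV G = sets borel" by (simp add: borel_eq_box G_def)
      then have "A \<in> sigma_sets UNIV G" using that by simp
      ultimately show ?thesis
      proof (induction rule: sigma_sets_induct_disjoint)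
        case (basic A)
        then obtain a b where A: "A = box a b" by (auto simp: G_def)
        have "A \<inter> K n = box (\<Sum>i\<in>Basis. max (a \<bullet> i) ((- (real n *\<^sub>R One)) \<bullet> i) *\<^sub>R i) (\<Sum>i\<in>Basis. min (b \<bullet> i) ((real n *\<^sub>R One) \<bullet> i) *\<^sub>R i)"
          by (simp add: A K_def box_Int_box)
        then show ?case using int_eq[of A] box_zero by (simp add: A)
      next
        case (compl A)
        then have A[measurable]: "A \<in> sets lborel" using sG by auto
        have "(LINT x:UNIV|lborel. k x) = 0" using int_eq[of UNIV] box_zero by (simp add: K_def)
        moreover have "(LINT x:(UNIV - A)|lborel. k x) = (LINT x:UNIV|lborel. k x) - (LINT x:A|lborel. k x)"
        proof -
          have "(LINT x:(UNIV - A)|lborel. k x) = (LINT x|lborel. indicator UNIV x *\<^sub>R k x - indicator A x *\<^sub>R k x)"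
            unfolding set_lebesgue_integral_def by (intro Bochner_Integration.integral_cong) (auto simp: indicator_def)
          also have "\<dots> = (LINT x:UNIV|lborel. k x) - (LINT x:A|lborel. k x)"
            unfolding set_lebesgue_integral_def using ik A
            by (intro Bochner_Integration.integral_diff integrable_mult_indicator) auto
          finally show ?thesis .
        qed
        ultimately show ?case using compl by simp
      next
        case (union A)
        then have A[measurable]: "A i \<in> sets lborel" for i using sG by auto
        have "(LINT x:(\<Union>i. A i)|lborel. k x) = (\<Sum>i. (LINT x:(A i)|lborel. k x))"
        proof (rule lebesgue_integral_countable_add[OF A])
          show "A i \<inter> A j = {}" if "i \<noteq> j" for i j using union(1) that by (auto simp: disjoint_family_on_def)
          show "set_integrable lborel (\<Union>i. A i) k"
            unfolding set_integrable_def using ik A by (intro integrable_mult_indicator) auto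
        qed
        then show ?case using union by simp
      qed (simp add: set_lebesgue_integral_def)
    qed
    then have "AE x in lborel. k x = 0" by (rule sigma_finite_measure.density_zero[OF sigma_finite_lborel ik])
    then have "AE x in lebesgue. k x = 0" by (rule AE_completion)
    with eq' show ?thesis by eventually_elim simp
  qed
  then have "AE x in lebesgue. \<forall>n. indicator (K n) x * h x = 0" by (simp only: AE_all_countable simp_thms)
  then show ?thesis
  proof eventually_elim
    case (elim x)
    have "x \<in> (\<Union>n. K n)" unfolding K_def UN_box_eq_UNIV by simp
    then obtain n where "x \<in> K n" by blast
    with elim show ?case by (metis indicator_simps(1) mult_1)
  qed
qed

text \<open>Each component of the difference integrates to \<open>0\<close> against all test functions. Hence, under an
  integral, a chosen weak gradient can be replaced by any known one.\<close>

lemma weak_gradient_unique: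
  assumes "has_weak_gradient u g1" "has_weak_gradient u g2"
  shows "AE x in lebesgue. g1 x = g2 x"
proof -
  have "AE x in lebesgue. (g1 x - g2 x) \<bullet> b = 0" if b: "b \<in> Basis" for b
  proof (rule locally_integrable_zero_if_test_zero)
    have l: "locally_integrable g1" "locally_integrable g2" using assms by (auto simp: has_weak_gradient_def)
    show "locally_integrable (\<lambda>x. (g1 x - g2 x) \<bullet> b)"
      unfolding locally_integrable_def
    proof (intro allI impI)
      fix K :: "'a set" assume "compact K"
      then have "(\<lambda>x. g1 x - g2 x) absolutely_integrable_on K"
        using l by (auto simp: locally_integrable_def intro!: set_integral_diff)
      then show "(\<lambda>x. (g1 x - g2 x) \<bullet> b) absolutely_integrable_on K"
        by (rule absolutely_integrable_component)
    qed
    fix \<phi> :: "'a \<Rightarrow> real" assume \<phi>: "test_function \<phi>"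
    have i: "integrable lebesgue (\<lambda>x. (g1 x \<bullet> b) * \<phi> x)" "integrable lebesgue (\<lambda>x. (g2 x \<bullet> b) * \<phi> x)"
      using integrable_inner_left[of _ lebesgue, OF locally_integrable_times_C1c[OF l(1) test_function_C1c[OF \<phi>]], of b]
        integrable_inner_left[of _ lebesgue, OF locally_integrable_times_C1c[OF l(2) test_function_C1c[OF \<phi>]], of b]
      by (simp_all add: mult.commute)
    have "(LINT x|lebesgue. (g1 x - g2 x) \<bullet> b * \<phi> x) = (LINT x|lebesgue. (g1 x \<bullet> b) * \<phi> x) - (LINT x|lebesgue. (g2 x \<bullet> b) * \<phi> x)"
      using i by (simp add: inner_diff_left left_diff_distrib)
    also have "\<dots> = 0"
      using assms \<phi> b unfolding has_weak_gradient_def by (metis (no_types, lifting) add.inverse_inverse cancel_comm_monoid_add_class.diff_cancel)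
    finally show "(LINT x|lebesgue. (g1 x - g2 x) \<bullet> b * \<phi> x) = 0" .
  qed
  then have "AE x in lebesgue. \<forall>b\<in>Basis. (g1 x - g2 x) \<bullet> b = 0" by (intro AE_finite_allI) auto
  then show ?thesis by eventually_elim (simp add: euclidean_eq_iff[of "g1 _"] inner_diff_left)
qed

section \<open>From the minimiser to a weak solution\<close>

lemma locally_integrable_if_L2:
  assumes "L2 lborel f" shows "locally_integrable f"
  unfolding locally_integrable_def
proof (intro allI impI)
  fix K :: "'a set" assume K: "compact K"
  then have K': "K \<in> sets borel" by (rule borel_compact)
  have fm[measurable]: "f \<in> borel_measurable borel" using assms by (simp add: L2_def)
  have "integrable lborel (\<lambda>x. indicator K x *\<^sub>R f x)"
  proof (rule Bochner_Integration.integrable_bound)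
    show "integrable lborel (\<lambda>x. indicator K x + (norm (f x))\<^sup>2)"
      using K' emeasure_compact_finite[OF K] L2_integrable[OF assms] by (intro Bochner_Integration.integrable_add) auto
    show "(\<lambda>x. indicator K x *\<^sub>R f x) \<in> borel_measurable lborel" using K' by simp
    show "AE x in lborel. norm (indicator K x *\<^sub>R f x) \<le> norm (indicator K x + (norm (f x))\<^sup>2)"
    proof (intro AE_I2)
      fix x
      have "2 * norm (f x) \<le> 1 + (norm (f x))\<^sup>2"
        using zero_le_power2[of "norm (f x) - 1"] by (simp add: power2_diff)
      then have "norm (f x) \<le> 1 + (norm (f x))\<^sup>2" using norm_ge_zero[of "f x"] by linarith
      then show "norm (indicator K x *\<^sub>R f x) \<le> norm (indicator K x + (norm (f x))\<^sup>2)"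
        by (auto simp: indicator_def)
    qed
  qed
  then show "f absolutely_integrable_on K"
    unfolding set_integrable_def using K' by (subst integrable_completion) auto
qed

lemma locally_integrable_if_bounded:
  fixes f :: "'a::euclidean_space \<Rightarrow> real"
  assumes fm[measurable]: "f \<in> borel_measurable borel" and B: "\<And>x. \<bar>f x\<bar> \<le> B"
  shows "locally_integrable f"
  unfolding locally_integrable_def
proof (intro allI impI)
  fix K :: "'a set" assume K: "compact K"
  then have K': "K \<in> sets borel" by (rule borel_compact)
  have "integrable lborel (\<lambda>x. indicator K x *\<^sub>R f x)"
  proof (rule Bochner_Integration.integrable_bound)
    show "integrable lborel (\<lambda>x. indicator K x * B)"
      using K' emeasure_compact_finite[OF K] by (intro integrable_mult_left) auto
    show "(\<lambda>x. indicator K x *\<^sub>R f x) \<in> borel_measurable lborel" using K' by simp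
    show "AE x in lborel. norm (indicator K x *\<^sub>R f x) \<le> norm (indicator K x * B)"
      using B by (intro AE_I2) (auto simp: indicator_def intro: order_trans[OF B abs_ge_self])
  qed
  then show "f absolutely_integrable_on K"
    unfolding set_integrable_def using K' by (subst integrable_completion) auto
qed

lemma weak_gradient_AE_eq:
  assumes "has_weak_gradient u p" shows "AE x in lebesgue. weak_gradient u x = p x"
  using weak_gradient_unique[OF _ assms, of "weak_gradient u"] someI[of "has_weak_gradient u", OF assms]
  by (simp add: weak_gradient_def)

lemma primitive_deriv:
  assumes "continuous_on UNIV f" shows "(primitive f has_real_derivative f t) (at t)"
proof -
  define r where "r = \<bar>t\<bar> + 1"
  have "((\<lambda>x. LBINT s=ereal 0..ereal x. f s) has_vector_derivative f t) (at t within {-r..r})"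
    using interval_integral_FTC2[of "-r" 0 r f t] continuous_on_subset[OF assms] by (auto simp: r_def zero_ereal_def)
  moreover have "at t within {-r..r} = at t"
    by (rule at_within_interior) (auto simp: r_def)
  ultimately show ?thesis
    by (simp add: primitive_def[abs_def] has_real_derivative_iff_has_vector_derivative)
qed

lemma primitive_0: "primitive f 0 = 0"
  by (simp add: primitive_def)

lemma primitive_nonneg:
  assumes f: "continuous_on UNIV f" "\<And>t. 0 \<le> t \<Longrightarrow> 0 \<le> f t" and "0 \<le> t"
  shows "0 \<le> primitive f t"
proof (cases "t = 0")
  case False
  with \<open>0 \<le> t\<close> have "0 < t" by simp
  from MVT2[OF this, of "primitive f" f] obtain z where "0 < z" "primitive f t - primitive f 0 = (t - 0) * f z"
    using primitive_deriv[OF f(1)] by blast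
  then show ?thesis using f(2)[of z] \<open>0 < t\<close> by (simp add: primitive_0)
qed (simp add: primitive_0)

text \<open>The constant \<open>M\<close> is a supersolution, because \<open>f M + lam M\<^sup>q\<^sup>-\<^sup>1 \<le> V\<^sub>0 M / 2\<close>. So the nonlinearity can be
  kept constant outside \<open>[0, M]\<close>: the minimiser of the truncated energy takes its values in \<open>[0, M]\<close>, where
  nothing was changed.\<close>

theorem positive_solution:
  fixes q :: real and V :: "'a::euclidean_space \<Rightarrow> real" and f :: "real \<Rightarrow> real"
  assumes q: "1 < q" "q < 2"
    and V: "continuous_on UNIV V" "0 < V0" "\<And>x. V0 \<le> V x" "integrable lebesgue (\<lambda>x. 1 / V x)"
    and f: "continuous_on UNIV f" "f 0 = 0" "\<And>t. 0 \<le> t \<Longrightarrow> 0 \<le> f t"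
    and lam: "0 < lam" and M: "0 < M" "f M + lam * M powr (q - 1) \<le> V0 * M / 2"
  shows "\<exists>u. weak_solution V f q lam u \<and> (\<forall>x. 0 < u x) \<and> negative_energy V f q lam u"
proof -
  \<comment> \<open>The truncated nonlinearity, constant above \<open>M\<close> and zero below \<open>0\<close>.\<close>
  define c where "c t = max 0 (min M t)" for t :: real
  define g where "g t = f (c t) + lam * c t powr (q - 1)" for t
  define G where "G = primitive g"
  have c: "0 \<le> c t" "c t \<le> M" for t using M by (auto simp: c_def)
  have c_cont: "continuous_on UNIV c" unfolding c_def[abs_def] by (intro continuous_intros)
  have g_cont: "continuous_on UNIV g"
    unfolding g_def[abs_def] using q c
    by (intro continuous_on_add continuous_on_mult continuous_on_const continuous_on_powr' c_cont
        continuous_on_compose2[OF f(1) c_cont]) auto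
  have g_nn: "0 \<le> g t" for t unfolding g_def using c lam by (intro add_nonneg_nonneg mult_nonneg_nonneg f(3)) auto
  have "compact (g ` {0..M})" using g_cont by (intro compact_continuous_image) (auto intro: continuous_on_subset)
  then obtain C where C: "\<And>t. t \<in> {0..M} \<Longrightarrow> \<bar>g t\<bar> \<le> C"
    using compact_imp_bounded bounded_iff by (metis (no_types, lifting) image_eqI real_norm_def)
  have gc: "g (c t) = g t" for t using M by (simp add: g_def c_def)
  have g_bd: "\<bar>g t\<bar> \<le> C" for t using C[of "c t"] c[of t] by (simp add: gc)
  have g_neg: "g t = 0" if "t \<le> 0" for t using that M f(2) by (simp add: g_def c_def)
  have g_mid: "g t = f t + lam * t powr (q - 1)" if "0 \<le> t" "t \<le> M" for t using that by (simp add: g_def c_def)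
  have g_large: "g t \<le> V0 * M / 2" if "M \<le> t" for t using that M by (simp add: g_def c_def)
  have G_deriv: "(G has_real_derivative g t) (at t)" for t unfolding G_def by (rule primitive_deriv[OF g_cont])
  have G_0: "G 0 = 0" by (simp add: G_def primitive_0)
  have G_neg: "G t = 0" if "t \<le> 0" for t
  proof (cases "t = 0")
    case False
    with that have "t < 0" by simp
    from MVT2[OF this, of G g] obtain z where "z < 0" "G 0 - G t = (0 - t) * g z" using G_deriv by blast
    then show ?thesis using g_neg[of z] G_0 by simp
  qed (simp add: G_0)
  have F_deriv: "(primitive f has_real_derivative f t) (at t)" for t by (rule primitive_deriv[OF f(1)])
  have F_cont: "continuous_on UNIV (primitive f)"
    by (rule DERIV_continuous_on[OF has_field_derivative_at_within[OF F_deriv]])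
  have G_cont: "continuous_on UNIV G"
    by (rule DERIV_continuous_on[OF has_field_derivative_at_within[OF G_deriv]])
  have G_mid: "G t = primitive f t + lam / q * t powr q" if t: "0 \<le> t" "t \<le> M" for t
  proof -
    define H where "H t = G t - primitive f t - lam / q * t powr q" for t
    have "H t = H 0"
    proof (rule DERIV_isconst2[OF \<open>0 < M\<close> _ _ t])
      show "continuous_on {0..M} H"
        unfolding H_def[abs_def] using q
        by (intro continuous_on_diff continuous_on_mult continuous_on_const continuous_on_powr' continuous_on_id
            continuous_on_subset[OF G_cont] continuous_on_subset[OF F_cont]) auto
      fix s assume s: "0 < s" "s < M"
      have "(H has_real_derivative g s - f s - lam / q * (q * s powr (q - 1))) (at s)"
        unfolding H_def[abs_def]
        by (intro DERIV_diff G_deriv F_deriv DERIV_cmult has_real_derivative_powr s)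
      then show "(H has_real_derivative 0) (at s)" using g_mid[of s] s q by simp
    qed
    then show ?thesis by (simp add: H_def G_0 primitive_0)
  qed
  have V_cont_inv: "integrable lborel (\<lambda>x. 1 / V x)"
  proof -
    have [measurable]: "V \<in> borel_measurable borel" by (rule borel_measurable_continuous_onI[OF V(1)])
    have "(\<lambda>x. 1 / V x) \<in> borel_measurable lborel" by measurable
    from integrable_completion[OF this] V(4) show ?thesis by simp
  qed
  interpret truncated_problem V V0 g G C
    by unfold_locales (use V V_cont_inv G_deriv g_cont g_bd G_0 in auto)
  obtain \<phi> D u p where "\<And>n. C1c (\<phi> n) (D n)" "(\<lambda>n. J (\<phi> n) (D n)) \<longlonglongrightarrow> inf_J"
    "L2_lim lborel D p" "L2_lim lborel (\<lambda>n x. rV x * \<phi> n x) (\<lambda>x. rV x * u x)"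
    "AE x in lborel. (\<lambda>n. \<phi> n x) \<longlonglongrightarrow> u x" "u \<in> borel_measurable borel"
    by (rule minimizing_sequence) blast
  then interpret minimizer V V0 g G C \<phi> D u p by unfold_locales
  have inf_neg: "inf_J < 0"
  proof (rule inf_J_negative[OF q(1,2)])
    show "0 < lam / q" using lam q by simp
    show "lam / q * t powr q \<le> G t" if "0 \<le> t" "t \<le> M" for t
      using G_mid[OF that] primitive_nonneg[OF f(1,3), of t] that by simp
  qed (rule M)
  have u_bd: "AE x in lborel. 0 \<le> u x \<and> u x \<le> M"
    by (rule minimizer_bounds[OF \<open>0 < M\<close> G_neg g_large])
  have "\<not> (AE x in lborel. u x = 0)"
  proof
    assume u0: "AE x in lborel. u x = 0"
    have "(LINT x|lborel. G (u x)) = (LINT x|(lborel :: 'a measure). 0)"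
      by (rule integral_cong_AE) (use u0 in \<open>auto simp: G_0\<close>)
    then have "0 \<le> J u p" using E_nonneg[of u p] by (simp add: J_def)
    then show False using J_u inf_neg by simp
  qed
  moreover have "AE x in lborel. 0 \<le> u x" using u_bd by eventually_elim simp
  ultimately have u_pos: "AE x in lborel. 0 < u x"
    using strictly_positive_or_zero g_nn by auto
  \<comment> \<open>Strict positivity and the bound by \<open>M\<close> hold almost everywhere; on the exceptional null set the
     solution is redefined, so that they hold everywhere.\<close>
  define v where "v x = (if 0 < u x \<and> u x \<le> M then u x else M)" for x
  have v: "0 < v x" "v x \<le> M" for x using M by (auto simp: v_def)
  have v_m[measurable]: "v \<in> borel_measurable borel" unfolding v_def[abs_def] by measurable
  have vu: "AE x in lborel. v x = u x"
    using u_pos u_bd by eventually_elim (simp add: v_def)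
  have v_L2: "L2 lborel (\<lambda>x. rV x * v x)"
  proof (rule L2_bound[OF u_L2, where K=1])
    show "AE x in lborel. norm (rV x * v x) \<le> 1 * norm (rV x * u x)" using vu by eventually_elim simp
  qed measurable
  have v_L2': "L2 lborel v"
  proof (rule L2_bound[OF v_L2, where K="1 / sqrt V0"])
    show "AE x in lborel. norm (v x) \<le> 1 / sqrt V0 * norm (rV x * v x)"
    proof (intro AE_I2)
      fix x
      have "sqrt V0 \<le> rV x" using V(3) by simp
      then have "sqrt V0 * v x \<le> rV x * v x" using v[of x] by (intro mult_right_mono) auto
      then show "norm (v x) \<le> 1 / sqrt V0 * norm (rV x * v x)"
        using v[of x] V(2) by (simp add: abs_mult field_simps)
    qed
  qed measurable
  have cont_grad: "continuous_on UNIV (gradient \<eta>)" if "test_function \<eta>" for \<eta> :: "'a \<Rightarrow> real"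
    using C1cD[OF test_function_C1c[OF that]] by simp
  have to_lborel: "(LINT x|lebesgue. h x) = (LINT x|lborel. h x)" if "h \<in> borel_measurable borel" for h :: "'a \<Rightarrow> real"
    by (rule integral_completion) (use that in simp)
  have grad_m: "gradient \<eta> \<in> borel_measurable borel" "\<eta> \<in> borel_measurable borel" if "test_function \<eta>" for \<eta> :: "'a \<Rightarrow> real"
    using C1c_measurable[OF test_function_C1c[OF that]] by auto
  have wg: "has_weak_gradient v p"
    unfolding has_weak_gradient_def
  proof (intro conjI allI impI ballI)
    show "locally_integrable v" "locally_integrable p" using v_L2' p_L2 by (auto intro: locally_integrable_if_L2)
    fix \<eta> :: "'a \<Rightarrow> real" and b :: 'a assume \<eta>: "test_function \<eta>"
    note [measurable] = grad_m[OF \<eta>]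
    have "(LINT x|lebesgue. v x * (gradient \<eta> x \<bullet> b)) = (LINT x|lborel. v x * (gradient \<eta> x \<bullet> b))"
      by (rule to_lborel) measurable
    also have "\<dots> = (LINT x|lborel. u x * (gradient \<eta> x \<bullet> b))"
      by (rule integral_cong_AE) (use vu in \<open>auto elim!: eventually_mono\<close>)
    also have "\<dots> = - (LINT x|lborel. (p x \<bullet> b) * \<eta> x)"
      by (rule weak_gradient_limit[OF test_function_C1c[OF \<eta>]])
    also have "(LINT x|lborel. (p x \<bullet> b) * \<eta> x) = (LINT x|lebesgue. (p x \<bullet> b) * \<eta> x)"
      by (rule to_lborel[symmetric]) measurable
    finally show "(LINT x|lebesgue. v x * (gradient \<eta> x \<bullet> b)) = - (LINT x|lebesgue. (p x \<bullet> b) * \<eta> x)" .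
  qed
  have sq: "square_integrable h" if "L2 lborel h" for h :: "'a \<Rightarrow> 'c::euclidean_space"
    using that unfolding square_integrable_def L2_def by (auto simp: integrable_completion intro: measurable_completion)
  have wgp: "AE x in lebesgue. weak_gradient v x = p x" by (rule weak_gradient_AE_eq[OF wg])
  have p_leb: "p \<in> borel_measurable lebesgue" by (rule measurable_completion) simp
  have wg_m[measurable]: "weak_gradient v \<in> borel_measurable lebesgue"
    by (rule borel_measurable_AE[OF p_leb]) (use wgp in \<open>auto elim!: eventually_mono\<close>)
  have gv: "f (v x) + lam * \<bar>v x\<bar> powr (q - 2) * v x = g (v x)" for x
  proof -
    have "\<bar>v x\<bar> powr (q - 2) * v x = v x powr (q - 2) * v x powr 1" using v[of x] by simp
    also have "\<dots> = v x powr (q - 1)" by (subst powr_add[symmetric]) simp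
    finally show ?thesis using g_mid[of "v x"] v[of x] by (simp add: mult.assoc)
  qed
  have f_m[measurable]: "f \<in> borel_measurable borel" by (rule borel_measurable_continuous_onI[OF f(1)])
  have F_m[measurable]: "primitive f \<in> borel_measurable borel" by (rule borel_measurable_continuous_onI[OF F_cont])
  have "weak_solution V f q lam v"
    unfolding weak_solution_def
  proof (intro conjI allI impI)
    show "v \<in> sobolev_H1" unfolding sobolev_H1_def using sq[OF v_L2'] sq[OF p_L2] wg by blast
    have "integrable lborel (\<lambda>x. V x * \<bar>v x\<bar>\<^sup>2)" using L2_integrable[OF v_L2] by (simp add: power_mult_distrib)
    then show "integrable lebesgue (\<lambda>x. V x * \<bar>v x\<bar>\<^sup>2)" by (subst integrable_completion) auto
    show "locally_integrable (\<lambda>x. f (v x))"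
    proof (rule locally_integrable_if_bounded)
      show "\<bar>f (v x)\<bar> \<le> C" for x
        using g_bd[of "v x"] g_mid[of "v x"] v[of x] f(3)[of "v x"] lam
        by (smt (verit) mult_nonneg_nonneg powr_ge_zero)
    qed measurable
    fix \<eta> :: "'a \<Rightarrow> real" assume \<eta>: "test_function \<eta>"
    note [measurable] = grad_m[OF \<eta>]
    have gl: "gradient \<eta> \<in> borel_measurable lebesgue" by (rule measurable_completion) simp
    have "(LINT x|lebesgue. weak_gradient v x \<bullet> gradient \<eta> x) = (LINT x|lebesgue. p x \<bullet> gradient \<eta> x)"
      by (rule integral_cong_AE) (use wgp gl p_leb in \<open>auto elim!: eventually_mono\<close>)
    also have "\<dots> = (LINT x|lborel. p x \<bullet> gradient \<eta> x)" by (rule to_lborel) measurable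
    finally have 1: "(LINT x|lebesgue. weak_gradient v x \<bullet> gradient \<eta> x) = (LINT x|lborel. p x \<bullet> gradient \<eta> x)" .
    have "(LINT x|lebesgue. V x * v x * \<eta> x) = (LINT x|lborel. V x * v x * \<eta> x)" by (rule to_lborel) measurable
    also have "\<dots> = (LINT x|lborel. V x * u x * \<eta> x)"
      by (rule integral_cong_AE) (use vu in \<open>auto elim!: eventually_mono\<close>)
    finally have 2: "(LINT x|lebesgue. V x * v x * \<eta> x) = (LINT x|lborel. V x * u x * \<eta> x)" .
    have "(LINT x|lebesgue. g (v x) * \<eta> x) = (LINT x|lborel. g (v x) * \<eta> x)" by (rule to_lborel) measurable
    also have "\<dots> = (LINT x|lborel. g (u x) * \<eta> x)"
      by (rule integral_cong_AE) (use vu in \<open>auto elim!: eventually_mono\<close>)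
    finally have 3: "(LINT x|lebesgue. g (v x) * \<eta> x) = (LINT x|lborel. g (u x) * \<eta> x)" .
    show "(LINT x|lebesgue. weak_gradient v x \<bullet> gradient \<eta> x) + (LINT x|lebesgue. V x * v x * \<eta> x)
        = (LINT x|lebesgue. (f (v x) + lam * \<bar>v x\<bar> powr (q - 2) * v x) * \<eta> x)"
      unfolding gv 1 2 3 by (rule Euler_Lagrange[OF test_function_C1c[OF \<eta>]])
  qed
  moreover have "negative_energy V f q lam v"
  proof -
    have Gv: "G (v x) = primitive f (v x) + lam / q * \<bar>v x\<bar> powr q" for x using G_mid[of "v x"] v[of x] by simp
    have Gi: "integrable lborel (\<lambda>x. G (v x))" by (rule G_integrable[OF integrable_if_weighted_L2(1)[OF v_L2]])
    have Fnn: "0 \<le> primitive f (v x)" for x using primitive_nonneg[OF f(1,3), of "v x"] v[of x] by simp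
    have Fi: "integrable lborel (\<lambda>x. primitive f (v x))"
    proof (rule Bochner_Integration.integrable_bound[OF Gi])
      show "AE x in lborel. norm (primitive f (v x)) \<le> norm (G (v x))"
        using Fnn lam q by (intro AE_I2) (auto simp: Gv)
    qed measurable
    have Pi: "integrable lborel (\<lambda>x. \<bar>v x\<bar> powr q)"
    proof (rule Bochner_Integration.integrable_bound)
      show "integrable lborel (\<lambda>x. q / lam * G (v x))" using Gi by simp
      show "AE x in lborel. norm (\<bar>v x\<bar> powr q) \<le> norm (q / lam * G (v x))"
        using Fnn lam q by (intro AE_I2) (simp add: Gv field_simps)
    qed measurable
    have e1: "(LINT x|lebesgue. (norm (weak_gradient v x))\<^sup>2) = (LINT x|lborel. (norm (p x))\<^sup>2)"
    proof -
      have "(LINT x|lebesgue. (norm (weak_gradient v x))\<^sup>2) = (LINT x|lebesgue. (norm (p x))\<^sup>2)"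
        by (rule integral_cong_AE) (use wgp p_leb in \<open>auto elim!: eventually_mono\<close>)
      also have "\<dots> = (LINT x|lborel. (norm (p x))\<^sup>2)" by (rule to_lborel) measurable
      finally show ?thesis .
    qed
    have e2: "(LINT x|lebesgue. V x * \<bar>v x\<bar>\<^sup>2) = (LINT x|lborel. (rV x * u x)\<^sup>2)"
    proof -
      have "(LINT x|lebesgue. V x * \<bar>v x\<bar>\<^sup>2) = (LINT x|lborel. V x * \<bar>v x\<bar>\<^sup>2)" by (rule to_lborel) measurable
      also have "\<dots> = (LINT x|lborel. (rV x * u x)\<^sup>2)"
        by (rule integral_cong_AE) (use vu in \<open>auto elim!: eventually_mono simp: power_mult_distrib\<close>)
      finally show ?thesis .
    qed
    have e3: "(LINT x|lebesgue. primitive f (v x)) = (LINT x|lborel. primitive f (v x))" by (rule to_lborel) measurable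
    have e4: "(LINT x|lebesgue. \<bar>v x\<bar> powr q) = (LINT x|lborel. \<bar>v x\<bar> powr q)" by (rule to_lborel) measurable
    have "(LINT x|lborel. G (u x)) = (LINT x|lborel. G (v x))"
      by (rule integral_cong_AE) (use vu in \<open>auto elim!: eventually_mono\<close>)
    also have "\<dots> = (LINT x|lborel. primitive f (v x)) + lam / q * (LINT x|lborel. \<bar>v x\<bar> powr q)"
      unfolding Gv using Fi Pi by simp
    finally have "energy V f q lam v = J u p"
      unfolding energy_def e1 e2 e3 e4 J_def E_def by simp
    then have "energy V f q lam v < 0" using J_u inf_neg by simp
    moreover have "integrable lebesgue (\<lambda>x. primitive f (v x))"
      using Fi by (subst integrable_completion) auto
    ultimately show ?thesis by (simp add: negative_energy_def)
  qed
  ultimately show ?thesis using v by blast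
qed

text \<open>For small \<open>t\<close> one has \<open>f t < t\<^sup>\<nu> = t\<^sup>\<nu>\<^sup>-\<^sup>1 t\<close>, and \<open>\<nu> > 1\<close> makes the factor \<open>t\<^sup>\<nu>\<^sup>-\<^sup>1\<close> small.\<close>

lemma small_supersolution_constant:
  fixes f :: "real \<Rightarrow> real"
  assumes "1 < \<nu>" and lim: "((\<lambda>t. f t / \<bar>t\<bar> powr \<nu>) \<longlongrightarrow> 0) (at 0)" and "0 < e"
  shows "\<exists>M>0. f M \<le> e * M"
proof -
  have "\<forall>\<^sub>F t in at 0. f t / \<bar>t\<bar> powr \<nu> < 1" using order_tendstoD(2)[OF lim] by simp
  then obtain d where d: "0 < d" "\<And>t. t \<noteq> 0 \<Longrightarrow> \<bar>t\<bar> < d \<Longrightarrow> f t / \<bar>t\<bar> powr \<nu> < 1"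
    unfolding eventually_at by (auto simp: dist_real_def)
  define M where "M = min (d / 2) (e powr (1 / (\<nu> - 1)))"
  have M: "0 < M" "M < d" using d(1) \<open>0 < e\<close> by (auto simp: M_def)
  have "f M / M powr \<nu> < 1" using d(2)[of M] M by simp
  then have "f M < M powr \<nu>" using M by (simp add: field_simps)
  also have "M powr \<nu> = M powr (\<nu> - 1) * M"
    using M powr_add[of M "\<nu> - 1" 1] by simp
  also have "M powr (\<nu> - 1) \<le> (e powr (1 / (\<nu> - 1))) powr (\<nu> - 1)"
    using M \<open>1 < \<nu>\<close> by (intro powr_mono2) (auto simp: M_def)
  also have "\<dots> = e" using \<open>1 < \<nu>\<close> \<open>0 < e\<close> by (simp add: powr_powr)
  finally show ?thesis using M by (auto intro: less_imp_le)
qed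

theorem theorem1p3:
  fixes q :: real and V :: "real ^ 2 \<Rightarrow> real" and f :: "real \<Rightarrow> real"
  assumes "1 < q" and "q < 2"
    and "continuous_on UNIV V"
    and "\<exists>V0>0. \<forall>x. V0 \<le> V x"
    and "integrable lebesgue (\<lambda>x. 1 / V x)"
    and "continuous_on UNIV f"
    and "\<forall>t. f (- t) = - f t"
    and "f 0 = 0"
    and "\<forall>t\<ge>0. 0 \<le> f t"
    and "\<exists>\<nu>>1. ((\<lambda>t. f t / \<bar>t\<bar> powr \<nu>) \<longlongrightarrow> 0) (at 0)"
  shows "\<exists>\<Lambda>\<^sub>1>0. \<forall>lam. 0 < lam \<and> lam < \<Lambda>\<^sub>1 \<longrightarrow>
    (\<exists>u. weak_solution V f q lam u \<and> (\<forall>x. 0 < u x) \<and> negative_energy V f q lam u)"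
proof -
  obtain V0 where V0: "0 < V0" "\<And>x. V0 \<le> V x" using assms(4) by blast
  obtain \<nu> where \<nu>: "1 < \<nu>" "((\<lambda>t. f t / \<bar>t\<bar> powr \<nu>) \<longlongrightarrow> 0) (at 0)" using assms(10) by blast
  obtain M where M: "0 < M" "f M \<le> V0 / 4 * M"
    using small_supersolution_constant[OF \<nu>, of "V0 / 4"] V0(1) by auto
  \<comment> \<open>Both \<open>f M\<close> and \<open>lam * M powr (q - 1)\<close> take at most half of the room \<open>V0 * M / 2\<close>.\<close>
  define \<Lambda> where "\<Lambda> = V0 * M / (4 * M powr (q - 1))"
  show ?thesis
  proof (intro exI[of _ \<Lambda>] conjI allI impI)
    show "0 < \<Lambda>" using V0 M by (simp add: \<Lambda>_def)
    fix lam assume lam: "0 < lam \<and> lam < \<Lambda>"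
    have "lam * M powr (q - 1) \<le> \<Lambda> * M powr (q - 1)" using lam by (intro mult_right_mono) auto
    also have "\<dots> = V0 * M / 4" using M by (simp add: \<Lambda>_def)
    finally have "f M + lam * M powr (q - 1) \<le> V0 * M / 2" using M by simp
    then show "\<exists>u. weak_solution V f q lam u \<and> (\<forall>x. 0 < u x) \<and> negative_energy V f q lam u"
      using positive_solution[OF assms(1,2,3) V0 assms(5,6,8)] assms(9) lam M by blast
  qed
qed

end
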